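(* Let $n,m$ be positive integers and let $\mathbf{r}=(r_1,\dots,r_m)$, $\mathbf{s}=(s_1,\dots,s_m)$ be sequences of nonnegative integers with $r=r_1+\dots+r_m$ and $s=s_1+\dots+s_m$. Then \begin{multline*} |\mathrm{YB}(n,\mathbf{r},\mathbf{s})| = \left((r+s+1)n+m\binom n2+\sum_{i=1}^m r_is_i\right)! \prod_{i=1}^m \frac{F(r_i)F(s_i)}{F(n+r_i+s_i)}\\ \times \frac{2^n}{n!} \prod_{j=1}^n \frac{(jm)!!\, (2r+(j-1)m)!!\,(2s+(j-1)m)!!}{m!!\,(2r+2s+2+(n+j-2)m)!!}. \end{multline*}
   Context: $F(k)=1!\,2!\cdots(k-1)!$ (empty product $=1$, so $F(0)=F(1)=1$). For a nonnegative integer $k$, $k!!=\prod_{j=0}^{\lfloor (k-1)/2\rfloor}(k-2j)$, so $0!!=1$. For nonnegative integers $p,q$, the $(n,p,q)$-staircase is the set of cells $(i,j)$ (row $i$, column $j$) with $1\le i\le p+n$, $1\le j\le n+q$ and $i\le j+p$ (an $(p+n)\times(n+q)$ rectangle with the cells below the cells $(j+p,j)$, $1\le j\le n$, removed); the cell $(j+p,j)$ is its $j$th diagonal cell. Thus a row $i>p$ contains the diagonal cell $(i,i-p)$, a column $j\le n$ contains the diagonal cell $(j+p,j)$, and other rows/columns contain no diagonal cell. Let page $\lambda^{(i)}$ be the $(n,r_i,s_i)$-staircase, $1\le i\le m$, and identify, for each $1\le j\le n$, the $j$th diagonal cells of all pages into one cell. An $(n,\mathbf{r},\mathbf{s})$-Selberg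 book is a filling of the resulting cells with $1,2,\dots,N$, $N=(r+s+1)n+m\binom n2+\sum_i r_is_i$, each used once, such that in each page every non-diagonal cell has entry larger than the entry of the diagonal cell in its row (if its row contains one) and smaller than the entry of the diagonal cell in its column (if its column contains one). An $(n,\mathbf{r},\mathbf{s})$-Young book is such a Selberg book in which, in each page, entries increase from left to right along rows and from top to bottom along columns. $\mathrm{YB}(n,\mathbf{r},\mathbf{s})$ denotes the set of $(n,\mathbf{r},\mathbf{s})$-Young books. *)

theory Defs
  imports Complex_Main
begin

definition superfact :: "nat \<Rightarrow> nat" where
  "superfact k = (\<Prod>i\<in>{1..<k}. fact i)"

definition dfact :: "nat \<Rightarrow> nat" where
  "dfact k = (if k = 0 then 1 else (\<Prod>j\<in>{0..(k - 1) div 2}. k - 2 * j))"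

text \<open>Cells of a book: the identified diagonal cells (index j, 1 \<le> j \<le> n) and
  the non-diagonal cells (page p, row a, column b), pages indexed 0..m-1.\<close>
datatype cell = Diag nat | Off nat nat nat

definition in_stair :: "nat \<Rightarrow> nat \<Rightarrow> nat \<Rightarrow> nat \<Rightarrow> nat \<Rightarrow> bool" where
  "in_stair n p q a b \<longleftrightarrow> 1 \<le> a \<and> a \<le> p + n \<and> 1 \<le> b \<and> b \<le> n + q \<and> a \<le> b + p"

definition is_diag :: "nat \<Rightarrow> nat \<Rightarrow> nat \<Rightarrow> nat \<Rightarrow> bool" where
  "is_diag n p a b \<longleftrightarrow> 1 \<le> b \<and> b \<le> n \<and> a = b + p"

definition book_cells :: "nat \<Rightarrow> nat list \<Rightarrow> nat list \<Rightarrow> cell set" where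
  "book_cells n r s =
     {Diag j | j. 1 \<le> j \<and> j \<le> n} \<union>
     {Off p a b | p a b. p < length r \<and> in_stair n (r ! p) (s ! p) a b \<and> \<not> is_diag n (r ! p) a b}"

definition entry :: "(cell \<Rightarrow> nat) \<Rightarrow> nat \<Rightarrow> nat list \<Rightarrow> nat \<Rightarrow> nat \<Rightarrow> nat \<Rightarrow> nat" where
  "entry f n r p a b = (if is_diag n (r ! p) a b then f (Diag b) else f (Off p a b))"

definition book_size :: "nat \<Rightarrow> nat list \<Rightarrow> nat list \<Rightarrow> nat" where
  "book_size n r s = (sum_list r + sum_list s + 1) * n + length r * (n choose 2)
      + (\<Sum>i<length r. r ! i * s ! i)"

definition selberg_book :: "nat \<Rightarrow> nat list \<Rightarrow> nat list \<Rightarrow> (cell \<Rightarrow> nat) \<Rightarrow> bool" where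
  "selberg_book n r s f \<longleftrightarrow>
     bij_betw f (book_cells n r s) {1..book_size n r s} \<and>
     (\<forall>x. x \<notin> book_cells n r s \<longrightarrow> f x = 0) \<and>
     (\<forall>p a b. p < length r \<and> in_stair n (r ! p) (s ! p) a b \<and> \<not> is_diag n (r ! p) a b \<longrightarrow>
        (r ! p < a \<longrightarrow> f (Diag (a - r ! p)) < f (Off p a b)) \<and>
        (b \<le> n \<longrightarrow> f (Off p a b) < f (Diag b)))"

definition young_book :: "nat \<Rightarrow> nat list \<Rightarrow> nat list \<Rightarrow> (cell \<Rightarrow> nat) \<Rightarrow> bool" where
  "young_book n r s f \<longleftrightarrow> selberg_book n r s f \<and>
     (\<forall>p a b b'. p < length r \<and> in_stair n (r ! p) (s ! p) a b \<and> in_stair n (r ! p) (s ! p) a b'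
        \<and> b < b' \<longrightarrow> entry f n r p a b < entry f n r p a b') \<and>
     (\<forall>p a a' b. p < length r \<and> in_stair n (r ! p) (s ! p) a b \<and> in_stair n (r ! p) (s ! p) a' b
        \<and> a < a' \<longrightarrow> entry f n r p a b < entry f n r p a' b)"

text \<open>YB(n,r,s); fillings are extended by 0 outside the cell set so that this set is finite.\<close>
definition YB :: "nat \<Rightarrow> nat list \<Rightarrow> nat list \<Rightarrow> (cell \<Rightarrow> nat) set" where
  "YB n r s = {f. young_book n r s f}"

end

theory Submission
  imports Defs "HOL-Probability.Probability" "Jordan_Normal_Form.Determinant"
begin

text \<open>
  Young books are the linear extensions of a poset on the \<open>N\<close> cells, so their number is \<open>N!\<close> times the
  volume of the order polytope in the unit cube. Condition on the diagonal entries
  \<open>x\<^sub>1 < \<dots> < x\<^sub>n\<close>: the pages become independent. The entries of a page on consecutive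
  diagonals interlace, and integrating a Vandermonde determinant over an interlacing region gives a
  Vandermonde determinant again (a determinant of primitives). Hence the page with parameters \<open>p, q\<close>
  has volume proportional to \<open>\<Prod>x\<^sub>j\<^sup>p (1 - x\<^sub>j)\<^sup>q\<close> times the Vandermonde product of \<open>x\<close>. Multiplying over
  the \<open>m\<close> pages leaves a Selberg integral with \<open>\<gamma> = m / 2\<close> and integer exponents. Aomoto's recursion,
  obtained from integration by parts and symmetrization, lowers the exponent of \<open>x\<close> to \<open>0\<close>; there the
  boundary term at \<open>0\<close> of another integration by parts expresses the \<open>n\<close>-dimensional integral by an
  \<open>(n - 1)\<close>-dimensional one.
\<close>

section \<open>Uniform measure on the cube\<close>

text \<open>The final integrand contains the \<open>m\<close>-th power of an absolute Vandermonde
  product. For odd \<open>m\<close> this is no polynomial, and differentiating it brings in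
  quotients by \<open>x k - x j\<close>. Two facts tame them: \<open>0 < m\<close> keeps the
  quotients bounded, and adding the image under the swap of the two coordinates cancels the
  denominator. The resulting recursions have coefficients in steps of \<open>m / 2\<close>; doubled,
  they are integers in steps of \<open>m\<close>, the origin of the double factorials. Each drop in
  dimension leaves one factor 2, hence \<open>2 ^ n\<close>. The division by \<open>n!\<close> is
  the share of the increasing chamber in a symmetric integral. The superfactorials telescope:
  removing the main diagonal of a staircase lowers \<open>n + p + q\<close> by one and costs
  \<open>(p - 1)! (q - 1)! / (n + p + q - 1)!\<close> (truncated differences). The shape that
  remains depends on whether \<open>p\<close> and \<open>q\<close> vanish, hence four cases of the
  interlacing integral. The interval is open so that the artificial bounds 0 and 1 of the
  interlacing hold strictly at every point of the space.\<close>

definition unit_unif :: "real measure" where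
  "unit_unif = restrict_space lborel {0<..<1}"

abbreviation cube :: "'i set \<Rightarrow> ('i \<Rightarrow> real) measure" where
  "cube I \<equiv> Pi\<^sub>M I (\<lambda>_. unit_unif)"

lemma space_unit_unif [simp]: "space unit_unif = {0<..<1}"
  by (simp add: unit_unif_def space_restrict_space)

lemma prob_space_unit_unif: "prob_space unit_unif"
  by standard (simp add: unit_unif_def space_restrict_space emeasure_restrict_space)

lemma product_sigma_finite_unit_unif: "product_sigma_finite (\<lambda>_. unit_unif)"
  using prob_space_unit_unif prob_space_imp_sigma_finite by (simp add: product_sigma_finite_def)

lemmas cube_integral_insert = product_sigma_finite.product_integral_insert[OF product_sigma_finite_unit_unif]
lemmas cube_integral_prod = product_sigma_finite.product_integral_prod[OF product_sigma_finite_unit_unif]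
lemmas cube_nn_integral_fold = product_sigma_finite.product_nn_integral_fold[OF product_sigma_finite_unit_unif]

lemma prob_space_cube: "prob_space (cube I)"
  by (intro prob_space_PiM prob_space_unit_unif)

lemma measurable_unit_unif:
  "f \<in> borel_measurable borel \<Longrightarrow> f \<in> borel_measurable unit_unif"
  unfolding unit_unif_def by (intro measurable_restrict_space1) simp

lemma measurable_into_unit_unif: "f \<in> measurable M unit_unif \<Longrightarrow> f \<in> borel_measurable M"
  using measurable_comp[OF _ measurable_unit_unif[of "\<lambda>x. x"], of f M] by (simp add: comp_def)

lemma measurable_cube_component [measurable (raw)]:
  "i \<in> I \<Longrightarrow> (\<lambda>x. x i) \<in> borel_measurable (cube I)"
  by (rule measurable_into_unit_unif, rule measurable_component_singleton)

lemma space_cubeD: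
  assumes "x \<in> space (cube I)" "i \<in> I"
  shows "0 < x i" "x i < 1"
  using assms by (auto simp: space_PiM dest: PiE_mem)

lemma integrable_cubeI:
  fixes f :: "('i \<Rightarrow> real) \<Rightarrow> real"
  assumes "f \<in> borel_measurable (cube I)" "\<And>x. x \<in> space (cube I) \<Longrightarrow> \<bar>f x\<bar> \<le> B"
  shows "integrable (cube I) f"
proof -
  interpret prob_space "cube I" by (rule prob_space_cube)
  show ?thesis
  proof (rule integrable_const_bound)
    show "AE x in cube I. norm (f x) \<le> B"
      by (rule AE_I2) (unfold real_norm_def, rule assms(2))
  qed (rule assms(1))
qed

text \<open>The finite set \<open>S\<close> is meant for the corners of absolute values: there
  \<open>F\<close> need only be continuous and \<open>f\<close> may take any bounded value.
  Measurability and boundedness of \<open>f\<close> turn the gauge integral of the fundamental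
  theorem into a Lebesgue integral.\<close>

lemma integral_unit_unif_FTC:
  fixes F f :: "real \<Rightarrow> real"
  assumes "continuous_on {a..b} F" "finite S" "0 \<le> a" "a \<le> b" "b \<le> 1"
    and "\<And>t. t \<in> {a<..<b} - S \<Longrightarrow> (F has_real_derivative f t) (at t)"
    and "f \<in> borel_measurable borel" "\<And>t. t \<in> {a<..<b} \<Longrightarrow> \<bar>f t\<bar> \<le> B"
  shows "(\<integral>t. indicator {a<..<b} t * f t \<partial>unit_unif) = F b - F a"
proof -
  have hi: "(f has_integral (F b - F a)) {a..b}"
    by (rule fundamental_theorem_of_calculus_interior_strong[OF assms(2,4) _ assms(1)])
      (rule iffD1[OF has_real_derivative_iff_has_vector_derivative], rule assms(6))
  have si: "set_integrable lborel {a<..<b} f"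
    unfolding set_integrable_def
  proof (rule integrableI_bounded_set_indicator[where B=B])
    show "f \<in> borel_measurable lborel"
      using assms(7) by simp
    show "emeasure lborel {a<..<b} < \<infinity>"
      using assms(4) by simp
    show "AE t in lborel. t \<in> {a<..<b} \<longrightarrow> norm (f t) \<le> B"
      by (rule AE_I2) (unfold real_norm_def, blast intro: assms(8))
  qed simp
  have "(\<integral>t. indicator {a<..<b} t * f t \<partial>unit_unif)
      = (\<integral>t. indicator {0<..<1} t *\<^sub>R (indicator {a<..<b} t * f t) \<partial>lborel)"
    unfolding unit_unif_def by (subst integral_restrict_space) simp_all
  also have "\<dots> = (LINT t:{a<..<b}|lborel. f t)"
    unfolding set_lebesgue_integral_def
    by (rule Bochner_Integration.integral_cong) (use assms(3-5) in \<open>simp_all add: indicator_def\<close>)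
  also have "\<dots> = integral {a<..<b} f"
    by (rule set_borel_integral_eq_integral(2)[OF si])
  also have "\<dots> = F b - F a"
    using hi by (simp add: has_integral_Icc_iff_Ioo integral_unique)
  finally show ?thesis .
qed

text \<open>Points of a product space are \<open>undefined\<close> outside \<open>I\<close>, and
  \<open>p\<close> fixes everything outside \<open>I\<close>, so plain composition stays in the
  space and agrees with the reindexing map of product measures.\<close>

lemma comp_permutes_eq_restrict:
  assumes "p permutes I" "x \<in> space (cube I)"
  shows "x \<circ> p = (\<lambda>i\<in>I. x (p i))"
proof
  fix i
  show "(x \<circ> p) i = (\<lambda>i\<in>I. x (p i)) i"
  proof (cases "i \<in> I")
    case False
    then have "p i = i" "x i = undefined"
      using permutes_not_in[OF assms(1)] assms(2) PiE_arb[of x I] by (auto simp: space_PiM)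
    with False show ?thesis by simp
  qed simp
qed

lemma distr_cube_permute:
  assumes "finite I" "p permutes I"
  shows "distr (cube I) (cube I) (\<lambda>x. x \<circ> p) = cube I"
proof -
  have "distr (cube I) (cube I) (\<lambda>x. x \<circ> p) = distr (cube I) (cube I) (\<lambda>x. \<lambda>i\<in>I. x (p i))"
    by (rule distr_cong[OF refl refl]) (rule comp_permutes_eq_restrict[OF assms(2)])
  also have "\<dots> = cube I"
  proof (rule distr_PiM_reindex)
    show "inj_on p I" by (rule permutes_inj_on[OF assms(2)])
    show "p \<in> I \<rightarrow> I" using permutes_in_image[OF assms(2)] by blast
  qed (rule prob_space_unit_unif)
  finally show ?thesis .
qed

lemma measurable_cube_permute:
  assumes "finite I" "p permutes I"
  shows "(\<lambda>x. x \<circ> p) \<in> measurable (cube I) (cube I)"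
proof -
  have "(\<lambda>x. \<lambda>i\<in>I. x (p i)) \<in> measurable (cube I) (cube I)"
    by (rule measurable_restrict, rule measurable_component_singleton)
      (use permutes_in_image[OF assms(2)] in blast)
  then show ?thesis
    by (subst measurable_cong[OF comp_permutes_eq_restrict[OF assms(2)]])
qed

lemma nn_integral_cube_permute:
  assumes "finite I" "p permutes I" "f \<in> borel_measurable (cube I)"
  shows "(\<integral>\<^sup>+x. f (x \<circ> p) \<partial>cube I) = (\<integral>\<^sup>+x. f x \<partial>cube I)"
  using nn_integral_distr[OF measurable_cube_permute[OF assms(1,2)], of f] assms(3)
  unfolding distr_cube_permute[OF assms(1,2)] by simp

lemma integral_cube_permute:
  fixes f :: "_ \<Rightarrow> real"
  assumes "finite I" "p permutes I" "f \<in> borel_measurable (cube I)"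
  shows "(\<integral>x. f (x \<circ> p) \<partial>cube I) = (\<integral>x. f x \<partial>cube I)"
  using integral_distr[OF measurable_cube_permute[OF assms(1,2)] assms(3)]
  unfolding distr_cube_permute[OF assms(1,2)] by (rule sym)

section \<open>The Selberg integral\<close>

text \<open>The index type need not be ordered: the product runs over ordered pairs, hence the square root.\<close>

definition abs_vandermonde :: "'i set \<Rightarrow> ('i \<Rightarrow> real) \<Rightarrow> real" where
  "abs_vandermonde I x = sqrt (\<Prod>i\<in>I. \<Prod>j\<in>I - {i}. \<bar>x i - x j\<bar>)"

lemma abs_vandermonde_empty [simp]: "abs_vandermonde {} x = 1"
  by (simp add: abs_vandermonde_def)

text \<open>Every pair containing \<open>k\<close> occurs in both orders, so its factor enters
  squared under the root.\<close>

lemma abs_vandermonde_insert: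
  assumes "finite I" "k \<notin> I"
  shows "abs_vandermonde (insert k I) x = (\<Prod>j\<in>I. \<bar>x k - x j\<bar>) * abs_vandermonde I x"
proof -
  have "(\<Prod>j\<in>insert k I - {i}. \<bar>x i - x j\<bar>) = \<bar>x k - x i\<bar> * (\<Prod>j\<in>I - {i}. \<bar>x i - x j\<bar>)"
    if "i \<in> I" for i
  proof -
    have "insert k I - {i} = insert k (I - {i})" using that assms by auto
    then show ?thesis using assms by (simp add: abs_minus_commute)
  qed
  then have "(\<Prod>i\<in>insert k I. \<Prod>j\<in>insert k I - {i}. \<bar>x i - x j\<bar>)
      = (\<Prod>j\<in>I. \<bar>x k - x j\<bar>) * (\<Prod>i\<in>I. \<bar>x k - x i\<bar> * (\<Prod>j\<in>I - {i}. \<bar>x i - x j\<bar>))"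
    using assms by (subst prod.insert) (auto intro!: prod.cong arg_cong2[where f="(*)"])
  also have "\<dots> = (\<Prod>j\<in>I. \<bar>x k - x j\<bar>)\<^sup>2 * (\<Prod>i\<in>I. \<Prod>j\<in>I - {i}. \<bar>x i - x j\<bar>)"
    by (simp add: prod.distrib power2_eq_square)
  finally show ?thesis
    by (simp add: abs_vandermonde_def real_sqrt_mult prod_nonneg)
qed

lemma abs_vandermonde_nonneg: "0 \<le> abs_vandermonde I x"
  by (simp add: abs_vandermonde_def prod_nonneg)

lemma abs_vandermonde_le_1:
  assumes "x \<in> space (cube I)"
  shows "abs_vandermonde I x \<le> 1"
proof -
  have "\<bar>x i - x j\<bar> \<le> 1" if "i \<in> I" "j \<in> I" for i j
    using space_cubeD[OF assms that(1)] space_cubeD[OF assms that(2)] by linarith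
  then have "(\<Prod>i\<in>I. \<Prod>j\<in>I - {i}. \<bar>x i - x j\<bar>) \<le> 1"
    by (intro prod_le_1 conjI prod_nonneg) auto
  then show ?thesis by (simp add: abs_vandermonde_def)
qed

lemma abs_vandermonde_permute:
  assumes "p permutes I"
  shows "abs_vandermonde I (x \<circ> p) = abs_vandermonde I x"
proof -
  have b: "bij_betw p I I" using assms by (rule permutes_imp_bij)
  have inner: "(\<Prod>j\<in>I - {i}. \<bar>x (p i) - x (p j)\<bar>) = (\<Prod>j\<in>I - {p i}. \<bar>x (p i) - x j\<bar>)"
    if "i \<in> I" for i
  proof (rule prod.reindex_bij_betw)
    show "bij_betw p (I - {i}) (I - {p i})"
      using bij_betw_DiffI[OF b, of "{i}" "{p i}"] that permutes_in_image[OF assms, of i] by simp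
  qed
  have "(\<Prod>i\<in>I. \<Prod>j\<in>I - {i}. \<bar>(x \<circ> p) i - (x \<circ> p) j\<bar>)
      = (\<Prod>i\<in>I. \<Prod>j\<in>I - {p i}. \<bar>x (p i) - x j\<bar>)"
    by (intro prod.cong[OF refl]) (simp add: inner)
  also have "\<dots> = (\<Prod>i\<in>I. \<Prod>j\<in>I - {i}. \<bar>x i - x j\<bar>)"
    by (rule prod.reindex_bij_betw[OF b])
  finally show ?thesis by (simp only: abs_vandermonde_def)
qed

lemma abs_vandermonde_eq_0:
  assumes "finite I" "i \<in> I" "j \<in> I" "i \<noteq> j" "x i = x j"
  shows "abs_vandermonde I x = 0"
proof -
  have "(\<Prod>j\<in>I - {i}. \<bar>x i - x j\<bar>) = 0"
    using assms by (intro prod_zero) auto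
  then have "(\<Prod>i\<in>I. \<Prod>j\<in>I - {i}. \<bar>x i - x j\<bar>) = 0"
    using assms by (intro prod_zero) auto
  then show ?thesis by (simp add: abs_vandermonde_def)
qed

lemma measurable_abs_vandermonde [measurable (raw)]:
  assumes "I \<subseteq> J"
  shows "abs_vandermonde I \<in> borel_measurable (cube J)"
proof -
  have [measurable]: "(\<lambda>x. x i) \<in> borel_measurable (cube J)" if "i \<in> I" for i
    using assms that by (auto intro: measurable_cube_component)
  show ?thesis unfolding abs_vandermonde_def[abs_def] by measurable
qed

text \<open>The exponent of \<open>x i\<close> varies with the coordinate because Aomoto's recursion
  raises the coordinates one at a time.\<close>

definition selberg_density :: "('i \<Rightarrow> nat) \<Rightarrow> nat \<Rightarrow> nat \<Rightarrow> 'i set \<Rightarrow> ('i \<Rightarrow> real) \<Rightarrow> real" where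
  "selberg_density e b m I x = (\<Prod>i\<in>I. x i ^ e i * (1 - x i) ^ b) * abs_vandermonde I x ^ m"

lemma prod_weight_bounds:
  assumes "x \<in> space (cube J)" "I \<subseteq> J"
  shows "0 \<le> (\<Prod>i\<in>I. x i ^ e i * (1 - x i) ^ b)" "(\<Prod>i\<in>I. x i ^ e i * (1 - x i) ^ b) \<le> 1"
proof -
  have "0 \<le> x i ^ e i * (1 - x i) ^ b \<and> x i ^ e i * (1 - x i) ^ b \<le> 1" if "i \<in> I" for i
    using space_cubeD[OF assms(1), of i] assms(2) that
    by (auto intro!: mult_le_one power_le_one)
  then show "0 \<le> (\<Prod>i\<in>I. x i ^ e i * (1 - x i) ^ b)" "(\<Prod>i\<in>I. x i ^ e i * (1 - x i) ^ b) \<le> 1"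
    by (auto intro!: prod_nonneg prod_le_1)
qed

lemma selberg_density_bounds:
  assumes "x \<in> space (cube I)"
  shows "0 \<le> selberg_density e b m I x" "selberg_density e b m I x \<le> 1"
  using prod_weight_bounds[OF assms subset_refl] abs_vandermonde_le_1[OF assms] abs_vandermonde_nonneg[of I x]
  by (auto simp: selberg_density_def intro!: mult_le_one power_le_one)

lemma measurable_selberg_density [measurable]:
  "selberg_density e b m I \<in> borel_measurable (cube I)"
  unfolding selberg_density_def[abs_def] by measurable

lemma integrable_selberg_density: "integrable (cube I) (selberg_density e b m I)"
proof (rule integrable_cubeI[OF measurable_selberg_density])
  fix x assume "x \<in> space (cube I)"
  from selberg_density_bounds[OF this, of e b m] show "\<bar>selberg_density e b m I x\<bar> \<le> 1" by simp
qed

lemma selberg_density_permute: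
  assumes "p permutes I"
  shows "selberg_density (e \<circ> p) b m I (x \<circ> p) = selberg_density e b m I x"
proof -
  have "(\<Prod>i\<in>I. x (p i) ^ e (p i) * (1 - x (p i)) ^ b) = (\<Prod>i\<in>I. x i ^ e i * (1 - x i) ^ b)"
    by (rule prod.reindex_bij_betw[OF permutes_imp_bij[OF assms]])
  then show ?thesis by (simp add: selberg_density_def abs_vandermonde_permute[OF assms])
qed

section \<open>Integration by parts in one coordinate\<close>

lemma prod_abs_power_div_le_1:
  fixes d :: "'i \<Rightarrow> real"
  assumes "finite I" "j \<in> I" "0 < m" "\<And>i. i \<in> I \<Longrightarrow> \<bar>d i\<bar> \<le> 1"
  shows "\<bar>(\<Prod>i\<in>I. \<bar>d i\<bar> ^ m) / d j\<bar> \<le> 1"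
proof -
  obtain l where m: "m = Suc l" using assms(3) by (cases m) auto
  \<comment> \<open>One of the \<open>m\<close> factors \<open>|d j|\<close> pays for the division;
    for \<open>d j = 0\<close> the quotient is 0 by convention.\<close>
  have "\<bar>(\<Prod>i\<in>I. \<bar>d i\<bar> ^ m) / d j\<bar> = (\<bar>d j\<bar> ^ m / \<bar>d j\<bar>) * (\<Prod>i\<in>I - {j}. \<bar>d i\<bar> ^ m)"
    using assms by (subst prod.remove[of I j]) (auto simp: abs_mult abs_prod)
  also have "\<dots> \<le> 1"
  proof (rule mult_le_one)
    show "\<bar>d j\<bar> ^ m / \<bar>d j\<bar> \<le> 1"
      using assms(4)[OF assms(2)] by (cases "d j = 0") (auto simp: m power_le_one)
    show "(\<Prod>i\<in>I - {j}. \<bar>d i\<bar> ^ m) \<le> 1"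
      using assms(4) by (intro prod_le_1 conjI power_le_one) auto
  qed (intro prod_nonneg, simp)
  finally show ?thesis .
qed

text \<open>Written as a logarithmic derivative, the formula needs no distinction of signs, and a
  product of such factors differentiates by summing the quotients.\<close>

lemma has_real_derivative_abs_power:
  fixes t c :: real
  assumes "t \<noteq> c"
  shows "((\<lambda>t. \<bar>t - c\<bar> ^ m) has_real_derivative \<bar>t - c\<bar> ^ m * (m / (t - c))) (at t)"
proof (cases m)
  case (Suc l)
  have abs': "((\<lambda>t. \<bar>t - c\<bar>) has_real_derivative sgn (t - c)) (at t)"
  proof (cases "t < c")
    case True
    have "((\<lambda>t. c - t) has_real_derivative -1) (at t)"
      by (auto intro!: derivative_eq_intros)
    then have "((\<lambda>t. \<bar>t - c\<bar>) has_real_derivative -1) (at t)"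
      by (rule has_field_derivative_transform_within_open[where S="{..<c}"]) (use True in auto)
    then show ?thesis using True by simp
  next
    case False
    have "((\<lambda>t. t - c) has_real_derivative 1) (at t)"
      by (auto intro!: derivative_eq_intros)
    then have "((\<lambda>t. \<bar>t - c\<bar>) has_real_derivative 1) (at t)"
      by (rule has_field_derivative_transform_within_open[where S="{c<..}"]) (use False assms in auto)
    then show ?thesis using False assms by simp
  qed
  have "((\<lambda>t. \<bar>t - c\<bar> ^ m) has_real_derivative of_nat m * (sgn (t - c) * \<bar>t - c\<bar> ^ (m - Suc 0))) (at t)"
    using DERIV_power[OF abs', of m] by (simp add: algebra_simps)
  also have "of_nat m * (sgn (t - c) * \<bar>t - c\<bar> ^ (m - Suc 0)) = \<bar>t - c\<bar> ^ m * (m / (t - c))"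
    using assms by (simp add: Suc sgn_if field_simps)
  finally show ?thesis .
qed simp

lemma has_real_derivative_prod_abs_power:
  fixes t :: real
  assumes "finite I" "\<And>j. j \<in> I \<Longrightarrow> t \<noteq> c j"
  shows "((\<lambda>t. \<Prod>j\<in>I. \<bar>t - c j\<bar> ^ m) has_real_derivative
    (\<Prod>j\<in>I. \<bar>t - c j\<bar> ^ m) * (\<Sum>j\<in>I. m / (t - c j))) (at t)"
  using assms
proof (induction I rule: finite_induct)
  case (insert i I)
  have 1: "((\<lambda>t. \<bar>t - c i\<bar> ^ m) has_real_derivative \<bar>t - c i\<bar> ^ m * (m / (t - c i))) (at t)"
    by (rule has_real_derivative_abs_power) (use insert in auto)
  have 2: "((\<lambda>t. \<Prod>j\<in>I. \<bar>t - c j\<bar> ^ m) has_real_derivative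
    (\<Prod>j\<in>I. \<bar>t - c j\<bar> ^ m) * (\<Sum>j\<in>I. m / (t - c j))) (at t)"
    using insert by blast
  from DERIV_mult[OF 1 2] show ?case
    using insert.hyps by (simp add: algebra_simps)
qed simp

lemma integral_unit_unif_FTC01:
  fixes F f :: "real \<Rightarrow> real"
  assumes "continuous_on {0..1} F" "finite S"
    and "\<And>t. t \<in> {0<..<1} - S \<Longrightarrow> (F has_real_derivative f t) (at t)"
    and "f \<in> borel_measurable borel" "\<And>t. t \<in> {0<..<1} \<Longrightarrow> \<bar>f t\<bar> \<le> B"
  shows "(\<integral>t. f t \<partial>unit_unif) = F 1 - F 0"
proof -
  have "(\<integral>t. f t \<partial>unit_unif) = (\<integral>t. indicator {0<..<1} t * f t \<partial>unit_unif)"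
    by (rule Bochner_Integration.integral_cong) auto
  also have "\<dots> = F 1 - F 0"
    by (rule integral_unit_unif_FTC[OF assms(1,2) _ _ _ assms(3,4,5)]) auto
  finally show ?thesis .
qed

text \<open>Where \<open>x k = x j\<close> the quotients below have the junk value \<open>0\<close>; this affects only finitely many
  values of \<open>x k\<close>.\<close>

lemma selberg_integration_by_parts:
  fixes v v' :: "real \<Rightarrow> real" and e :: "'i \<Rightarrow> nat" and b :: nat
  assumes "finite I" "k \<notin> I" "0 < m"
    and v: "\<And>t. (v has_real_derivative v' t) (at t)" and v'_cont: "continuous_on UNIV v'"
  defines "w \<equiv> \<lambda>x. \<Prod>i\<in>I. x i ^ e i * (1 - x i) ^ b"
  shows "integrable (cube (insert k I))
      (\<lambda>x. w x * abs_vandermonde (insert k I) x ^ m * v' (x k))" (is ?int1)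
    and "\<And>j. j \<in> I \<Longrightarrow> integrable (cube (insert k I))
      (\<lambda>x. w x * abs_vandermonde (insert k I) x ^ m * v (x k) / (x k - x j))" (is "\<And>j. _ \<Longrightarrow> ?int2 j")
    and "(\<integral>x. w x * abs_vandermonde (insert k I) x ^ m * v' (x k) \<partial>cube (insert k I))
      + m * (\<Sum>j\<in>I. \<integral>x. w x * abs_vandermonde (insert k I) x ^ m * v (x k) / (x k - x j) \<partial>cube (insert k I))
      = (\<integral>x. w x * abs_vandermonde I x ^ m *
           (v 1 * (\<Prod>j\<in>I. \<bar>1 - x j\<bar> ^ m) - v 0 * (\<Prod>j\<in>I. \<bar>0 - x j\<bar> ^ m)) \<partial>cube I)"
proof -
  let ?J = "insert k I"
  have v_cont: "continuous_on UNIV v"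
    using v by (intro continuous_at_imp_continuous_on ballI) (auto intro: DERIV_isCont)
  have [measurable]: "v \<in> borel_measurable borel" "v' \<in> borel_measurable borel"
    using v_cont v'_cont by (auto intro: borel_measurable_continuous_onI)
  obtain B1 where B1: "\<And>t. t \<in> {0..1} \<Longrightarrow> \<bar>v t\<bar> \<le> B1"
  proof -
    have "bounded (v ` {0..1})"
      by (intro compact_imp_bounded compact_continuous_image continuous_on_subset[OF v_cont]) auto
    then obtain a where "\<forall>t\<in>{0..1}. \<bar>v t\<bar> \<le> a" unfolding bounded_iff by auto
    then show ?thesis using that by blast
  qed
  obtain B2 where B2: "\<And>t. t \<in> {0..1} \<Longrightarrow> \<bar>v' t\<bar> \<le> B2"
  proof -
    have "bounded (v' ` {0..1})"
      by (intro compact_imp_bounded compact_continuous_image continuous_on_subset[OF v'_cont]) auto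
    then obtain a where "\<forall>t\<in>{0..1}. \<bar>v' t\<bar> \<le> a" unfolding bounded_iff by auto
    then show ?thesis using that by blast
  qed
  have B_nonneg: "0 \<le> B1" "0 \<le> B2"
    using B1[of 0] B2[of 0] by auto
  have [measurable]: "w \<in> borel_measurable (cube ?J)"
    unfolding w_def by measurable
  have V: "abs_vandermonde ?J x ^ m = (\<Prod>j\<in>I. \<bar>x k - x j\<bar> ^ m) * abs_vandermonde I x ^ m" for x
    using assms(1,2) by (simp add: abs_vandermonde_insert power_mult_distrib prod_power_distrib)
  have xd: "\<bar>x k - x j\<bar> \<le> 1" if "x \<in> space (cube ?J)" "j \<in> I" for x j
    using space_cubeD[OF that(1), of k] space_cubeD[OF that(1), of j] that(2) by auto
  have rest: "\<bar>w x * abs_vandermonde I x ^ m\<bar> \<le> 1" if "x \<in> space (cube ?J)" for x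
  proof -
    \<comment> \<open>The bound for \<open>abs_vandermonde I\<close> is stated on
      \<open>cube I\<close>, and its value depends on the coordinates in \<open>I\<close>
      only.\<close>
    have "restrict x I \<in> space (cube I)"
      using that by (auto simp: space_PiM)
    from abs_vandermonde_le_1[OF this] have "abs_vandermonde I x \<le> 1"
      by (simp add: abs_vandermonde_def)
    then have "abs_vandermonde I x ^ m \<le> 1"
      by (intro power_le_one abs_vandermonde_nonneg)
    with prod_weight_bounds[OF that subset_insertI, of e b] abs_vandermonde_nonneg[of I x] show ?thesis
      by (auto simp: w_def abs_mult intro!: mult_le_one)
  qed
  have b1: "\<bar>w x * abs_vandermonde ?J x ^ m * v' (x k)\<bar> \<le> B2" if x: "x \<in> space (cube ?J)" for x
  proof -
    have "\<bar>\<Prod>j\<in>I. \<bar>x k - x j\<bar> ^ m\<bar> \<le> 1"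
      using xd[OF x] by (auto simp: abs_prod intro!: prod_le_1 power_le_one)
    with rest[OF x] have "\<bar>(w x * abs_vandermonde I x ^ m) * (\<Prod>j\<in>I. \<bar>x k - x j\<bar> ^ m)\<bar> \<le> 1"
      unfolding abs_mult[of "w x * abs_vandermonde I x ^ m"] by (intro mult_le_one) auto
    moreover have "\<bar>v' (x k)\<bar> \<le> B2" using B2 space_cubeD[OF x, of k] by simp
    ultimately have "\<bar>(w x * abs_vandermonde I x ^ m) * (\<Prod>j\<in>I. \<bar>x k - x j\<bar> ^ m)\<bar> * \<bar>v' (x k)\<bar> \<le> 1 * B2"
      by (intro mult_mono) auto
    then show ?thesis by (simp add: V abs_mult mult_ac)
  qed
  show ?int1
    by (rule integrable_cubeI[OF _ b1]) measurable
  have b2: "\<bar>w x * abs_vandermonde ?J x ^ m * v (x k) / (x k - x j)\<bar> \<le> B1"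
    if x: "x \<in> space (cube ?J)" and j: "j \<in> I" for x j
  proof -
    have "\<bar>(\<Prod>i\<in>I. \<bar>x k - x i\<bar> ^ m) / (x k - x j)\<bar> \<le> 1"
      by (rule prod_abs_power_div_le_1[OF assms(1) j assms(3)]) (rule xd[OF x])
    with rest[OF x] have "\<bar>(w x * abs_vandermonde I x ^ m) * ((\<Prod>j\<in>I. \<bar>x k - x j\<bar> ^ m) / (x k - x j))\<bar> \<le> 1"
      unfolding abs_mult[of "w x * abs_vandermonde I x ^ m"] by (intro mult_le_one) auto
    moreover have "\<bar>v (x k)\<bar> \<le> B1" using B1 space_cubeD[OF x, of k] by simp
    ultimately have "\<bar>(w x * abs_vandermonde I x ^ m) * ((\<Prod>j\<in>I. \<bar>x k - x j\<bar> ^ m) / (x k - x j))\<bar> * \<bar>v (x k)\<bar> \<le> 1 * B1"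
      by (intro mult_mono) auto
    then show ?thesis by (simp add: V abs_mult mult_ac)
  qed
  show int2: "?int2 j" if "j \<in> I" for j
  proof (rule integrable_cubeI[OF _ b2[OF _ that]])
    have [measurable]: "(\<lambda>x. x j) \<in> borel_measurable (cube ?J)" by (rule measurable_cube_component) (use that in simp)
    show "(\<lambda>x. w x * abs_vandermonde ?J x ^ m * v (x k) / (x k - x j)) \<in> borel_measurable (cube ?J)"
      by measurable
  qed
  \<comment> \<open>Away from coinciding coordinates, \<open>g\<close> is the partial derivative in
    \<open>x k\<close> of \<open>w x * abs_vandermonde ?J x ^ m * v (x k)\<close>.\<close>
  define g where "g x = w x * abs_vandermonde ?J x ^ m * v' (x k)
    + m * (\<Sum>j\<in>I. w x * abs_vandermonde ?J x ^ m * v (x k) / (x k - x j))" for x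
  have g_int: "integrable (cube ?J) g"
    unfolding g_def[abs_def] using \<open>?int1\<close> int2 by auto
  have "(\<integral>x. w x * abs_vandermonde ?J x ^ m * v' (x k) \<partial>cube ?J)
      + m * (\<Sum>j\<in>I. \<integral>x. w x * abs_vandermonde ?J x ^ m * v (x k) / (x k - x j) \<partial>cube ?J)
      = (\<integral>x. g x \<partial>cube ?J)"
    unfolding g_def using \<open>?int1\<close> int2
    by (subst Bochner_Integration.integral_add)
      (auto simp: Bochner_Integration.integral_sum)
  also have "\<dots> = (\<integral>x. \<integral>t. g (x(k := t)) \<partial>unit_unif \<partial>cube I)"
    by (rule cube_integral_insert[OF assms(1,2) g_int])
  also have "\<dots> = (\<integral>x. w x * abs_vandermonde I x ^ m *
           (v 1 * (\<Prod>j\<in>I. \<bar>1 - x j\<bar> ^ m) - v 0 * (\<Prod>j\<in>I. \<bar>0 - x j\<bar> ^ m)) \<partial>cube I)"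
  proof (rule Bochner_Integration.integral_cong[OF refl])
    fix x assume x: "x \<in> space (cube I)"
    have upd: "w (x(k := t)) = w x" "abs_vandermonde I (x(k := t)) = abs_vandermonde I x"
      "(\<Prod>j\<in>I. \<bar>t - (x(k := t)) j\<bar> ^ m) = (\<Prod>j\<in>I. \<bar>t - x j\<bar> ^ m)" for t
    proof -
      have "(x(k := t)) i = x i" if "i \<in> I" for i using that assms(2) by auto
      then show "w (x(k := t)) = w x" "abs_vandermonde I (x(k := t)) = abs_vandermonde I x"
        "(\<Prod>j\<in>I. \<bar>t - (x(k := t)) j\<bar> ^ m) = (\<Prod>j\<in>I. \<bar>t - x j\<bar> ^ m)"
        unfolding w_def abs_vandermonde_def
        by (auto intro!: prod.cong arg_cong[where f=sqrt] simp del: fun_upd_apply)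
    qed
    define h where "h t = (\<Prod>j\<in>I. \<bar>t - x j\<bar> ^ m) * (v' t + m * (\<Sum>j\<in>I. v t / (t - x j)))" for t
    have gh: "g (x(k := t)) = w x * abs_vandermonde I x ^ m * h t" for t
    proof -
      have *: "(\<Sum>j\<in>I. c * v t / (t - (x(k := t)) j)) = (\<Sum>j\<in>I. c * v t / (t - x j))" for c
        using assms(2) by (intro sum.cong) auto
      show ?thesis
        unfolding g_def V upd fun_upd_same h_def *
        by (simp add: algebra_simps sum_distrib_left)
    qed
    \<comment> \<open>The primitive, \<open>v t\<close> times the product of the
      \<open>|t - x j| ^ m\<close>, is continuous and can fail to be differentiable only at the
      finitely many points \<open>x j\<close>.\<close>
    have "(\<integral>t. h t \<partial>unit_unif) = v 1 * (\<Prod>j\<in>I. \<bar>1 - x j\<bar> ^ m) - v 0 * (\<Prod>j\<in>I. \<bar>0 - x j\<bar> ^ m)"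
    proof (rule integral_unit_unif_FTC01[where S="x ` I"])
      show "continuous_on {0..1} (\<lambda>t. v t * (\<Prod>j\<in>I. \<bar>t - x j\<bar> ^ m))"
        by (intro continuous_intros continuous_on_subset[OF v_cont]) auto
      show "finite (x ` I)" using assms(1) by simp
      show "((\<lambda>t. v t * (\<Prod>j\<in>I. \<bar>t - x j\<bar> ^ m)) has_real_derivative h t) (at t)"
        if "t \<in> {0<..<1} - x ` I" for t
      proof -
        have "((\<lambda>t. \<Prod>j\<in>I. \<bar>t - x j\<bar> ^ m) has_real_derivative
            (\<Prod>j\<in>I. \<bar>t - x j\<bar> ^ m) * (\<Sum>j\<in>I. m / (t - x j))) (at t)"
          by (rule has_real_derivative_prod_abs_power[OF assms(1)]) (use that in auto)
        from DERIV_mult[OF v this] show ?thesis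
          by (rule DERIV_cong) (simp add: h_def algebra_simps sum_distrib_left sum_distrib_right)
      qed
      show "h \<in> borel_measurable borel"
        unfolding h_def[abs_def] by measurable
      show "\<bar>h t\<bar> \<le> B2 + m * (card I * B1)" if t: "t \<in> {0<..<1}" for t
      proof -
        let ?P = "\<Prod>j\<in>I. \<bar>t - x j\<bar> ^ m"
        have d: "\<bar>t - x j\<bar> \<le> 1" if "j \<in> I" for j
          using space_cubeD[OF x that] t by auto
        have P1: "\<bar>?P\<bar> \<le> 1"
          using d by (auto simp: abs_prod intro!: prod_le_1 power_le_one)
        have vt: "\<bar>v t\<bar> \<le> B1" "\<bar>v' t\<bar> \<le> B2" using B1 B2 t by auto
        have "\<bar>?P / (t - x j) * v t\<bar> \<le> B1" if "j \<in> I" for j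
        proof -
          have "\<bar>?P / (t - x j)\<bar> \<le> 1"
            by (rule prod_abs_power_div_le_1[OF assms(1) that assms(3)]) (rule d)
          then have "\<bar>?P / (t - x j)\<bar> * \<bar>v t\<bar> \<le> 1 * B1" using vt by (intro mult_mono) auto
          then show ?thesis by (simp add: abs_mult)
        qed
        then have "\<bar>\<Sum>j\<in>I. ?P / (t - x j) * v t\<bar> \<le> card I * B1"
          by (intro order_trans[OF sum_abs] sum_bounded_above[THEN order_trans]) auto
        then have "m * \<bar>\<Sum>j\<in>I. ?P / (t - x j) * v t\<bar> \<le> m * (card I * B1)"
          by (intro mult_left_mono) auto
        moreover have "\<bar>?P * v' t\<bar> \<le> 1 * B2"
          unfolding abs_mult using P1 vt by (intro mult_mono) auto
        moreover have "h t = ?P * v' t + m * (\<Sum>j\<in>I. ?P / (t - x j) * v t)"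
          by (simp add: h_def algebra_simps sum_distrib_left)
        moreover have "\<bar>?P * v' t + m * (\<Sum>j\<in>I. ?P / (t - x j) * v t)\<bar>
            \<le> \<bar>?P * v' t\<bar> + m * \<bar>\<Sum>j\<in>I. ?P / (t - x j) * v t\<bar>"
          by (rule order_trans[OF abs_triangle_ineq]) (simp add: abs_mult)
        ultimately show ?thesis by linarith
      qed
    qed
    then show "(\<integral>t. g (x(k := t)) \<partial>unit_unif) = w x * abs_vandermonde I x ^ m *
        (v 1 * (\<Prod>j\<in>I. \<bar>1 - x j\<bar> ^ m) - v 0 * (\<Prod>j\<in>I. \<bar>0 - x j\<bar> ^ m))"
      by (simp add: gh)
  qed
  finally show "(\<integral>x. w x * abs_vandermonde ?J x ^ m * v' (x k) \<partial>cube ?J)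
      + m * (\<Sum>j\<in>I. \<integral>x. w x * abs_vandermonde ?J x ^ m * v (x k) / (x k - x j) \<partial>cube ?J)
      = (\<integral>x. w x * abs_vandermonde I x ^ m *
           (v 1 * (\<Prod>j\<in>I. \<bar>1 - x j\<bar> ^ m) - v 0 * (\<Prod>j\<in>I. \<bar>0 - x j\<bar> ^ m)) \<partial>cube I)" .
qed

section \<open>Symmetrization and Aomoto's recursion\<close>

lemma integral_cube_symmetrize:
  fixes g h :: "_ \<Rightarrow> real"
  assumes "finite I" "p permutes I" "integrable (cube I) g"
    and "\<And>x. x \<in> space (cube I) \<Longrightarrow> g x + g (x \<circ> p) = h x"
  shows "(\<integral>x. g x \<partial>cube I) = (\<integral>x. h x \<partial>cube I) / 2"
proof -
  have int: "integrable (cube I) (\<lambda>x. g (x \<circ> p))"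
    using integrable_distr[OF measurable_cube_permute[OF assms(1,2)], of g] assms(3)
    unfolding distr_cube_permute[OF assms(1,2)] by simp
  \<comment> \<open>The intended \<open>g\<close> has a denominator \<open>x k - x j\<close> and
    \<open>p\<close> swaps \<open>j\<close> and \<open>k\<close>: in the sum
    \<open>g x + g (x \<circ> p)\<close> the denominator cancels.\<close>
  have "(\<integral>x. h x \<partial>cube I) = (\<integral>x. g x + g (x \<circ> p) \<partial>cube I)"
    by (rule Bochner_Integration.integral_cong) (simp_all add: assms(4))
  also have "\<dots> = (\<integral>x. g x \<partial>cube I) + (\<integral>x. g (x \<circ> p) \<partial>cube I)"
    by (rule Bochner_Integration.integral_add[OF assms(3) int])
  also have "(\<integral>x. g (x \<circ> p) \<partial>cube I) = (\<integral>x. g x \<partial>cube I)"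
    by (rule integral_cube_permute[OF assms(1,2)]) (use assms(3) in simp)
  finally show ?thesis by simp
qed

text \<open>Aomoto's integrals: the coordinates in \<open>T\<close> carry one additional factor
  \<open>x i\<close>. Growing \<open>T\<close> from the empty set to \<open>I\<close> passes from
  exponent \<open>a\<close> to exponent \<open>Suc a\<close>.\<close>

definition selberg_moment :: "nat \<Rightarrow> nat \<Rightarrow> nat \<Rightarrow> 'i set \<Rightarrow> 'i set \<Rightarrow> real" where
  "selberg_moment a b m I T =
    (\<integral>x. selberg_density (\<lambda>i. if i \<in> T then Suc a else a) b m I x \<partial>cube I)"

lemma selberg_density_eq_0:
  assumes "finite I" "i \<in> I" "j \<in> I" "i \<noteq> j" "x i = x j" "0 < m"
  shows "selberg_density e b m I x = 0"
  using abs_vandermonde_eq_0[OF assms(1-5)] assms(6) by (simp add: selberg_density_def)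

lemma selberg_moment_swap:
  assumes "finite I" "k \<in> I" "j \<in> I" "k \<notin> T" "j \<notin> T"
  shows "selberg_moment a b m I (insert j T) = selberg_moment a b m I (insert k T)"
proof -
  let ?p = "Transposition.transpose j k"
  let ?e = "\<lambda>T i. if i \<in> T then Suc a else a"
  have p: "?p permutes I" by (rule permutes_swap_id) fact+
  have e: "?e (insert j T) \<circ> ?p = ?e (insert k T)"
    using assms(4,5) by (auto simp: fun_eq_iff Transposition.transpose_def)
  have "selberg_moment a b m I (insert k T)
      = (\<integral>x. selberg_density (?e (insert k T)) b m I (x \<circ> ?p) \<partial>cube I)"
    unfolding selberg_moment_def
    by (rule integral_cube_permute[OF assms(1) p, symmetric]) simp
  also have "\<dots> = selberg_moment a b m I (insert j T)"
    unfolding selberg_moment_def e[symmetric] selberg_density_permute[OF p] ..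
  finally show ?thesis by simp
qed

lemma selberg_density_transpose:
  assumes "k \<in> I" "j \<in> I" "e j = e k"
  shows "selberg_density e b m I (x \<circ> Transposition.transpose j k) = selberg_density e b m I x"
proof -
  have "e \<circ> Transposition.transpose j k = e" using assms(3) by (auto simp: fun_eq_iff Transposition.transpose_def)
  with selberg_density_permute[OF permutes_swap_id[OF assms(2,1)], of e b m x] show ?thesis
    by (simp add: comp_def)
qed

lemma selberg_density_raise:
  assumes "finite I" "k \<in> I"
  shows "selberg_density (e(k := Suc (e k))) b m I x = x k * selberg_density e b m I x"
proof -
  have "(\<Prod>i\<in>I. x i ^ (e(k := Suc (e k))) i * (1 - x i) ^ b)
      = x k * (\<Prod>i\<in>I. x i ^ e i * (1 - x i) ^ b)"
  proof -
    have "(\<Prod>i\<in>I - {k}. x i ^ (e(k := Suc (e k))) i * (1 - x i) ^ b)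
        = (\<Prod>i\<in>I - {k}. x i ^ e i * (1 - x i) ^ b)"
      by (rule prod.cong) auto
    then show ?thesis using assms by (simp add: prod.remove[of I k])
  qed
  then show ?thesis by (simp add: selberg_density_def)
qed

lemma has_real_derivative_one_minus_power:
  "((\<lambda>t. (1 - t) ^ Suc b) has_real_derivative - (real (b + 1) * (1 - t) ^ b)) (at t)"
proof -
  have "((\<lambda>t::real. 1 - t) has_real_derivative -1) (at t)"
    by (auto intro!: derivative_eq_intros)
  from DERIV_power[OF this, of "Suc b"] show ?thesis
    by (rule DERIV_cong) simp
qed

text \<open>Integration by parts in \<open>x k\<close> with a \<open>v\<close> that vanishes at 0
  and 1. Pairing \<open>k\<close> with every other coordinate \<open>j\<close> and symmetrizing
  removes \<open>x k - x j\<close>; what is left depends on whether \<open>j\<close> already carries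
  the additional factor.\<close>

lemma aomoto_recursion:
  assumes "finite I" "k \<notin> I" "T \<subseteq> I" "0 < m"
  defines "J \<equiv> insert k I"
  shows "(a + b + 2 + m * card T / 2 + m * card (I - T)) * selberg_moment a b m J (insert k T)
    = (a + 1 + m * card (I - T) / 2) * selberg_moment a b m J T"
proof -
  let ?e = "\<lambda>T i. if i \<in> T then Suc a else a"
  let ?E = "selberg_moment a b m J"
  let ?V = "\<lambda>x. abs_vandermonde J x ^ m"
  define w where "w x = (\<Prod>i\<in>I. x i ^ ?e T i * (1 - x i) ^ b)" for x :: "'a \<Rightarrow> real"
  define v where "v t = t ^ Suc a * (1 - t) ^ Suc b" for t :: real
  define v' where "v' t = t ^ a * (1 - t) ^ b * ((a + 1) * (1 - t) - (b + 1) * t)" for t :: real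
  have finJ: "finite J" and kJ: "k \<in> J" and kT: "k \<notin> T"
    using assms by (auto simp: J_def)
  have v: "(v has_real_derivative v' t) (at t)" for t
  proof -
    have "((\<lambda>t. t ^ Suc a) has_real_derivative (a + 1) * t ^ a) (at t)"
      using DERIV_pow[of "Suc a" t] by simp
    from DERIV_mult[OF this has_real_derivative_one_minus_power] show ?thesis
      unfolding v_def[abs_def] by (rule DERIV_cong) (simp add: v'_def algebra_simps)
  qed
  have v'_cont: "continuous_on UNIV v'" unfolding v'_def by (intro continuous_intros)
  note ibp = selberg_integration_by_parts[OF assms(1,2,4) v v'_cont, where e="?e T" and b=b, folded w_def J_def]
  have dT: "selberg_density (?e T) b m J x = w x * ?V x * (x k ^ a * (1 - x k) ^ b)" for x
    using assms(1,2) kT by (simp add: selberg_density_def J_def w_def mult_ac)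
  have eT: "?e (insert k T) = (?e T)(k := Suc (?e T k))"
    using kT by (auto simp: fun_eq_iff)
  have dkT: "selberg_density (?e (insert k T)) b m J x = x k * selberg_density (?e T) b m J x" for x
    unfolding eT by (rule selberg_density_raise[OF finJ kJ])
  have int: "integrable (cube J) (selberg_density e b m J)" for e
    by (rule integrable_selberg_density)
  have "(\<integral>x. w x * ?V x * v' (x k) \<partial>cube J)
      = (\<integral>x. (a + 1) * selberg_density (?e T) b m J x
          - (a + b + 2) * selberg_density (?e (insert k T)) b m J x \<partial>cube J)"
    by (rule Bochner_Integration.integral_cong[OF refl], unfold dkT, unfold dT v'_def)
      (simp add: algebra_simps)
  also have "\<dots> = (a + 1) * ?E T - (a + b + 2) * ?E (insert k T)"
    unfolding selberg_moment_def using int by simp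
  finally have main: "(\<integral>x. w x * ?V x * v' (x k) \<partial>cube J)
      = (a + 1) * ?E T - (a + b + 2) * ?E (insert k T)" .
  \<comment> \<open>After raising \<open>k\<close>, the coordinates \<open>j\<close> and
    \<open>k\<close> have equal exponents, so the swap fixes the density, and
    \<open>((1 - x k) - (1 - x j)) / (x k - x j) = -1\<close>.\<close>
  have term_T: "(\<integral>x. w x * ?V x * v (x k) / (x k - x j) \<partial>cube J) = - ?E (insert k T) / 2"
    if j: "j \<in> T" for j
  proof -
    have jJ: "j \<in> J" "j \<noteq> k" using j assms by (auto simp: J_def)
    have eq: "w x * ?V x * v (x k) / (x k - x j)
        = selberg_density (?e (insert k T)) b m J x * (1 - x k) / (x k - x j)" for x
      unfolding dkT dT v_def by (simp add: mult_ac)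
    have "(\<integral>x. w x * ?V x * v (x k) / (x k - x j) \<partial>cube J)
        = (\<integral>x. - selberg_density (?e (insert k T)) b m J x \<partial>cube J) / 2"
    proof (rule integral_cube_symmetrize[OF finJ permutes_swap_id[OF jJ(1) kJ]])
      show "integrable (cube J) (\<lambda>x. w x * ?V x * v (x k) / (x k - x j))"
        by (rule ibp(2)) (use j assms(3) in auto)
      fix x
      have s: "selberg_density (?e (insert k T)) b m J (x \<circ> Transposition.transpose j k)
          = selberg_density (?e (insert k T)) b m J x"
        by (rule selberg_density_transpose[OF kJ jJ(1)]) (use j in simp)
      show "w x * ?V x * v (x k) / (x k - x j) +
          w (x \<circ> Transposition.transpose j k) * ?V (x \<circ> Transposition.transpose j k) * v ((x \<circ> Transposition.transpose j k) k)
            / ((x \<circ> Transposition.transpose j k) k - (x \<circ> Transposition.transpose j k) j)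
          = - selberg_density (?e (insert k T)) b m J x"
      proof (cases "x k = x j")
        \<comment> \<open>Quotients by zero are 0, and the density vanishes here because
          \<open>0 < m\<close>.\<close>
        case True
        then have "selberg_density (?e (insert k T)) b m J x = 0"
          by (intro selberg_density_eq_0[OF finJ kJ jJ(1) _ _ assms(4)]) (use jJ in auto)
        then show ?thesis unfolding eq s by simp
      next
        case False
        then have ne: "x k - x j \<noteq> 0" "x j - x k \<noteq> 0" by auto
        have "d * (1 - x k) / (x k - x j) + d * (1 - x j) / (x j - x k) = - d" for d
          using ne by (simp add: divide_simps) (simp add: algebra_simps)
        then show ?thesis unfolding eq s by simp
      qed
    qed
    then show ?thesis by (simp add: selberg_moment_def)
  qed
  \<comment> \<open>Before raising \<open>k\<close> the two exponents agree, and \<open>(x k * (1 -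
    x k) - x j * (1 - x j)) / (x k - x j) = 1 - x k - x j\<close>.\<close>
  have term_nT: "(\<integral>x. w x * ?V x * v (x k) / (x k - x j) \<partial>cube J) = ?E T / 2 - ?E (insert k T)"
    if j: "j \<in> I - T" for j
  proof -
    have jJ: "j \<in> J" "j \<noteq> k" "j \<notin> T" using j assms by (auto simp: J_def)
    have eq: "w x * ?V x * v (x k) / (x k - x j)
        = selberg_density (?e T) b m J x * (x k * (1 - x k)) / (x k - x j)" for x
      unfolding dT v_def by (simp add: mult_ac)
    have ejT: "?e (insert j T) = (?e T)(j := Suc (?e T j))"
      using jJ by (auto simp: fun_eq_iff)
    have djT: "selberg_density (?e (insert j T)) b m J x = x j * selberg_density (?e T) b m J x" for x
      unfolding ejT by (rule selberg_density_raise[OF finJ jJ(1)])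
    have "(\<integral>x. w x * ?V x * v (x k) / (x k - x j) \<partial>cube J)
        = (\<integral>x. selberg_density (?e T) b m J x - selberg_density (?e (insert k T)) b m J x
            - selberg_density (?e (insert j T)) b m J x \<partial>cube J) / 2"
    proof (rule integral_cube_symmetrize[OF finJ permutes_swap_id[OF jJ(1) kJ]])
      show "integrable (cube J) (\<lambda>x. w x * ?V x * v (x k) / (x k - x j))"
        by (rule ibp(2)) (use j in auto)
      fix x
      have s: "selberg_density (?e T) b m J (x \<circ> Transposition.transpose j k) = selberg_density (?e T) b m J x"
        by (rule selberg_density_transpose[OF kJ jJ(1)]) (use jJ kT in simp)
      show "w x * ?V x * v (x k) / (x k - x j) +
          w (x \<circ> Transposition.transpose j k) * ?V (x \<circ> Transposition.transpose j k) * v ((x \<circ> Transposition.transpose j k) k)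
            / ((x \<circ> Transposition.transpose j k) k - (x \<circ> Transposition.transpose j k) j)
          = selberg_density (?e T) b m J x - selberg_density (?e (insert k T)) b m J x
            - selberg_density (?e (insert j T)) b m J x"
      proof (cases "x k = x j")
        case True
        then have "selberg_density (?e T) b m J x = 0"
          by (intro selberg_density_eq_0[OF finJ kJ jJ(1) _ _ assms(4)]) (use jJ in auto)
        then show ?thesis unfolding eq s dkT djT by simp
      next
        case False
        then have ne: "x k - x j \<noteq> 0" "x j - x k \<noteq> 0" by auto
        have "d * (x k * (1 - x k)) / (x k - x j) + d * (x j * (1 - x j)) / (x j - x k)
            = d - x k * d - x j * d" for d
          using ne by (simp add: divide_simps) (simp add: algebra_simps)
        then show ?thesis unfolding eq s dkT djT by simp
      qed
    qed
    also have "\<dots> = (?E T - ?E (insert k T) - ?E (insert j T)) / 2"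
      unfolding selberg_moment_def using int by simp
    \<comment> \<open>Raising \<open>j\<close> instead of \<open>k\<close> gives the same integral
      by symmetry, so only two unknowns remain.\<close>
    also have "?E (insert j T) = ?E (insert k T)"
      by (rule selberg_moment_swap[OF finJ kJ jJ(1) kT jJ(3)])
    finally show ?thesis by (simp add: field_simps)
  qed
  have "(\<Sum>j\<in>I. \<integral>x. w x * ?V x * v (x k) / (x k - x j) \<partial>cube J)
      = (\<Sum>j\<in>T. - ?E (insert k T) / 2) + (\<Sum>j\<in>I - T. ?E T / 2 - ?E (insert k T))"
    unfolding sum.subset_diff[OF assms(3,1)]
    by (subst add.commute) (intro arg_cong2[where f="(+)"] sum.cong refl term_T term_nT)
  also have "\<dots> = card (I - T) * (?E T / 2 - ?E (insert k T)) - card T * ?E (insert k T) / 2"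
    by simp
  finally have sumeq: "(\<Sum>j\<in>I. \<integral>x. w x * ?V x * v (x k) / (x k - x j) \<partial>cube J)
    = card (I - T) * (?E T / 2 - ?E (insert k T)) - card T * ?E (insert k T) / 2" .
  have "v 0 = 0" "v 1 = 0" by (simp_all add: v_def)
  then have "(a + 1) * ?E T - (a + b + 2) * ?E (insert k T)
      + m * (card (I - T) * (?E T / 2 - ?E (insert k T)) - card T * ?E (insert k T) / 2) = 0"
    using ibp(3) unfolding main sumeq by simp
  then show ?thesis by (simp add: algebra_simps)
qed

text \<open>With exponent 0 the boundary term at \<open>x k = 0\<close> survives: there
  \<open>|x k - x j| ^ m\<close> becomes \<open>x j ^ m\<close>, which leaves an integral in one
  variable less with exponent \<open>m\<close>.\<close>

lemma selberg_moment_boundary: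
  assumes "finite I" "k \<notin> I" "0 < m"
  shows "(b + 1 + m * card I / 2) * selberg_moment 0 b m (insert k I) {} = selberg_moment m b m I {}"
proof -
  define J where "J = insert k I"
  let ?E = "selberg_moment 0 b m J {}"
  let ?V = "\<lambda>x. abs_vandermonde J x ^ m"
  let ?D = "selberg_density (\<lambda>_. 0) b m J"
  define w where "w x = (\<Prod>i\<in>I. x i ^ 0 * (1 - x i) ^ b)" for x :: "'a \<Rightarrow> real"
  \<comment> \<open>No power of \<open>t\<close> here: \<open>v 0 = 1\<close> keeps the lower
    boundary term, \<open>v 1 = 0\<close> removes the upper one.\<close>
  define v where "v t = (1 - t) ^ Suc b" for t :: real
  define v' where "v' t = - ((b + 1) * (1 - t) ^ b)" for t :: real
  have finJ: "finite J" and kJ: "k \<in> J"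
    using assms by (auto simp: J_def)
  have v: "(v has_real_derivative v' t) (at t)" for t
    unfolding v_def[abs_def] v'_def by (rule has_real_derivative_one_minus_power)
  have v'_cont: "continuous_on UNIV v'" unfolding v'_def by (intro continuous_intros)
  note ibp = selberg_integration_by_parts[OF assms v v'_cont, where e="\<lambda>_. 0" and b=b, folded w_def J_def]
  have D: "?D x = w x * ?V x * (1 - x k) ^ b" for x
    using assms(1,2) by (simp add: selberg_density_def J_def w_def mult_ac)
  have E: "?E = (\<integral>x. ?D x \<partial>cube J)" by (simp add: selberg_moment_def)
  have main: "(\<integral>x. w x * ?V x * v' (x k) \<partial>cube J) = - ((b + 1) * ?E)"
  proof -
    have "(\<integral>x. w x * ?V x * v' (x k) \<partial>cube J) = (\<integral>x. - ((b + 1) * ?D x) \<partial>cube J)"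
      by (rule Bochner_Integration.integral_cong[OF refl], unfold D v'_def) simp
    then show ?thesis unfolding E by simp
  qed
  have t: "(\<integral>x. w x * ?V x * v (x k) / (x k - x j) \<partial>cube J) = - ?E / 2" if j: "j \<in> I" for j
  proof -
    have jJ: "j \<in> J" "j \<noteq> k" using j assms by (auto simp: J_def)
    have eq: "w x * ?V x * v (x k) / (x k - x j) = ?D x * (1 - x k) / (x k - x j)" for x
      unfolding D v_def by (simp add: mult_ac)
    have "(\<integral>x. w x * ?V x * v (x k) / (x k - x j) \<partial>cube J) = (\<integral>x. - ?D x \<partial>cube J) / 2"
    proof (rule integral_cube_symmetrize[OF finJ permutes_swap_id[OF jJ(1) kJ]])
      show "integrable (cube J) (\<lambda>x. w x * ?V x * v (x k) / (x k - x j))"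
        by (rule ibp(2)) (use j in auto)
      fix x
      have s: "?D (x \<circ> Transposition.transpose j k) = ?D x"
        by (rule selberg_density_transpose[OF kJ jJ(1)]) simp
      show "w x * ?V x * v (x k) / (x k - x j) +
          w (x \<circ> Transposition.transpose j k) * ?V (x \<circ> Transposition.transpose j k) * v ((x \<circ> Transposition.transpose j k) k)
            / ((x \<circ> Transposition.transpose j k) k - (x \<circ> Transposition.transpose j k) j) = - ?D x"
      proof (cases "x k = x j")
        case True
        then have "?D x = 0"
          by (intro selberg_density_eq_0[OF finJ kJ jJ(1) _ _ assms(3)]) (use jJ in auto)
        then show ?thesis unfolding eq s by simp
      next
        case False
        then have ne: "x k - x j \<noteq> 0" "x j - x k \<noteq> 0" by auto
        have "d * (1 - x k) / (x k - x j) + d * (1 - x j) / (x j - x k) = - d" for d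
          using ne by (simp add: divide_simps) (simp add: algebra_simps)
        then show ?thesis unfolding eq s by simp
      qed
    qed
    then show ?thesis by (simp add: E)
  qed
  have rhs: "(\<integral>x. w x * abs_vandermonde I x ^ m *
      (v 1 * (\<Prod>j\<in>I. \<bar>1 - x j\<bar> ^ m) - v 0 * (\<Prod>j\<in>I. \<bar>0 - x j\<bar> ^ m)) \<partial>cube I)
      = - selberg_moment m b m I {}"
  proof -
    have "(\<integral>x. w x * abs_vandermonde I x ^ m *
      (v 1 * (\<Prod>j\<in>I. \<bar>1 - x j\<bar> ^ m) - v 0 * (\<Prod>j\<in>I. \<bar>0 - x j\<bar> ^ m)) \<partial>cube I)
      = (\<integral>x. - selberg_density (\<lambda>_. m) b m I x \<partial>cube I)"
    proof (rule Bochner_Integration.integral_cong[OF refl])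
      fix x assume x: "x \<in> space (cube I)"
      have "(\<Prod>j\<in>I. \<bar>x j\<bar> ^ m) = (\<Prod>j\<in>I. x j ^ m)"
        using space_cubeD[OF x] by (intro prod.cong) (auto simp: less_imp_le)
      then show "w x * abs_vandermonde I x ^ m *
          (v 1 * (\<Prod>j\<in>I. \<bar>1 - x j\<bar> ^ m) - v 0 * (\<Prod>j\<in>I. \<bar>0 - x j\<bar> ^ m))
          = - selberg_density (\<lambda>_. m) b m I x"
        by (simp add: v_def w_def selberg_density_def prod.distrib mult_ac)
    qed
    then show ?thesis by (simp add: selberg_moment_def)
  qed
  have "- ((b + 1) * ?E) + m * (\<Sum>j\<in>I. - ?E / 2) = - selberg_moment m b m I {}"
    using ibp(3) unfolding main rhs by (simp add: t)
  then show ?thesis unfolding J_def by (simp add: algebra_simps)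
qed

section \<open>Double factorials and the closed form of the Selberg integral\<close>

lemma dfact_Suc_Suc: "dfact (Suc (Suc k)) = Suc (Suc k) * dfact k"
proof (cases "k = 0")
  case False
  then have "(Suc (Suc k) - 1) div 2 = Suc ((k - 1) div 2)" by presburger
  then have "dfact (Suc (Suc k)) = (\<Prod>j\<in>{0..Suc ((k - 1) div 2)}. Suc (Suc k) - 2 * j)"
    by (simp add: dfact_def)
  also have "\<dots> = Suc (Suc k) * (\<Prod>j\<in>{0..(k - 1) div 2}. k - 2 * j)"
    by (simp add: prod.atLeast0_atMost_Suc_shift del: prod.cl_ivl_Suc)
  also have "\<dots> = Suc (Suc k) * dfact k" using False by (simp add: dfact_def)
  finally show ?thesis .
qed (simp add: dfact_def)

lemma dfact_add_2: "dfact (k + 2) = (k + 2) * dfact k"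
  using dfact_Suc_Suc[of k] by simp

lemma dfact_pos: "0 < dfact k"
  by (auto simp: dfact_def intro!: prod_pos)

lemma dfact_0 [simp]: "dfact 0 = 1"
  by (simp add: dfact_def)

text \<open>Selberg's Gamma product with parameter \<open>m / 2\<close>, its Gamma values at
  multiples of one half rewritten as double factorials. It belongs to the whole cube, hence there is
  no division by \<open>n!\<close> yet. In each factor \<open>1 <= j <= n\<close>, so
  \<open>j - 1\<close> and \<open>n + j - 2\<close> are true differences.\<close>

definition selberg_value :: "nat \<Rightarrow> nat \<Rightarrow> nat \<Rightarrow> nat \<Rightarrow> real" where
  "selberg_value m n r s = 2 ^ n * (\<Prod>j\<in>{1..n}.
     real (dfact (j * m) * dfact (2 * r + (j - 1) * m) * dfact (2 * s + (j - 1) * m))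
     / real (dfact m * dfact (2 * r + 2 * s + 2 + (n + j - 2) * m)))"

text \<open>Raising \<open>r\<close> advances two double factorials in each factor by 2 and releases
  one linear term from each; these terms are the doubled coefficients of Aomoto's recursion.\<close>

lemma selberg_value_Suc:
  "selberg_value m n (Suc r) s * (\<Prod>j\<in>{1..n}. real (2 * r + 2 * s + 4 + (n + j - 2) * m))
    = selberg_value m n r s * (\<Prod>j\<in>{1..n}. real (2 * r + 2 + (j - 1) * m))"
proof -
  have "real (dfact (j * m) * dfact (2 * Suc r + (j - 1) * m) * dfact (2 * s + (j - 1) * m))
      / real (dfact m * dfact (2 * Suc r + 2 * s + 2 + (n + j - 2) * m))
      * real (2 * r + 2 * s + 4 + (n + j - 2) * m)
    = real (dfact (j * m) * dfact (2 * r + (j - 1) * m) * dfact (2 * s + (j - 1) * m))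
      / real (dfact m * dfact (2 * r + 2 * s + 2 + (n + j - 2) * m))
      * real (2 * r + 2 + (j - 1) * m)" for j
  proof -
    have 1: "dfact (2 * Suc r + (j - 1) * m) = (2 * r + 2 + (j - 1) * m) * dfact (2 * r + (j - 1) * m)"
      using dfact_add_2[of "2 * r + (j - 1) * m"] by (simp add: algebra_simps)
    have 2: "dfact (2 * Suc r + 2 * s + 2 + (n + j - 2) * m)
        = (2 * r + 2 * s + 4 + (n + j - 2) * m) * dfact (2 * r + 2 * s + 2 + (n + j - 2) * m)"
      using dfact_add_2[of "2 * r + 2 * s + 2 + (n + j - 2) * m"] by (simp add: algebra_simps)
    have 3: "real (dfact m) \<noteq> 0" "real (dfact (2 * r + 2 * s + 2 + (n + j - 2) * m)) \<noteq> 0"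
      "real (2 * r + 2 * s + 4 + (n + j - 2) * m) \<noteq> 0"
      unfolding of_nat_eq_0_iff using dfact_pos by (auto simp: less_imp_neq[symmetric])
    have alg: "x * (p * y) * z / (d * (q * h)) * q = x * y * z / (d * h) * p"
      if "q \<noteq> 0" for x y z p q d h :: real
      using that by (simp add: field_simps)
    show ?thesis
      unfolding 1 2 of_nat_mult[of _ "dfact _"] of_nat_mult[of "_ * dfact _"] of_nat_mult[of "dfact _"]
      by (rule alg) (rule 3)
  qed
  then show ?thesis
    by (simp only: selberg_value_def mult.assoc[of "2 ^ n"] prod.distrib[symmetric])
qed

text \<open>Both sides are products over the sequences \<open>D\<close>, \<open>G\<close>,
  \<open>H\<close>. Taking \<open>r = m\<close> in dimension \<open>n\<close> shifts indices of
  \<open>D\<close> and \<open>H\<close> by one, so everything cancels except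
  \<open>G n / H n\<close>, the reciprocal of the linear factor, and one factor 2.\<close>

lemma selberg_value_boundary:
  "selberg_value m (Suc n) 0 s * real (2 * s + 2 + n * m) = 2 * selberg_value m n m s"
proof -
  define D G H where "D j = real (dfact (j * m))" and "G j = real (dfact (2 * s + j * m))"
    and "H j = real (dfact (2 * s + 2 + j * m))" for j
  have nz: "D j \<noteq> 0" "G j \<noteq> 0" "H j \<noteq> 0" for j
    using dfact_pos by (auto simp: D_def G_def H_def less_imp_neq[symmetric])
  have shift: "(\<Prod>j\<in>{1..n}. f j) = (\<Prod>k<n. f (Suc k))" for f :: "nat \<Rightarrow> real" and n
    by (simp add: prod.atLeast1_atMost_eq)
  have D0: "D 0 = 1" by (simp add: D_def)
  have HG: "H n = real (2 * s + 2 + n * m) * G n"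
  proof -
    have e: "2 * s + 2 + n * m = (2 * s + n * m) + 2" by simp
    show ?thesis unfolding H_def G_def e dfact_add_2 by (rule of_nat_mult)
  qed
  have L: "selberg_value m (Suc n) 0 s = 2 ^ Suc n * (\<Prod>k<Suc n. D (Suc k) * D k * G k / (D 1 * H (n + k)))"
    unfolding selberg_value_def shift
    by (intro arg_cong2[where f="(*)"] refl prod.cong) (simp_all add: D_def G_def H_def)
  have R: "selberg_value m n m s = 2 ^ n * (\<Prod>k<n. D (Suc k) * D (Suc (Suc k)) * G k / (D 1 * H (n + Suc k)))"
  proof -
    have e1: "2 * m + (Suc k - 1) * m = Suc (Suc k) * m" for k by simp
    \<comment> \<open>The condition \<open>k < n\<close> makes \<open>n + Suc k - 2\<close> a true
      difference.\<close>
    have e2: "2 * m + 2 * s + 2 + (n + Suc k - 2) * m = 2 * s + 2 + (n + Suc k) * m" if "k < n" for k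
    proof -
      have "n + Suc k = 2 + (n + Suc k - 2)" using that by simp
      then have "(n + Suc k) * m = 2 * m + (n + Suc k - 2) * m"
        by (metis add_mult_distrib)
      then show ?thesis by simp
    qed
    show ?thesis
      unfolding selberg_value_def shift e1
      by (intro arg_cong2[where f="(*)"] refl prod.cong)
        (simp_all only: lessThan_iff e2 D_def G_def H_def of_nat_mult diff_Suc_1 mult_1)
  qed
  have 1: "(\<Prod>k<Suc n. D k) = (\<Prod>k<n. D (Suc k))"
    by (subst prod.lessThan_Suc_shift) (simp add: D0)
  have 2: "(\<Prod>k<Suc n. D (Suc k)) = D 1 * (\<Prod>k<n. D (Suc (Suc k)))"
    by (subst prod.lessThan_Suc_shift) simp
  have 3: "(\<Prod>k<Suc n. H (n + k)) = H n * (\<Prod>k<n. H (n + Suc k))"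
    by (subst prod.lessThan_Suc_shift) simp
  have prodL: "(\<Prod>k<Suc n. D (Suc k) * D k * G k / (D 1 * H (n + k)))
      = (D 1 * (\<Prod>k<n. D (Suc (Suc k)))) * (\<Prod>k<n. D (Suc k)) * (G n * (\<Prod>k<n. G k))
         / (D 1 ^ Suc n * (H n * (\<Prod>k<n. H (n + Suc k))))"
    unfolding prod_dividef prod.distrib 1 2 3 by (simp add: mult_ac)
  have prodR: "(\<Prod>k<n. D (Suc k) * D (Suc (Suc k)) * G k / (D 1 * H (n + Suc k)))
      = (\<Prod>k<n. D (Suc (Suc k))) * (\<Prod>k<n. D (Suc k)) * (\<Prod>k<n. G k)
         / (D 1 ^ n * (\<Prod>k<n. H (n + Suc k)))"
    unfolding prod_dividef prod.distrib by (simp add: mult_ac)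
  have alg: "2 ^ Suc n * ((d * P) * Q * (g * R) / (d ^ Suc n * ((c * g) * h))) * c
      = 2 * (2 ^ n * (P * Q * R / (d ^ n * h)))"
    if "d \<noteq> 0" "g \<noteq> 0" "c \<noteq> 0" for P Q R d g c h :: real
    using that by (simp add: field_simps)
  have c: "real (2 * s + 2 + n * m) \<noteq> 0"
    unfolding of_nat_eq_0_iff by simp
  show ?thesis
    unfolding L R prodL prodR HG by (rule alg[OF nz(1) nz(2) c])
qed

lemma selberg_moment_cong:
  assumes "\<And>i. i \<in> I \<Longrightarrow> (if i \<in> T then Suc a else a) = (if i \<in> T' then Suc a' else a')"
  shows "selberg_moment a b m I T = selberg_moment a' b m I T'"
  unfolding selberg_moment_def selberg_density_def using assms by (simp cong: prod.cong)

text \<open>Iterates Aomoto's recursion along \<open>T\<close>. Raising a coordinate while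
  \<open>c\<close> others are still unraised contributes the factor with \<open>j = c + 1\<close>,
  so the indices are used up from \<open>n\<close> downwards.\<close>

lemma selberg_moment_prod:
  assumes "finite T" "finite J" "T \<subseteq> J" "0 < m"
  defines "n \<equiv> card J"
  shows "selberg_moment a b m J T * (\<Prod>j\<in>{card (J - T) + 1..n}. real (2 * a + 2 * b + 4 + (n + j - 2) * m))
    = selberg_moment a b m J {} * (\<Prod>j\<in>{card (J - T) + 1..n}. real (2 * a + 2 + (j - 1) * m))"
  using assms(1,3)
proof (induction T rule: finite_induct)
  case (insert k T)
  define I where "I = J - {k}"
  define c where "c = card (J - insert k T)"
  have J: "J = insert k I" "finite I" "k \<notin> I" "T \<subseteq> I"
    using insert.hyps insert.prems assms(2) by (auto simp: I_def)
  have "J - insert k T = I - T" by (auto simp: I_def)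
  then have c: "c = card (I - T)" by (simp only: c_def)
  have "J - T = insert k (J - insert k T)" using insert.hyps insert.prems by auto
  then have c1: "card (J - T) = Suc c"
    unfolding c_def using assms(2) by (metis DiffD2 card_insert_disjoint finite_Diff insertI1)
  have n: "n = card T + Suc c"
    using card_Diff_subset[OF insert.hyps(1), of J] c1 insert.prems card_mono[OF assms(2), of T]
    by (auto simp: n_def)
  have iv: "{c + 1..n} = insert (Suc c) {Suc c + 1..n}" using n by auto
  let ?E = "selberg_moment a b m J"
  \<comment> \<open>Doubling clears the halves. With \<open>n = card T + c + 1\<close> and
    \<open>j = c + 1\<close>, the multiplier \<open>card T + 2 * c\<close> of \<open>m\<close> is
    \<open>n + j - 2\<close>.\<close>
  have "real (2 * a + 2 * b + 4 + (card T + 2 * c) * m) * ?E (insert k T)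
      = 2 * ((a + b + 2 + m * card T / 2 + m * card (I - T)) * ?E (insert k T))"
    unfolding c by (simp add: algebra_simps)
  also have "\<dots> = 2 * ((a + 1 + m * card (I - T) / 2) * ?E T)"
    using aomoto_recursion[OF J(2,3,4) assms(4), of a b] unfolding J(1) by (simp add: add_ac)
  also have "\<dots> = real (2 * a + 2 + c * m) * ?E T"
    unfolding c by (simp add: algebra_simps)
  finally have step: "real (2 * a + 2 * b + 4 + (card T + 2 * c) * m) * ?E (insert k T)
    = real (2 * a + 2 + c * m) * ?E T" .
  have "?E (insert k T) * (\<Prod>j\<in>{c + 1..n}. real (2 * a + 2 * b + 4 + (n + j - 2) * m))
      = (real (2 * a + 2 * b + 4 + (card T + 2 * c) * m) * ?E (insert k T))
        * (\<Prod>j\<in>{Suc c + 1..n}. real (2 * a + 2 * b + 4 + (n + j - 2) * m))"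
    unfolding iv by (subst prod.insert) (simp_all add: n del: of_nat_add of_nat_mult)
  also have "\<dots> = real (2 * a + 2 + c * m) * (?E T
        * (\<Prod>j\<in>{Suc c + 1..n}. real (2 * a + 2 * b + 4 + (n + j - 2) * m)))"
    unfolding step by (simp only: mult_ac)
  also have "\<dots> = real (2 * a + 2 + c * m) * (?E {}
        * (\<Prod>j\<in>{Suc c + 1..n}. real (2 * a + 2 + (j - 1) * m)))"
    using insert.IH insert.prems unfolding c1 by (simp only: insert_subset)
  also have "\<dots> = ?E {} * (\<Prod>j\<in>{c + 1..n}. real (2 * a + 2 + (j - 1) * m))"
    unfolding iv by (subst prod.insert) (simp_all del: of_nat_add of_nat_mult)
  finally show ?case unfolding c_def .
qed (simp add: n_def)

text \<open>Induction on the dimension and, inside it, on \<open>r\<close>. The case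
  \<open>r = 0\<close> calls the smaller dimension with exponent \<open>m\<close>, so the outer
  hypothesis has to be general in \<open>r\<close>.\<close>

theorem selberg_integral:
  assumes "finite I" "0 < m"
  shows "(\<integral>x. selberg_density (\<lambda>_. r) s m I x \<partial>cube I) = selberg_value m (card I) r s"
proof -
  have "selberg_moment r s m I {} = selberg_value m (card I) r s"
    using assms(1)
  proof (induction I arbitrary: r s rule: finite_induct)
    case empty
    interpret prob_space "cube {} :: ('a \<Rightarrow> real) measure" by (rule prob_space_cube)
    show ?case
      by (simp add: selberg_moment_def selberg_density_def selberg_value_def prob_space)
  next
    case (insert k I)
    let ?J = "insert k I"
    show ?case
    proof (induction r)
      case 0
      have "(s + 1 + m * card I / 2) * selberg_moment 0 s m ?J {} = selberg_value m (card I) m s"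
        using selberg_moment_boundary[OF insert.hyps assms(2), of s] insert.IH by (simp add: add_ac)
      then have "selberg_moment 0 s m ?J {} * real (2 * s + 2 + card I * m)
          = selberg_value m (card ?J) 0 s * real (2 * s + 2 + card I * m)"
        using selberg_value_boundary[of m "card I" s] insert.hyps by (simp add: algebra_simps)
      then show ?case by (simp del: of_nat_add of_nat_mult)
    next
      case (Suc r)
      have "selberg_moment r s m ?J ?J = selberg_moment (Suc r) s m ?J {}"
        by (rule selberg_moment_cong) simp
      with selberg_moment_prod[of ?J ?J m r s] insert.hyps assms(2)
      have "selberg_moment (Suc r) s m ?J {} * (\<Prod>j\<in>{1..card ?J}. real (2 * r + 2 * s + 4 + (card ?J + j - 2) * m))
          = selberg_value m (card ?J) r s * (\<Prod>j\<in>{1..card ?J}. real (2 * r + 2 + (j - 1) * m))"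
        unfolding Suc by (simp del: of_nat_add of_nat_mult card.insert)
      also have "\<dots> = selberg_value m (card ?J) (Suc r) s *
          (\<Prod>j\<in>{1..card ?J}. real (2 * r + 2 * s + 4 + (card ?J + j - 2) * m))"
        by (rule selberg_value_Suc[symmetric])
      finally show ?case
        by (subst (asm) mult_cancel_right) (auto simp: prod_zero_iff simp del: of_nat_add of_nat_mult)
    qed
  qed
  then show ?thesis by (simp add: selberg_moment_def)
qed

section \<open>Linear extensions and order polytopes\<close>

text \<open>The value 0 outside \<open>C\<close> makes a labeling unique as a total function and
  matches the convention for fillings of a book.\<close>

definition labelings :: "'c set \<Rightarrow> ('c \<Rightarrow> nat) set" where
  "labelings C = {f. bij_betw f C {1..card C} \<and> (\<forall>x. x \<notin> C \<longrightarrow> f x = 0)}"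

text \<open>For a labeling \<open>f\<close>, one of the simplices into which the hyperplanes
  \<open>x c = x d\<close> cut the cube.\<close>

definition order_cell :: "'c set \<Rightarrow> ('c \<Rightarrow> nat) \<Rightarrow> ('c \<Rightarrow> real) set" where
  "order_cell C f = {x \<in> space (cube C). \<forall>c\<in>C. \<forall>d\<in>C. f c < f d \<longrightarrow> x c < x d}"

lemma sets_cube_less:
  assumes "c \<in> C" "d \<in> C"
  shows "{x \<in> space (cube C). x c < x d} \<in> sets (cube C)"
proof -
  have [measurable]: "(\<lambda>x. x c) \<in> borel_measurable (cube C)" "(\<lambda>x. x d) \<in> borel_measurable (cube C)"
    using assms by (auto intro: measurable_cube_component)
  show ?thesis by measurable
qed

lemma sets_cube_All_less:
  assumes "finite C" "R \<subseteq> C \<times> C"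
  shows "{x \<in> space (cube C). \<forall>(c,d)\<in>R. x c < x d} \<in> sets (cube C)"
proof -
  have "finite R" using assms by (auto intro: finite_subset)
  then have "{x \<in> space (cube C). \<forall>p\<in>R. x (fst p) < x (snd p)} \<in> sets (cube C)"
    by (intro sets.sets_Collect_finite_All) (use assms(2) in \<open>auto intro!: sets_cube_less\<close>)
  then show ?thesis by (simp add: case_prod_beta)
qed

lemma order_cell_eq:
  "order_cell C f = {x \<in> space (cube C). \<forall>(c,d)\<in>{(c,d) \<in> C \<times> C. f c < f d}. x c < x d}"
  by (auto simp: order_cell_def)

lemma sets_order_cell [measurable]:
  assumes "finite C"
  shows "order_cell C f \<in> sets (cube C)"
  unfolding order_cell_eq by (rule sets_cube_All_less[OF assms]) auto

lemma emeasure_unit_unif_singleton: "emeasure unit_unif {t} = 0"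
proof (cases "t \<in> {0<..<1}")
  case True
  then show ?thesis by (simp add: unit_unif_def emeasure_restrict_space)
next
  case False
  then have "{t} \<notin> sets unit_unif"
    by (auto simp: unit_unif_def sets_restrict_space)
  then show ?thesis by (rule emeasure_notin_sets)
qed

text \<open>Tonelli in the coordinate \<open>c\<close>: with the other coordinates fixed, the bad
  set is contained in a single point, and points are null.\<close>

lemma AE_cube_neq:
  assumes "finite C" "c \<in> C" "d \<in> C" "c \<noteq> d"
  shows "AE x in cube C. x c \<noteq> x d"
proof -
  let ?I = "C - {c}"
  have C: "C = insert c ?I" using assms by auto
  have [measurable]: "(\<lambda>x. x c) \<in> borel_measurable (cube C)" "(\<lambda>x. x d) \<in> borel_measurable (cube C)"
    using assms by (auto intro: measurable_cube_component)
  have N: "{x \<in> space (cube C). x c = x d} \<in> sets (cube C)" by measurable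
  have "emeasure (cube C) {x \<in> space (cube C). x c = x d}
      = (\<integral>\<^sup>+x. indicator {x \<in> space (cube C). x c = x d} x \<partial>cube C)"
    by (rule nn_integral_indicator[OF N, symmetric])
  also have "\<dots> = (\<integral>\<^sup>+x. (\<integral>\<^sup>+t. indicator {x \<in> space (cube C). x c = x d} (x(c := t)) \<partial>unit_unif) \<partial>cube ?I)"
  proof (subst (1) C, rule product_sigma_finite.product_nn_integral_insert[OF product_sigma_finite_unit_unif])
    show "indicator {x \<in> space (cube C). x c = x d} \<in> borel_measurable (cube (insert c ?I))"
      unfolding C[symmetric] using N by simp
  qed (use assms in auto)
  also have "\<dots> = (\<integral>\<^sup>+x. 0 \<partial>cube ?I)"
  proof (rule nn_integral_cong)
    fix x :: "'a \<Rightarrow> real"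
    have "(\<integral>\<^sup>+t. indicator {x \<in> space (cube C). x c = x d} (x(c := t)) \<partial>unit_unif)
        \<le> (\<integral>\<^sup>+t. indicator {x d} t \<partial>unit_unif)"
      by (rule nn_integral_mono) (use assms(4) in \<open>auto simp: indicator_def\<close>)
    also have "\<dots> = 0"
    proof (cases "x d \<in> {0<..<1}")
      case True
      then have "{x d} \<in> sets unit_unif" by (auto simp: unit_unif_def sets_restrict_space)
      then show ?thesis by (simp add: emeasure_unit_unif_singleton)
    next
      case False
      have "(\<integral>\<^sup>+t. indicator {x d} t \<partial>unit_unif) = (\<integral>\<^sup>+t. 0 \<partial>unit_unif)"
        by (rule nn_integral_cong) (use False in \<open>auto simp: indicator_def\<close>)
      then show ?thesis by simp
    qed
    finally show "(\<integral>\<^sup>+t. indicator {x \<in> space (cube C). x c = x d} (x(c := t)) \<partial>unit_unif) = 0"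
      by simp
  qed
  finally have "emeasure (cube C) {x \<in> space (cube C). x c = x d} = 0" by simp
  then show ?thesis
    by (intro AE_I[OF _ _ N]) auto
qed

lemma AE_cube_inj_on:
  assumes "finite C"
  shows "AE x in cube C. inj_on x C"
proof -
  have "AE x in cube C. \<forall>p\<in>{(c,d) \<in> C \<times> C. c \<noteq> d}. x (fst p) \<noteq> x (snd p)"
  proof (rule AE_finite_allI)
    show "finite {(c,d) \<in> C \<times> C. c \<noteq> d}"
      by (rule finite_subset[of _ "C \<times> C"]) (use assms in auto)
  qed (use assms in \<open>auto intro!: AE_cube_neq\<close>)
  then show ?thesis
    by (rule AE_mp) (auto simp: inj_on_def intro!: AE_I2)
qed

text \<open>Pairwise distinct coordinates can be replaced by their ranks.\<close>

lemma labeling_of_inj_on: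
  assumes "finite C" "inj_on x C" "x \<in> space (cube C)"
  shows "\<exists>!f. f \<in> labelings C \<and> x \<in> order_cell C f"
proof -
  define rk where "rk c = (if c \<in> C then card {d \<in> C. x d \<le> x c} else 0)" for c
  have mono: "rk c < rk d" if "c \<in> C" "d \<in> C" "x c < x d" for c d
  proof -
    have "{e \<in> C. x e \<le> x c} \<subset> {e \<in> C. x e \<le> x d}" using that by force
    then show ?thesis using that assms(1) by (auto simp: rk_def intro!: psubset_card_mono)
  qed
  have inj: "inj_on rk C"
  proof (rule inj_onI, rule ccontr)
    fix c d assume cd: "c \<in> C" "d \<in> C" "rk c = rk d" "c \<noteq> d"
    then have "x c \<noteq> x d" using assms(2) by (auto dest: inj_onD)
    then show False using mono[of c d] mono[of d c] cd by force
  qed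
  have "rk ` C \<subseteq> {1..card C}"
  proof (rule image_subsetI)
    fix c assume c: "c \<in> C"
    then have "{d \<in> C. x d \<le> x c} \<noteq> {}" by auto
    then have "0 < card {d \<in> C. x d \<le> x c}" using assms(1) by (simp add: card_gt_0_iff)
    moreover have "card {d \<in> C. x d \<le> x c} \<le> card C"
      using assms(1) by (intro card_mono) auto
    ultimately show "rk c \<in> {1..card C}" using c by (simp add: rk_def)
  qed
  then have "rk ` C = {1..card C}"
    by (intro card_subset_eq) (simp_all add: card_image[OF inj])
  then have "bij_betw rk C {1..card C}"
    using inj by (simp add: bij_betw_def)
  then have rk_lab: "rk \<in> labelings C" by (simp add: labelings_def rk_def)
  have rk_cell: "x \<in> order_cell C rk"
  proof -
    have "x c < x d" if "c \<in> C" "d \<in> C" "rk c < rk d" for c d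
      using mono[of d c] that by (cases "x c" "x d" rule: linorder_cases)
        (auto dest: inj_onD[OF assms(2)])
    then show ?thesis using assms(3) by (auto simp: order_cell_def)
  qed
  \<comment> \<open>In a labeling, \<open>f c\<close> counts the cells with label at most
    \<open>f c\<close>. Membership in the order cell turns these into the cells with coordinate at
    most \<open>x c\<close>, whose number is the rank.\<close>
  have uniq: "f = rk" if f: "f \<in> labelings C" "x \<in> order_cell C f" for f
  proof
    fix c
    show "f c = rk c"
    proof (cases "c \<in> C")
      case True
      have bij: "bij_betw f C {1..card C}" using f by (simp add: labelings_def)
      have le: "x d \<le> x c \<longleftrightarrow> f d \<le> f c" if "d \<in> C" for d
      proof -
        have 1: "x d < x c" if "f d < f c" using f(2) that \<open>d \<in> C\<close> True by (auto simp: order_cell_def)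
        have 2: "x c < x d" if "f c < f d" using f(2) that \<open>d \<in> C\<close> True by (auto simp: order_cell_def)
        have 3: "d = c" if "f d = f c" using bij that \<open>d \<in> C\<close> True by (auto simp: bij_betw_def dest: inj_onD)
        show ?thesis using 1 2 3 by (cases "f d" "f c" rule: linorder_cases) auto
      qed
      have "bij_betw f {d \<in> C. f d \<le> f c} {1..f c}"
      proof (rule bij_betw_subset[OF bij])
        show "f ` {d \<in> C. f d \<le> f c} = {1..f c}"
        proof
          show "{1..f c} \<subseteq> f ` {d \<in> C. f d \<le> f c}"
          proof
            fix y assume y: "y \<in> {1..f c}"
            have "f c \<in> {1..card C}" using bij True by (auto simp: bij_betw_def)
            with y have "y \<in> f ` C" using bij by (auto simp: bij_betw_def)
            then show "y \<in> f ` {d \<in> C. f d \<le> f c}" using y by auto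
          qed
        qed (use bij in \<open>auto simp: bij_betw_def\<close>)
      qed auto
      then have "card {d \<in> C. f d \<le> f c} = f c" by (auto dest: bij_betw_same_card)
      moreover have "{d \<in> C. f d \<le> f c} = {d \<in> C. x d \<le> x c}" using le by auto
      ultimately show ?thesis using True by (simp add: rk_def)
    qed (use f in \<open>auto simp: labelings_def rk_def\<close>)
  qed
  show ?thesis using rk_lab rk_cell uniq by blast
qed

text \<open>A fixed labeling identifies all labelings with permutations; this yields their number
  and shows that permuting coordinates acts transitively on the order cells.\<close>

lemma bij_betw_permutes_labelings:
  assumes "f \<in> labelings C"
  shows "bij_betw (\<lambda>p. f \<circ> p) {p. p permutes C} (labelings C)"
proof (rule bij_betwI')
  have f: "bij_betw f C {1..card C}" "\<And>x. x \<notin> C \<Longrightarrow> f x = 0" using assms by (auto simp: labelings_def)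
  {
    fix p q assume pq: "p \<in> {p. p permutes C}" "q \<in> {p. p permutes C}"
    show "(f \<circ> p = f \<circ> q) = (p = q)"
    proof
      assume eq: "f \<circ> p = f \<circ> q"
      show "p = q"
      proof
        fix c show "p c = q c"
        proof (cases "c \<in> C")
          case True
          have "f (p c) = f (q c)" using eq by (metis comp_apply)
          then show ?thesis using f(1) pq True permutes_in_image
            by (metis bij_betw_def inj_onD mem_Collect_eq)
        next
          case False
          then show ?thesis using pq by (simp add: permutes_not_in)
        qed
      qed
    qed simp
  next
    fix p assume p: "p \<in> {p. p permutes C}"
    then have "bij_betw (f \<circ> p) C {1..card C}"
      using f(1) by (auto intro: bij_betw_trans permutes_imp_bij)
    moreover have "(f \<circ> p) x = 0" if "x \<notin> C" for x
      using p that f(2) by (simp add: permutes_not_in)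
    ultimately show "f \<circ> p \<in> labelings C" by (auto simp: labelings_def)
  next
    fix g assume g: "g \<in> labelings C"
    then have gb: "bij_betw g C {1..card C}" by (simp add: labelings_def)
    define p where "p c = (if c \<in> C then inv_into C f (g c) else c)" for c
    have "bij_betw (inv_into C f \<circ> g) C C"
      by (rule bij_betw_trans[OF gb bij_betw_inv_into[OF f(1)]])
    then have "bij_betw p C C"
      by (rule iffD1[OF bij_betw_cong, rotated]) (simp add: p_def)
    then have "p permutes C" by (rule bij_imp_permutes) (simp add: p_def)
    moreover have "g = f \<circ> p"
    proof
      fix c
      show "g c = (f \<circ> p) c"
      proof (cases "c \<in> C")
        case True
        then have "g c \<in> f ` C" using gb f(1) by (auto simp: bij_betw_def)
        then show ?thesis using True by (simp add: p_def f_inv_into_f)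
      next
        case False
        then show ?thesis using g f(2) by (simp add: p_def labelings_def)
      qed
    qed
    ultimately show "\<exists>p\<in>{p. p permutes C}. g = f \<circ> p" by blast
  }
qed

lemma labelings_nonempty:
  assumes "finite C"
  obtains f where "f \<in> labelings C"
proof -
  obtain h where h: "bij_betw h C {0..<card C}" using ex_bij_betw_finite_nat[OF assms] by blast
  have "bij_betw Suc {0..<card C} {1..card C}"
    by (simp add: bij_betw_def atLeastLessThanSuc_atLeastAtMost)
  from bij_betw_trans[OF h this] have "bij_betw (\<lambda>c. if c \<in> C then Suc (h c) else 0) C {1..card C}"
    by (rule iffD1[OF bij_betw_cong, rotated]) simp
  then show ?thesis by (intro that[of "\<lambda>c. if c \<in> C then Suc (h c) else 0"]) (simp add: labelings_def)
qed

lemma card_labelings: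
  assumes "finite C"
  shows "finite (labelings C)" "card (labelings C) = fact (card C)"
proof -
  obtain f where "f \<in> labelings C" using labelings_nonempty[OF assms] .
  note b = bij_betw_permutes_labelings[OF this]
  show "finite (labelings C)" using bij_betw_finite[OF b] finite_permutations[OF assms] by simp
  show "card (labelings C) = fact (card C)"
    using bij_betw_same_card[OF b] card_permutations[OF refl assms] by simp
qed

text \<open>Almost every point has distinct coordinates and then lies in exactly one order
  cell.\<close>

lemma nn_integral_order_cells:
  assumes "finite C" and h [measurable]: "h \<in> borel_measurable (cube C)"
  shows "(\<integral>\<^sup>+x. h x \<partial>cube C) = (\<Sum>f\<in>labelings C. \<integral>\<^sup>+x. indicator (order_cell C f) x * h x \<partial>cube C)"
proof -
  have "AE x in cube C. h x = (\<Sum>f\<in>labelings C. indicator (order_cell C f) x * h x)"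
  proof (rule AE_mp[OF AE_cube_inj_on[OF assms(1)]], rule AE_I2, rule impI)
    fix x assume "x \<in> space (cube C)" "inj_on x C"
    then obtain f where f: "f \<in> labelings C" "x \<in> order_cell C f"
      "\<And>g. g \<in> labelings C \<Longrightarrow> x \<in> order_cell C g \<Longrightarrow> g = f"
      using labeling_of_inj_on[OF assms(1)] by blast
    have "(\<Sum>g\<in>labelings C. indicator (order_cell C g) x * h x)
        = (\<Sum>g\<in>labelings C. if g = f then h x else 0)"
    proof (rule sum.cong[OF refl])
      fix g assume "g \<in> labelings C"
      with f(2) f(3)[OF this] have "x \<in> order_cell C g \<longleftrightarrow> g = f" by blast
      then show "indicator (order_cell C g) x * h x = (if g = f then h x else 0)"
        by (simp add: indicator_def)
    qed
    also have "\<dots> = h x" using f(1) card_labelings(1)[OF assms(1)] by (simp only: sum.delta if_True)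
    finally show "h x = (\<Sum>f\<in>labelings C. indicator (order_cell C f) x * h x)" by simp
  qed
  then have "(\<integral>\<^sup>+x. h x \<partial>cube C) = (\<integral>\<^sup>+x. (\<Sum>f\<in>labelings C. indicator (order_cell C f) x * h x) \<partial>cube C)"
    by (rule nn_integral_cong_AE)
  also have "\<dots> = (\<Sum>f\<in>labelings C. \<integral>\<^sup>+x. indicator (order_cell C f) x * h x \<partial>cube C)"
    by (rule nn_integral_sum)
      (use assms(1) in \<open>auto intro!: borel_measurable_times_ennreal borel_measurable_indicator sets_order_cell\<close>)
  finally show ?thesis .
qed

text \<open>Permuting coordinates preserves the measure and \<open>h\<close> and moves any order
  cell to any other, so all cells have equal shares. It serves with \<open>h = 1\<close> to count
  linear extensions and with the Selberg density to restrict to increasing diagonals.\<close>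

lemma nn_integral_order_cell_symmetric:
  assumes "finite C" and h: "h \<in> borel_measurable (cube C)"
    and sym: "\<And>x p. p permutes C \<Longrightarrow> x \<in> space (cube C) \<Longrightarrow> h (x \<circ> p) = h x"
    and f: "f \<in> labelings C"
  shows "fact (card C) * (\<integral>\<^sup>+x. indicator (order_cell C f) x * h x \<partial>cube C) = (\<integral>\<^sup>+x. h x \<partial>cube C)"
proof -
  let ?G = "\<lambda>f. \<integral>\<^sup>+x. indicator (order_cell C f) x * h x \<partial>cube C"
  have eq: "?G g = ?G f" if "g \<in> labelings C" for g
  proof -
    from that bij_betw_permutes_labelings[OF f] obtain p where p: "p permutes C" "g = f \<circ> p"
      by (auto simp: bij_betw_def)
    note ip = permutes_inv[OF p(1)]
    \<comment> \<open>The inverse appears because \<open>x \<circ> inv p\<close> is ordered like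
      \<open>f\<close> exactly when \<open>x\<close> is ordered like
      \<open>f \<circ> p\<close>.\<close>
    have "?G f = (\<integral>\<^sup>+x. indicator (order_cell C f) (x \<circ> inv_into UNIV p) * h (x \<circ> inv_into UNIV p) \<partial>cube C)"
      by (rule nn_integral_cube_permute[OF assms(1) ip, symmetric])
        (intro borel_measurable_times_ennreal borel_measurable_indicator sets_order_cell assms)
    also have "\<dots> = ?G g"
    proof (rule nn_integral_cong)
      fix x assume x: "x \<in> space (cube C)"
      have x': "x \<circ> inv_into UNIV p \<in> space (cube C)"
        by (rule measurable_space[OF measurable_cube_permute[OF assms(1) ip] x])
      have "x \<circ> inv_into UNIV p \<in> order_cell C f \<longleftrightarrow> x \<in> order_cell C g"
      proof
        assume L: "x \<circ> inv_into UNIV p \<in> order_cell C f"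
        have "x c < x d" if "c \<in> C" "d \<in> C" "g c < g d" for c d
        proof -
          have "(x \<circ> inv_into UNIV p) (p c) < (x \<circ> inv_into UNIV p) (p d)"
            using L that unfolding order_cell_def p(2) comp_apply
            by (blast intro: iffD2[OF permutes_in_image[OF p(1)]])
          then show ?thesis by (simp add: permutes_inverses(2)[OF p(1)])
        qed
        then show "x \<in> order_cell C g" using x by (auto simp: order_cell_def)
      next
        assume R: "x \<in> order_cell C g"
        have "x (inv_into UNIV p c) < x (inv_into UNIV p d)" if "c \<in> C" "d \<in> C" "f c < f d" for c d
          using R that p permutes_in_image[OF ip] permutes_inverses(1)[OF p(1)]
          by (auto simp: order_cell_def)
        then show "x \<circ> inv_into UNIV p \<in> order_cell C f" using x' by (auto simp: order_cell_def)
      qed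
      then show "indicator (order_cell C f) (x \<circ> inv_into UNIV p) * h (x \<circ> inv_into UNIV p)
          = indicator (order_cell C g) x * h x"
        using sym[OF ip x] by (simp add: indicator_def)
    qed
    finally show ?thesis by simp
  qed
  have "(\<integral>\<^sup>+x. h x \<partial>cube C) = (\<Sum>g\<in>labelings C. ?G g)"
    by (rule nn_integral_order_cells[OF assms(1,2)])
  also have "\<dots> = (\<Sum>g\<in>labelings C. ?G f)" by (rule sum.cong[OF refl eq])
  also have "\<dots> = fact (card C) * ?G f" using card_labelings(2)[OF assms(1)] by simp
  finally show ?thesis by simp
qed

text \<open>Within an order cell coordinates and labels are ordered alike, so the cell lies inside
  the order polytope or is disjoint from it; every cell has the same measure, the reciprocal of
  \<open>fact (card C)\<close>.\<close>

theorem card_linear_extensions: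
  assumes "finite C" "R \<subseteq> C \<times> C"
  shows "of_nat (card {f \<in> labelings C. \<forall>(c,d)\<in>R. f c < f d})
    = fact (card C) * emeasure (cube C) {x \<in> space (cube C). \<forall>(c,d)\<in>R. x c < x d}"
proof -
  let ?P = "{x \<in> space (cube C). \<forall>(c,d)\<in>R. x c < x d}"
  let ?L = "{f \<in> labelings C. \<forall>(c,d)\<in>R. f c < f d}"
  have P: "?P \<in> sets (cube C)" by (rule sets_cube_All_less[OF assms])
  have cell: "indicator (order_cell C f) x * indicator ?P x
      = (if f \<in> ?L then indicator (order_cell C f) x * 1 else (0::ennreal))"
    if f: "f \<in> labelings C" and x: "x \<in> space (cube C)" for f x
  proof (cases "x \<in> order_cell C f")
    case True
    have bij: "bij_betw f C {1..card C}" using f by (simp add: labelings_def)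
    have "x c < x d \<longleftrightarrow> f c < f d" if "c \<in> C" "d \<in> C" for c d
    proof -
      have "x c < x d" if "f c < f d" using True that \<open>c \<in> C\<close> \<open>d \<in> C\<close> by (auto simp: order_cell_def)
      moreover have "x d < x c" if "f d < f c" using True that \<open>c \<in> C\<close> \<open>d \<in> C\<close> by (auto simp: order_cell_def)
      moreover have "c = d" if "f c = f d"
        using bij that \<open>c \<in> C\<close> \<open>d \<in> C\<close> by (auto simp: bij_betw_def dest: inj_onD)
      ultimately show ?thesis by (cases "f c" "f d" rule: linorder_cases) auto
    qed
    then have "x \<in> ?P \<longleftrightarrow> f \<in> ?L" using f x assms(2) by fastforce
    then show ?thesis by (simp add: indicator_def)
  qed simp
  have pull_if: "(\<integral>\<^sup>+x. (if q then F x else 0) \<partial>cube C) = (if q then \<integral>\<^sup>+x. F x \<partial>cube C else 0)"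
    for q and F :: "_ \<Rightarrow> ennreal"
    by (cases q) simp_all
  have one: "fact (card C) * (\<integral>\<^sup>+x. indicator (order_cell C f) x * 1 \<partial>cube C) = 1"
    if "f \<in> labelings C" for f
  proof -
    interpret prob_space "cube C" by (rule prob_space_cube)
    show ?thesis
      using nn_integral_order_cell_symmetric[OF assms(1) _ _ that, of "\<lambda>_. 1"] emeasure_space_1 by simp
  qed
  have "emeasure (cube C) ?P = (\<integral>\<^sup>+x. indicator ?P x \<partial>cube C)"
    by (rule nn_integral_indicator[OF P, symmetric])
  also have "\<dots> = (\<Sum>f\<in>labelings C. \<integral>\<^sup>+x. indicator (order_cell C f) x * indicator ?P x \<partial>cube C)"
    by (rule nn_integral_order_cells[OF assms(1)]) (rule borel_measurable_indicator[OF P])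
  also have "\<dots> = (\<Sum>f\<in>labelings C. if f \<in> ?L then \<integral>\<^sup>+x. indicator (order_cell C f) x * 1 \<partial>cube C else 0)"
  proof (rule sum.cong[OF refl])
    fix f assume f: "f \<in> labelings C"
    have "(\<integral>\<^sup>+x. indicator (order_cell C f) x * indicator ?P x \<partial>cube C)
        = (\<integral>\<^sup>+x. (if f \<in> ?L then indicator (order_cell C f) x * 1 else 0) \<partial>cube C)"
      by (rule nn_integral_cong) (rule cell[OF f])
    also have "\<dots> = (if f \<in> ?L then \<integral>\<^sup>+x. indicator (order_cell C f) x * 1 \<partial>cube C else 0)"
      by (rule pull_if)
    finally show "(\<integral>\<^sup>+x. indicator (order_cell C f) x * indicator ?P x \<partial>cube C)
        = (if f \<in> ?L then \<integral>\<^sup>+x. indicator (order_cell C f) x * 1 \<partial>cube C else 0)" .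
  qed
  finally have "fact (card C) * emeasure (cube C) ?P
      = (\<Sum>f\<in>labelings C. if f \<in> ?L then fact (card C) * (\<integral>\<^sup>+x. indicator (order_cell C f) x * 1 \<partial>cube C) else 0)"
    by (simp add: sum_distrib_left if_distrib cong: if_cong)
  also have "\<dots> = (\<Sum>f\<in>labelings C. if f \<in> ?L then 1 else 0)"
    by (rule sum.cong[OF refl]) (simp only: one cong: if_cong)
  also have "\<dots> = of_nat (card ?L)"
    using card_labelings(1)[OF assms(1)] by (simp add: sum.If_cases Int_def)
  finally show ?thesis by simp
qed

section \<open>Vandermonde determinants and interlacing integrals\<close>

text \<open>The array is a function on all index pairs with the size kept apart, so that shifting
  rows or columns and changing the size need no matrix operations.\<close>

definition ndet :: "nat \<Rightarrow> (nat \<Rightarrow> nat \<Rightarrow> real) \<Rightarrow> real" where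
  "ndet n a = Determinant.det (mat n n (\<lambda>(i,k). a i k))"

lemma ndet_expand: "ndet n a = (\<Sum>p | p permutes {0..<n}. signof p * (\<Prod>i<n. a i (p i)))"
proof -
  have "ndet n a = (\<Sum>p | p permutes {0..<n}.
      signof p * (\<Prod>i = 0..<n. mat n n (\<lambda>(i,k). a i k) $$ (i, p i)))"
    unfolding ndet_def by (rule det_def') simp
  also have "\<dots> = (\<Sum>p | p permutes {0..<n}. signof p * (\<Prod>i<n. a i (p i)))"
  proof (rule sum.cong[OF refl], rule arg_cong[where f="(*) _"])
    fix p assume "p \<in> {p. p permutes {0..<n}}"
    then have "p i < n" if "i < n" for i
      using that permutes_in_image[of p "{0..<n}" i] by simp
    then show "(\<Prod>i = 0..<n. mat n n (\<lambda>(i,k). a i k) $$ (i, p i)) = (\<Prod>i<n. a i (p i))"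
      by (intro prod.cong) auto
  qed
  finally show ?thesis .
qed

lemma ndet_cong:
  assumes "\<And>i k. i < n \<Longrightarrow> k < n \<Longrightarrow> a i k = b i k"
  shows "ndet n a = ndet n b"
  unfolding ndet_def by (rule arg_cong[where f=Determinant.det], rule eq_matI) (use assms in auto)

lemma ndet_rows_mult: "ndet n (\<lambda>i k. w i * a i k) = (\<Prod>i<n. w i) * ndet n a"
  by (simp add: ndet_expand prod.distrib sum_distrib_left mult_ac)

lemma ndet_mult:
  "ndet n (\<lambda>i k. \<Sum>l<n. a i l * b l k) = ndet n a * ndet n b"
proof -
  have "mat n n (\<lambda>(i,k). \<Sum>l<n. a i l * b l k) = mat n n (\<lambda>(i,k). a i k) * mat n n (\<lambda>(i,k). b i k)"
    by (rule eq_matI) (auto simp: scalar_prod_def atLeast0LessThan intro!: sum.cong)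
  then show ?thesis
    unfolding ndet_def by (simp add: det_mult[of _ n])
qed

lemma prod_list_diag_mat: "prod_list (diag_mat (mat n n (\<lambda>(i,k). a i k))) = (\<Prod>i<n. a i i)"
  by (simp add: prod_list_diag_prod atLeast0LessThan)

lemma ndet_upper_triangular:
  assumes "\<And>i k. k < i \<Longrightarrow> i < n \<Longrightarrow> a i k = 0"
  shows "ndet n a = (\<Prod>i<n. a i i)"
  unfolding ndet_def
  by (subst det_upper_triangular[where n=n]) (use assms in \<open>auto simp: prod_list_diag_mat\<close>)

lemma ndet_lower_triangular:
  assumes "\<And>i k. i < k \<Longrightarrow> k < n \<Longrightarrow> a i k = 0"
  shows "ndet n a = (\<Prod>i<n. a i i)"
  unfolding ndet_def
  by (subst det_lower_triangular[where n=n]) (use assms in \<open>auto simp: prod_list_diag_mat\<close>)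

lemma ndet_first_row:
  assumes "\<And>k. 0 < k \<Longrightarrow> k \<le> n \<Longrightarrow> a 0 k = 0"
  shows "ndet (Suc n) a = a 0 0 * ndet n (\<lambda>i k. a (Suc i) (Suc k))"
proof -
  let ?A = "mat (Suc n) (Suc n) (\<lambda>(i,k). a i k)"
  have "Determinant.det ?A = (\<Sum>j<Suc n. ?A $$ (0,j) * cofactor ?A 0 j)"
    by (rule laplace_expansion_row) auto
  also have "\<dots> = (\<Sum>j\<in>{0}. ?A $$ (0,j) * cofactor ?A 0 j)"
    by (rule sum.mono_neutral_right) (use assms in auto)
  also have "\<dots> = a 0 0 * Determinant.det (mat_delete ?A 0 0)"
    by (simp add: cofactor_def)
  also have "mat_delete ?A 0 0 = mat n n (\<lambda>(i,k). a (Suc i) (Suc k))"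
    by (rule eq_matI) (auto simp: mat_delete_def)
  finally show ?thesis by (simp add: ndet_def)
qed

text \<open>The only entry left in the last row sits at position \<open>(n, 0)\<close>, whose
  cofactor carries the sign \<open>(-1) ^ n\<close>.\<close>

lemma ndet_last_row:
  assumes "\<And>k. 0 < k \<Longrightarrow> k \<le> n \<Longrightarrow> a n k = 0"
  shows "ndet (Suc n) a = (-1) ^ n * a n 0 * ndet n (\<lambda>i k. a i (Suc k))"
proof -
  let ?A = "mat (Suc n) (Suc n) (\<lambda>(i,k). a i k)"
  have "Determinant.det ?A = (\<Sum>j<Suc n. ?A $$ (n,j) * cofactor ?A n j)"
    by (rule laplace_expansion_row) auto
  also have "\<dots> = (\<Sum>j\<in>{0}. ?A $$ (n,j) * cofactor ?A n j)"
    by (rule sum.mono_neutral_right) (use assms in auto)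
  also have "\<dots> = a n 0 * ((-1) ^ n * Determinant.det (mat_delete ?A n 0))"
    by (simp add: cofactor_def)
  also have "mat_delete ?A n 0 = mat n n (\<lambda>(i,k). a i (Suc k))"
    by (rule eq_matI) (auto simp: mat_delete_def)
  finally show ?thesis by (simp add: ndet_def)
qed

lemma ndet_first_column:
  assumes "\<And>i. 0 < i \<Longrightarrow> i \<le> n \<Longrightarrow> a i 0 = 0"
  shows "ndet (Suc n) a = a 0 0 * ndet n (\<lambda>i k. a (Suc i) (Suc k))"
proof -
  let ?A = "mat (Suc n) (Suc n) (\<lambda>(i,k). a i k)"
  have "Determinant.det ?A = (\<Sum>i<Suc n. ?A $$ (i,0) * cofactor ?A i 0)"
    by (rule laplace_expansion_column) auto
  also have "\<dots> = (\<Sum>i\<in>{0}. ?A $$ (i,0) * cofactor ?A i 0)"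
    by (rule sum.mono_neutral_right) (use assms in auto)
  also have "\<dots> = a 0 0 * Determinant.det (mat_delete ?A 0 0)"
    by (simp add: cofactor_def)
  also have "mat_delete ?A 0 0 = mat n n (\<lambda>(i,k). a (Suc i) (Suc k))"
    by (rule eq_matI) (auto simp: mat_delete_def)
  finally show ?thesis by (simp add: ndet_def)
qed

text \<open>Turns a determinant of increments of primitives into one of their values: in the matrix
  bordered by a column of ones, subtracting from each row its predecessor leaves
  \<open>1, 0, ..., 0\<close> in that column.\<close>

lemma ndet_differences:
  "ndet n (\<lambda>i k. G k (z (Suc i)) - G k (z i)) = ndet (Suc n) (\<lambda>i k. if k = 0 then 1 else G (k - 1) (z i))"
proof -
  define M where "M i k = (if k = 0 then 1 else G (k - 1) (z i))" for i k :: nat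
  \<comment> \<open>Lower bidiagonal with ones on the diagonal: multiplying by it performs the row
    subtractions, at determinant 1.\<close>
  define L where "L i l = (if l = i then 1 else if Suc l = i then -1 else 0 :: real)" for i l :: nat
  have sum: "(\<Sum>l<Suc n. L i l * M l k) = (if i = 0 then M 0 k else M i k - M (i - 1) k)" if "i \<le> n" for i k
  proof -
    have "(\<Sum>l<Suc n. L i l * M l k)
        = (\<Sum>l<Suc n. (if l = i then M i k else 0) - (if Suc l = i then M (i - 1) k else 0))"
      by (rule sum.cong) (auto simp: L_def)
    also have "\<dots> = M i k - (\<Sum>l<Suc n. if Suc l = i then M (i - 1) k else 0)"
      using that by (simp add: sum_subtractf del: sum.lessThan_Suc)
    also have "(\<Sum>l<Suc n. if Suc l = i then M (i - 1) k else 0) = (if i = 0 then 0 else M (i - 1) k)"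
    proof (cases i)
      case (Suc j)
      then show ?thesis using that by (simp del: sum.lessThan_Suc)
    qed simp
    finally show ?thesis by simp
  qed
  have "ndet (Suc n) L = 1"
    by (subst ndet_lower_triangular) (auto simp: L_def)
  then have "ndet (Suc n) M = ndet (Suc n) (\<lambda>i k. \<Sum>l<Suc n. L i l * M l k)"
    by (simp add: ndet_mult del: sum.lessThan_Suc)
  also have "\<dots> = ndet (Suc n) (\<lambda>i k. if i = 0 then M 0 k else M i k - M (i - 1) k)"
    by (rule ndet_cong) (simp add: sum del: sum.lessThan_Suc)
  also have "\<dots> = ndet n (\<lambda>i k. G k (z (Suc i)) - G k (z i))"
    by (subst ndet_first_column) (auto simp: M_def)
  finally show ?thesis unfolding M_def by (rule sym)
qed

text \<open>Signed, in contrast to \<open>abs_vandermonde\<close>; on increasing sequences the two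
  agree.\<close>

definition vandermonde :: "nat \<Rightarrow> (nat \<Rightarrow> real) \<Rightarrow> real" where
  "vandermonde n y = (\<Prod>k<n. \<Prod>l<k. y k - y l)"

lemma poly_eq_sum_less:
  fixes p :: "real poly"
  assumes "degree p < n"
  shows "poly p x = (\<Sum>l<n. x ^ l * coeff p l)"
proof -
  have "poly p x = (\<Sum>l\<le>degree p. coeff p l * x ^ l)" by (rule poly_altdef)
  also have "\<dots> = (\<Sum>l<n. coeff p l * x ^ l)"
    by (rule sum.mono_neutral_left) (use assms in \<open>auto simp: coeff_eq_0\<close>)
  finally show ?thesis by (simp add: mult.commute)
qed

text \<open>Expanding in powers factors the matrix, and the degree bounds make the coefficient
  matrix upper triangular.\<close>

lemma ndet_polys_powers:
  fixes q :: "nat \<Rightarrow> real poly"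
  assumes "\<And>k. k < n \<Longrightarrow> degree (q k) \<le> k"
  shows "ndet n (\<lambda>i k. poly (q k) (y i)) = (\<Prod>k<n. coeff (q k) k) * ndet n (\<lambda>i k. y i ^ k)"
proof -
  have "ndet n (\<lambda>i k. poly (q k) (y i)) = ndet n (\<lambda>i k. \<Sum>l<n. y i ^ l * coeff (q k) l)"
    by (rule ndet_cong, rule poly_eq_sum_less) (use assms le_less_trans in blast)
  also have "\<dots> = ndet n (\<lambda>i k. y i ^ k) * ndet n (\<lambda>l k. coeff (q k) l)"
    by (rule ndet_mult)
  also have "ndet n (\<lambda>l k. coeff (q k) l) = (\<Prod>k<n. coeff (q k) k)"
  proof (rule ndet_upper_triangular)
    fix i k assume "k < i" "i < n"
    then have "degree (q k) < i" using assms[of k] by linarith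
    then show "coeff (q k) i = 0" by (rule coeff_eq_0)
  qed
  finally show ?thesis by simp
qed

lemma ndet_powers: "ndet n (\<lambda>i k. y i ^ k) = vandermonde n y"
proof -
  \<comment> \<open>Newton's basis makes the matrix triangular.\<close>
  define q where "q k = (\<Prod>l<k. [:- y l, 1:])" for k
  have deg: "degree (q k) = k" for k
    unfolding q_def by (subst degree_prod_eq_sum_degree) auto
  have lead: "coeff (q k) k = 1" for k
  proof -
    have "lead_coeff (q k) = 1" unfolding q_def by (simp add: lead_coeff_prod)
    then show ?thesis by (simp add: deg)
  qed
  have "ndet n (\<lambda>i k. poly (q k) (y i)) = ndet n (\<lambda>i k. y i ^ k)"
    by (subst ndet_polys_powers) (simp_all add: deg lead)
  moreover have "ndet n (\<lambda>i k. poly (q k) (y i)) = (\<Prod>k<n. poly (q k) (y k))"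
    by (rule ndet_lower_triangular) (auto simp: q_def poly_prod)
  ultimately show ?thesis by (simp add: vandermonde_def q_def poly_prod)
qed

lemma ndet_polys:
  fixes q :: "nat \<Rightarrow> real poly"
  assumes "\<And>k. k < n \<Longrightarrow> degree (q k) \<le> k"
  shows "ndet n (\<lambda>i k. poly (q k) (y i)) = (\<Prod>k<n. coeff (q k) k) * vandermonde n y"
  using ndet_polys_powers[OF assms] by (simp add: ndet_powers)

section \<open>Integrals over interlacing regions\<close>

lemma integrable_unit_unif_continuous:
  fixes g :: "real \<Rightarrow> real"
  assumes "continuous_on UNIV g" "0 \<le> a" "a \<le> b" "b \<le> 1"
  shows "\<exists>B. \<forall>t\<in>{0..1}. \<bar>g t\<bar> \<le> B"
    and "integrable unit_unif (\<lambda>t. indicator {a<..<b} t * g t)"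
proof -
  have "bounded (g ` {0..1})"
    by (intro compact_imp_bounded compact_continuous_image continuous_on_subset[OF assms(1)]) auto
  then show bnd: "\<exists>B. \<forall>t\<in>{0..1}. \<bar>g t\<bar> \<le> B" unfolding bounded_iff by auto
  then obtain B where B: "\<forall>t\<in>{0..1}. \<bar>g t\<bar> \<le> B" by blast
  interpret prob_space unit_unif by (rule prob_space_unit_unif)
  have [measurable]: "g \<in> borel_measurable borel"
    using assms(1) by (rule borel_measurable_continuous_onI)
  show "integrable unit_unif (\<lambda>t. indicator {a<..<b} t * g t)"
  proof (rule integrable_const_bound)
    show "AE t in unit_unif. norm (indicator {a<..<b} t * g t) \<le> B"
    proof (rule AE_I2)
      fix t assume "t \<in> space unit_unif"
      then have "\<bar>g t\<bar> \<le> B" using B by auto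
      then show "norm (indicator {a<..<b} t * g t) \<le> B"
        by (auto simp: indicator_def)
    qed
    show "(\<lambda>t. indicator {a<..<b} t * g t) \<in> borel_measurable unit_unif"
      by (rule measurable_unit_unif) measurable
  qed
qed

text \<open>The slab confines each coordinate to an interval of its own, so every term of the
  Leibniz expansion is a product of functions of single coordinates and integrates to a product of
  increments. The map \<open>c\<close> places the coordinates at cells of a page.\<close>

lemma integral_interlacing_det:
  fixes c :: "nat \<Rightarrow> 'c" and g G :: "nat \<Rightarrow> real \<Rightarrow> real" and z :: "nat \<Rightarrow> real"
  assumes c: "inj_on c {..<n}"
    and z: "\<And>i. i < n \<Longrightarrow> 0 \<le> z i \<and> z i \<le> z (Suc i) \<and> z (Suc i) \<le> 1"
    and G: "\<And>k t. k < n \<Longrightarrow> (G k has_real_derivative g k t) (at t)"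
    and g: "\<And>k. k < n \<Longrightarrow> continuous_on UNIV (g k)"
  defines "slab \<equiv> \<lambda>y. \<Prod>i<n. indicator {z i<..<z (Suc i)} (y (c i)) :: real"
  shows "integrable (cube (c ` {..<n})) (\<lambda>y. slab y * ndet n (\<lambda>i k. g k (y (c i))))"
    and "(\<integral>y. slab y * ndet n (\<lambda>i k. g k (y (c i))) \<partial>cube (c ` {..<n}))
      = ndet n (\<lambda>i k. G k (z (Suc i)) - G k (z i))"
proof -
  let ?I = "c ` {..<n}"
  let ?d = "the_inv_into {..<n} c"
  have d: "?d (c i) = i" if "i < n" for i using c that by (simp add: the_inv_into_f_f)
  \<comment> \<open>The factor at coordinate \<open>a\<close> in the Leibniz term of
    \<open>p\<close>; \<open>?d\<close> recovers the position of \<open>a\<close>.\<close>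
  define F where "F p a t = indicator {z (?d a)<..<z (Suc (?d a))} t * g (p (?d a)) t"
    for p :: "nat \<Rightarrow> nat" and a :: 'c and t :: real
  have F_prod: "(\<Prod>a\<in>?I. F p a (y a)) = slab y * (\<Prod>i<n. g (p i) (y (c i)))" for p y
  proof -
    have "(\<Prod>a\<in>?I. F p a (y a)) = (\<Prod>i<n. F p (c i) (y (c i)))"
      by (subst prod.reindex[OF c]) simp
    also have "\<dots> = (\<Prod>i<n. indicator {z i<..<z (Suc i)} (y (c i)) * g (p i) (y (c i)))"
      by (rule prod.cong) (auto simp: F_def d)
    finally show ?thesis by (simp add: prod.distrib slab_def)
  qed
  have pn: "p i < n" if "p permutes {0..<n}" "i < n" for p i
    using permutes_in_image[OF that(1), of i] that(2) by simp
  have F_int: "integrable unit_unif (F p a)" if p: "p permutes {0..<n}" and a: "a \<in> ?I" for p a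
  proof -
    from a obtain i where i: "i < n" "a = c i" by auto
    show ?thesis
      unfolding F_def[abs_def] i(2) d[OF i(1)]
      by (rule integrable_unit_unif_continuous(2)) (use z[OF i(1)] g[OF pn[OF p i(1)]] in auto)
  qed
  have F_val: "integral\<^sup>L unit_unif (F p (c i)) = G (p i) (z (Suc i)) - G (p i) (z i)"
    if p: "p permutes {0..<n}" and i: "i < n" for p i
  proof -
    note pi = pn[OF p i]
    obtain B where B: "\<forall>t\<in>{0..1}. \<bar>g (p i) t\<bar> \<le> B"
      using integrable_unit_unif_continuous(1)[OF g[OF pi], of 0 1] by auto
    show ?thesis
      unfolding F_def[abs_def] d[OF i]
    proof (rule integral_unit_unif_FTC[where S="{}" and B=B])
      show "continuous_on {z i..z (Suc i)} (G (p i))"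
        using G[OF pi] by (intro continuous_at_imp_continuous_on ballI) (auto intro: DERIV_isCont)
      show "\<bar>g (p i) t\<bar> \<le> B" if "t \<in> {z i<..<z (Suc i)}" for t
        using B z[OF i] that by auto
      show "g (p i) \<in> borel_measurable borel"
        by (rule borel_measurable_continuous_onI[OF g[OF pi]])
    qed (use z[OF i] G[OF pi] in auto)
  qed
  have int: "integrable (cube ?I) (\<lambda>y. \<Prod>a\<in>?I. F p a (y a))" if "p permutes {0..<n}" for p
    by (rule product_sigma_finite.product_integrable_prod[OF product_sigma_finite_unit_unif])
      (use F_int[OF that] in auto)
  have val: "(\<integral>y. (\<Prod>a\<in>?I. F p a (y a)) \<partial>cube ?I) = (\<Prod>i<n. G (p i) (z (Suc i)) - G (p i) (z i))"
    if "p permutes {0..<n}" for p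
  proof -
    have "(\<integral>y. (\<Prod>a\<in>?I. F p a (y a)) \<partial>cube ?I) = (\<Prod>a\<in>?I. integral\<^sup>L unit_unif (F p a))"
      by (rule cube_integral_prod) (use F_int[OF that] in auto)
    also have "\<dots> = (\<Prod>i<n. integral\<^sup>L unit_unif (F p (c i)))"
      by (subst prod.reindex[OF c]) simp
    also have "\<dots> = (\<Prod>i<n. G (p i) (z (Suc i)) - G (p i) (z i))"
      by (rule prod.cong) (auto simp: F_val[OF that])
    finally show ?thesis .
  qed
  have eq: "slab y * ndet n (\<lambda>i k. g k (y (c i)))
      = (\<Sum>p | p permutes {0..<n}. signof p * (\<Prod>a\<in>?I. F p a (y a)))" for y
    unfolding ndet_expand F_prod by (simp add: sum_distrib_left mult_ac)
  show "integrable (cube ?I) (\<lambda>y. slab y * ndet n (\<lambda>i k. g k (y (c i))))"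
    unfolding eq by (intro Bochner_Integration.integrable_sum integrable_mult_right int) auto
  have "(\<integral>y. slab y * ndet n (\<lambda>i k. g k (y (c i))) \<partial>cube ?I)
      = (\<Sum>p | p permutes {0..<n}. \<integral>y. signof p * (\<Prod>a\<in>?I. F p a (y a)) \<partial>cube ?I)"
    unfolding eq by (intro Bochner_Integration.integral_sum integrable_mult_right int) auto
  also have "\<dots> = (\<Sum>p | p permutes {0..<n}. signof p * (\<Prod>i<n. G (p i) (z (Suc i)) - G (p i) (z i)))"
    by (rule sum.cong) (auto simp: val)
  finally show "(\<integral>y. slab y * ndet n (\<lambda>i k. g k (y (c i))) \<partial>cube ?I)
      = ndet n (\<lambda>i k. G k (z (Suc i)) - G k (z i))"
    by (simp add: ndet_expand)
qed

text \<open>A Vandermonde product with weight \<open>w\<close> is, up to leading coefficients, the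
  determinant of the functions \<open>w * q k\<close> for any polynomials \<open>q k\<close> of
  exact degree \<open>k\<close>. This freedom allows the \<open>q k\<close> to be chosen to suit
  convenient primitives.\<close>

lemma interlacing_integral:
  fixes c :: "nat \<Rightarrow> 'c" and q :: "nat \<Rightarrow> real poly" and w :: "real \<Rightarrow> real"
    and G :: "nat \<Rightarrow> real \<Rightarrow> real" and z :: "nat \<Rightarrow> real"
  assumes c: "inj_on c {..<n}"
    and z: "\<And>i. i < n \<Longrightarrow> 0 \<le> z i \<and> z i \<le> z (Suc i) \<and> z (Suc i) \<le> 1"
    and q: "\<And>k. k < n \<Longrightarrow> degree (q k) \<le> k" "\<And>k. k < n \<Longrightarrow> coeff (q k) k \<noteq> 0"
    and w: "continuous_on UNIV w"
    and G: "\<And>k t. k < n \<Longrightarrow> (G k has_real_derivative w t * poly (q k) t) (at t)"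
  defines "F \<equiv> \<lambda>y. (\<Prod>i<n. indicator {z i<..<z (Suc i)} (y (c i))) * ((\<Prod>i<n. w (y (c i))) * vandermonde n (y \<circ> c)) :: real"
  shows "integrable (cube (c ` {..<n})) F"
    and "(\<integral>y. F y \<partial>cube (c ` {..<n}))
      = ndet (Suc n) (\<lambda>i k. if k = 0 then 1 else G (k - 1) (z i)) / (\<Prod>k<n. coeff (q k) k)"
proof -
  let ?C = "\<Prod>k<n. coeff (q k) k"
  have C: "?C \<noteq> 0" using q(2) by simp
  have g: "continuous_on UNIV (\<lambda>t. w t * poly (q k) t)" for k
    by (intro continuous_intros w)
  note I = integral_interlacing_det[where z=z and G=G and g="\<lambda>k t. w t * poly (q k) t", OF c z G g]
  have det: "ndet n (\<lambda>i k. w (y (c i)) * poly (q k) (y (c i)))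
      = ?C * ((\<Prod>i<n. w (y (c i))) * vandermonde n (y \<circ> c))" for y
    using ndet_polys[OF q(1), where y="y \<circ> c"] by (simp add: ndet_rows_mult)
  have F: "(\<Prod>i<n. indicator {z i<..<z (Suc i)} (y (c i))) * ndet n (\<lambda>i k. w (y (c i)) * poly (q k) (y (c i)))
      = ?C * F y" for y
    unfolding det F_def by (simp add: mult_ac)
  have int: "integrable (cube (c ` {..<n})) (\<lambda>y. ?C * F y)"
    using I(1) unfolding F .
  have "integrable (cube (c ` {..<n})) (\<lambda>y. (1 / ?C) * (?C * F y))"
    by (rule integrable_mult_right[OF int])
  then show "integrable (cube (c ` {..<n})) F" using C by simp
  have "?C * (\<integral>y. F y \<partial>cube (c ` {..<n})) = (\<integral>y. ?C * F y \<partial>cube (c ` {..<n}))"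
    by simp
  also have "\<dots> = ndet (Suc n) (\<lambda>i k. if k = 0 then 1 else G (k - 1) (z i))"
    using I(2) unfolding F ndet_differences .
  finally show "(\<integral>y. F y \<partial>cube (c ` {..<n}))
      = ndet (Suc n) (\<lambda>i k. if k = 0 then 1 else G (k - 1) (z i)) / ?C"
    using C by (simp add: field_simps)
qed

text \<open>\<open>W\<close> is the primitive of the bare weight, needed for the constant polynomial
  when \<open>p\<close> and \<open>q\<close> are both positive. Integration by parts trades a factor
  \<open>1 - t\<close> for a factor \<open>t\<close>, so \<open>a\<close> must vary in the
  induction.\<close>

lemma incomplete_beta:
  "\<exists>W. (\<forall>t. (W has_real_derivative t ^ a * (1 - t) ^ b) (at t)) \<and> W 0 = 0 \<and>
    W 1 = (fact a * fact b / fact (a + b + 1) :: real)"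
proof (induction b arbitrary: a)
  case 0
  have "((\<lambda>t::real. t ^ Suc a / (a + 1)) has_real_derivative t ^ a * (1 - t) ^ 0) (at t)" for t
    using DERIV_cdivide[OF DERIV_pow[of "Suc a" t], of "real (a + 1)"] by simp
  then show ?case by (intro exI[of _ "\<lambda>t. t ^ Suc a / (a + 1)"]) (simp add: add.commute)
next
  case (Suc b)
  from Suc.IH[of "Suc a"] obtain W where W: "\<And>t. (W has_real_derivative t ^ Suc a * (1 - t) ^ b) (at t)"
    "W 0 = 0" "W 1 = fact (Suc a) * fact b / fact (Suc a + b + 1)" by blast
  \<comment> \<open>The derivative of \<open>t ^ Suc a * (1 - t) ^ Suc b\<close> contains the
    unwanted term \<open>- (b + 1) * t ^ Suc a * (1 - t) ^ b\<close>, which the multiple of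
    \<open>W\<close> cancels.\<close>
  let ?V = "\<lambda>t. (t ^ Suc a * (1 - t) ^ Suc b + (b + 1) * W t) / (a + 1)"
  have "(?V has_real_derivative t ^ a * (1 - t) ^ Suc b) (at t)" for t
  proof -
    have 1: "((\<lambda>t. t ^ Suc a) has_real_derivative (a + 1) * t ^ a) (at t)"
      using DERIV_pow[of "Suc a" t] by simp
    have 2: "((\<lambda>t. real (b + 1) * W t) has_real_derivative (b + 1) * (t ^ Suc a * (1 - t) ^ b)) (at t)"
      by (rule DERIV_cmult[OF W(1)])
    show ?thesis
      by (rule DERIV_cong[OF DERIV_cdivide[OF DERIV_add[OF DERIV_mult[OF 1 has_real_derivative_one_minus_power] 2]]])
        (simp add: field_simps)
  qed
  moreover have "?V 1 = fact a * fact (Suc b) / fact (a + Suc b + 1)"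
  proof -
    have alg: "real (b + 1) * (real (Suc a) * A * B / X) / real (a + 1) = A * (real (Suc b) * B) / X" for A B X
      by (simp add: add.commute)
    have "Suc a + b + 1 = a + Suc b + 1" by simp
    then show ?thesis using alg[of "fact a" "fact b" "fact (a + Suc b + 1)"]
      by (simp only: W(3) fact_Suc[of a] fact_Suc[of b]) simp
  qed
  ultimately show ?case using W(2) by (intro exI[of _ ?V]) simp
qed

lemma prod_add_fact:
  "0 < p \<Longrightarrow> (\<Prod>k<n. real (p + k)) * fact (p - 1) = fact (n + p - 1)"
proof (induction n)
  case (Suc n)
  have "(\<Prod>k<Suc n. real (p + k)) * fact (p - 1) = real (p + n) * ((\<Prod>k<n. real (p + k)) * fact (p - 1))"
    by simp
  also have "\<dots> = real (p + n) * fact (n + p - 1)" using Suc by simp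
  also have "\<dots> = fact (Suc n + p - 1)"
    using Suc.prems fact_reduce[of "n + p", where 'a=real] by (simp add: add.commute)
  finally show ?case .
qed simp

lemma ndet_shifted_powers:
  "ndet n (\<lambda>i k. x i ^ (p + k) * (1 - x i) ^ q) = (\<Prod>i<n. x i ^ p * (1 - x i) ^ q) * vandermonde n x"
proof -
  have "ndet n (\<lambda>i k. x i ^ (p + k) * (1 - x i) ^ q) = ndet n (\<lambda>i k. (x i ^ p * (1 - x i) ^ q) * x i ^ k)"
    by (rule ndet_cong) (simp add: power_add mult_ac)
  then show ?thesis by (simp add: ndet_rows_mult ndet_powers)
qed

text \<open>The entries of the first off-diagonal interlace with the diagonal entries, extended by the bounds
  \<open>0\<close> and \<open>1\<close> of the cube at the ends where the staircase continues.\<close>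

definition interlacing_points :: "nat \<Rightarrow> nat \<Rightarrow> (nat \<Rightarrow> real) \<Rightarrow> nat \<Rightarrow> real" where
  "interlacing_points n p x i =
    (if 0 < p then (if i = 0 then 0 else if i \<le> n then x (i - 1) else 1) else if i < n then x i else 1)"

text \<open>Length of the diagonal \<open>a + 1 = b + p\<close>: for \<open>0 < n\<close> it has
  \<open>n - 1\<close> cells between consecutive diagonal cells, one more above the first of them if
  \<open>0 < p\<close>, and one more to the right of the last if \<open>0 < q\<close>.\<close>

definition next_diag_length :: "nat \<Rightarrow> nat \<Rightarrow> nat \<Rightarrow> nat" where
  "next_diag_length n p q = n + (if 0 < p then 1 else 0) + (if 0 < q then 1 else 0) - 1"

lemma interlacing_points_mono:
  assumes x: "\<And>i. i < n \<Longrightarrow> 0 < x i \<and> x i < 1" "\<And>i. Suc i < n \<Longrightarrow> x i < x (Suc i)"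
    and i: "i < next_diag_length n p q"
  shows "0 \<le> interlacing_points n p x i \<and> interlacing_points n p x i \<le> interlacing_points n p x (Suc i)
    \<and> interlacing_points n p x (Suc i) \<le> 1"
proof (cases "0 < p")
  case True
  have "x (i - 1) < x i" if "0 < i" "i < n" using x(2)[of "i - 1"] that by simp
  then show ?thesis
    using True x(1)[of i] x(1)[of "i - 1"] i
    by (auto simp: interlacing_points_def next_diag_length_def less_imp_le split: if_splits)
next
  case False
  then show ?thesis
    using x(1)[of i] x(1)[of "Suc i"] x(2)[of i] i
    by (auto simp: interlacing_points_def next_diag_length_def less_imp_le split: if_splits)
qed

text \<open>The derivative is the weight times a polynomial of degree \<open>Suc k\<close>; for
  positive \<open>p\<close> and \<open>q\<close> these functions serve as primitives in every column
  except that of the constant polynomial.\<close>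

lemma has_real_derivative_powers:
  "((\<lambda>t. t ^ (Suc a + k) * (1 - t) ^ Suc b) has_real_derivative
    t ^ a * (1 - t) ^ b * ((real (Suc a + k)) * t ^ k - real (Suc a + Suc b + k) * t ^ Suc k)) (at t)"
proof -
  have 1: "((\<lambda>t. t ^ (Suc a + k)) has_real_derivative real (Suc a + k) * t ^ (a + k)) (at t)"
    using DERIV_pow[of "Suc a + k" t] by simp
  show ?thesis
    by (rule DERIV_cong[OF DERIV_mult[OF 1 has_real_derivative_one_minus_power]])
      (simp add: power_add algebra_simps)
qed

text \<open>One layer of a page: a function of the next diagonal with lowered exponents integrates
  to the same kind of function of the diagonal itself. The cases differ in which of the bounds 0 and
  1 occur among the interlacing points. The primitives are chosen to vanish at these bounds as far
  as possible, which makes the corresponding rows trivial.\<close>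

lemma interlacing_volume:
  fixes c :: "nat \<Rightarrow> 'c" and n p q :: nat
  assumes pos: "0 < n + p + q"
    and x: "\<And>i. i < n \<Longrightarrow> 0 < x i \<and> x i < 1" "\<And>i. Suc i < n \<Longrightarrow> x i < x (Suc i)"
  defines "N \<equiv> next_diag_length n p q" and "z \<equiv> interlacing_points n p x"
  assumes c: "inj_on c {..<N}"
  defines "F \<equiv> \<lambda>y. (\<Prod>i<N. indicator {z i<..<z (Suc i)} (y (c i))) *
    ((\<Prod>i<N. y (c i) ^ (p - 1) * (1 - y (c i)) ^ (q - 1)) * vandermonde N (y \<circ> c)) :: real"
  shows "integrable (cube (c ` {..<N})) F \<and> (\<integral>y. F y \<partial>cube (c ` {..<N}))
    = fact (p - 1) * fact (q - 1) / fact (n + p + q - 1) *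
      ((\<Prod>i<n. x i ^ p * (1 - x i) ^ q) * vandermonde n x)"
proof -
  have z: "0 \<le> z i \<and> z i \<le> z (Suc i) \<and> z (Suc i) \<le> 1" if "i < N" for i
    unfolding z_def by (rule interlacing_points_mono[where x=x, OF x]) (use that in \<open>auto simp: N_def\<close>)
  have w: "continuous_on UNIV (\<lambda>t::real. t ^ (p - 1) * (1 - t) ^ (q - 1))"
    by (intro continuous_intros)
  consider "p = 0" "q = 0" | "0 < p" "q = 0" | "p = 0" "0 < q" | "0 < p" "0 < q" by blast
  then show ?thesis
  proof cases
    \<comment> \<open>No bound occurs: all interlacing points are diagonal entries, and the bordered
      matrix is itself the matrix of powers.\<close>
    case 1
    then obtain n' where n': "n = Suc n'" using pos by (cases n) auto
    have N: "N = n'" using 1 by (simp add: N_def next_diag_length_def n')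
    define Q :: "nat \<Rightarrow> real poly" where "Q k = Polynomial.monom (k + 1) k" for k
    have G: "((\<lambda>t. t ^ Suc k) has_real_derivative
        t ^ (p - 1) * (1 - t) ^ (q - 1) * poly (Q k) t) (at t)" for k t
      using DERIV_pow[of "Suc k" t] 1 by (simp add: Q_def poly_monom add.commute)
    have I: "integrable (cube (c ` {..<N})) F"
      "(\<integral>y. F y \<partial>cube (c ` {..<N})) = ndet (Suc N) (\<lambda>i k. if k = 0 then 1 else z i ^ Suc (k - 1)) / (\<Prod>k<N. coeff (Q k) k)"
      unfolding F_def
      by (rule interlacing_integral[where z=z and q=Q and G="\<lambda>k t. t ^ Suc k" and w="\<lambda>t. t ^ (p - 1) * (1 - t) ^ (q - 1)", OF c z _ _ w G];
          simp add: Q_def degree_monom_eq del: of_nat_Suc)+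
    have "ndet (Suc N) (\<lambda>i k. if k = 0 then 1 else z i ^ Suc (k - 1)) = ndet n (\<lambda>i k. x i ^ k)"
      unfolding N n' by (rule ndet_cong) (use 1 in \<open>auto simp: z_def interlacing_points_def n'\<close>)
    moreover have "(\<Prod>k<N. coeff (Q k) k) = fact n'"
      using prod_add_fact[of 1 N] by (simp add: Q_def N add.commute)
    ultimately show ?thesis using I 1 n' by (simp add: ndet_powers)
  next
    \<comment> \<open>At the point \<open>z 0 = 0\<close> all primitives \<open>t ^ (p + k)\<close>
      vanish, so the first row is \<open>1, 0, ..., 0\<close>.\<close>
    case 2
    have N: "N = n" using 2 by (simp add: N_def next_diag_length_def)
    define Q :: "nat \<Rightarrow> real poly" where "Q k = Polynomial.monom (p + k) k" for k
    obtain p' where p': "p = Suc p'" using 2 by (cases p) auto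
    have G: "((\<lambda>t. t ^ (p + k)) has_real_derivative
        t ^ (p - 1) * (1 - t) ^ (q - 1) * poly (Q k) t) (at t)" for k t
      using DERIV_pow[of "p + k" t] 2 by (simp add: Q_def poly_monom p' power_add mult_ac)
    have I: "integrable (cube (c ` {..<N})) F"
      "(\<integral>y. F y \<partial>cube (c ` {..<N})) = ndet (Suc N) (\<lambda>i k. if k = 0 then 1 else z i ^ (p + (k - 1))) / (\<Prod>k<N. coeff (Q k) k)"
      unfolding F_def
      by (rule interlacing_integral[where z=z and q=Q and G="\<lambda>k t. t ^ (p + k)" and w="\<lambda>t. t ^ (p - 1) * (1 - t) ^ (q - 1)", OF c z _ _ w G];
          simp add: Q_def degree_monom_eq 2 del: of_nat_add)+
    have "ndet (Suc N) (\<lambda>i k. if k = 0 then 1 else z i ^ (p + (k - 1))) = ndet n (\<lambda>i k. z (Suc i) ^ (p + k))"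
      unfolding N by (subst ndet_first_row) (use 2 in \<open>auto simp: z_def interlacing_points_def\<close>)
    also have "\<dots> = ndet n (\<lambda>i k. x i ^ (p + k) * (1 - x i) ^ q)"
      by (rule ndet_cong) (use 2 in \<open>auto simp: z_def interlacing_points_def\<close>)
    finally have "ndet (Suc N) (\<lambda>i k. if k = 0 then 1 else z i ^ (p + (k - 1)))
      = (\<Prod>i<n. x i ^ p * (1 - x i) ^ q) * vandermonde n x" unfolding ndet_shifted_powers .
    moreover have "fact (n + p - 1) = (\<Prod>k<N. coeff (Q k) k) * (fact (p - 1) :: real)"
      using prod_add_fact[of p N] 2 by (simp add: Q_def N)
    ultimately show ?thesis using I 2 by simp
  next
    case 3
    have N: "N = n" using 3 by (simp add: N_def next_diag_length_def)
    \<comment> \<open>For \<open>k = 0\<close> the first monomial has coefficient 0, so the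
      truncated \<open>k - 1\<close> does no harm. The leading coefficients are negative; their sign
      \<open>(-1) ^ n\<close> cancels the one from expanding along the last row, where the
      primitives vanish at 1.\<close>
    define Q :: "nat \<Rightarrow> real poly" where "Q k = Polynomial.monom k (k - 1) - Polynomial.monom (q + k) k" for k
    obtain q' where q': "q = Suc q'" using 3 by (cases q) auto
    have cQ: "coeff (Q k) k = - real (q + k)" for k by (cases k) (auto simp: Q_def)
    have dQ: "degree (Q k) \<le> k" for k
      unfolding Q_def by (intro degree_diff_le order_trans[OF degree_monom_le]) auto
    have G: "((\<lambda>t. t ^ k * (1 - t) ^ q) has_real_derivative
        t ^ (p - 1) * (1 - t) ^ (q - 1) * poly (Q k) t) (at t)" for k t
    proof -
      have 1: "((\<lambda>t. t ^ k) has_real_derivative real k * t ^ (k - 1)) (at t)"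
        using DERIV_pow[of k t] by simp
      show ?thesis
        unfolding q'
        by (rule DERIV_cong[OF DERIV_mult[OF 1 has_real_derivative_one_minus_power]])
          (use 3 in \<open>cases k; simp add: Q_def poly_monom q' algebra_simps\<close>)
    qed
    have I: "integrable (cube (c ` {..<N})) F"
      "(\<integral>y. F y \<partial>cube (c ` {..<N})) = ndet (Suc N) (\<lambda>i k. if k = 0 then 1 else z i ^ (k - 1) * (1 - z i) ^ q) / (\<Prod>k<N. coeff (Q k) k)"
      unfolding F_def
      by (rule interlacing_integral[where z=z and q=Q and G="\<lambda>k t. t ^ k * (1 - t) ^ q" and w="\<lambda>t. t ^ (p - 1) * (1 - t) ^ (q - 1)", OF c z dQ _ w G]; use 3 in \<open>simp add: cQ\<close>)+
    have "ndet (Suc N) (\<lambda>i k. if k = 0 then 1 else z i ^ (k - 1) * (1 - z i) ^ q)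
        = (-1) ^ n * ndet n (\<lambda>i k. z i ^ k * (1 - z i) ^ q)"
      unfolding N by (subst ndet_last_row) (use 3 in \<open>auto simp: z_def interlacing_points_def\<close>)
    also have "ndet n (\<lambda>i k. z i ^ k * (1 - z i) ^ q) = ndet n (\<lambda>i k. x i ^ (p + k) * (1 - x i) ^ q)"
      by (rule ndet_cong) (use 3 in \<open>auto simp: z_def interlacing_points_def\<close>)
    finally have "ndet (Suc N) (\<lambda>i k. if k = 0 then 1 else z i ^ (k - 1) * (1 - z i) ^ q)
      = (-1) ^ n * ((\<Prod>i<n. x i ^ p * (1 - x i) ^ q) * vandermonde n x)" unfolding ndet_shifted_powers .
    moreover have "(\<Prod>k<N. coeff (Q k) k) = (-1) ^ n * (\<Prod>k<N. real (q + k))"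
      unfolding cQ N by (simp only: prod_uminus card_lessThan)
    moreover have "fact (n + q - 1) = (\<Prod>k<N. real (q + k)) * (fact (q - 1) :: real)"
      using prod_add_fact[of q N] 3 by (simp add: N)
    ultimately show ?thesis using I 3 by simp
  next
    case 4
    have N: "N = Suc n" using 4 by (simp add: N_def next_diag_length_def)
    obtain p' q' where p': "p = Suc p'" and q': "q = Suc q'" using 4 by (cases p; cases q) auto
    obtain W where W: "\<And>t. (W has_real_derivative t ^ p' * (1 - t) ^ q') (at t)" "W 0 = 0"
      "W 1 = fact p' * fact q' / fact (p' + q' + 1)" using incomplete_beta[of p' q'] by blast
    \<comment> \<open>The functions \<open>t ^ (p + j) * (1 - t) ^ q\<close> vanish at both bounds
      and account for the degrees 1 to \<open>n\<close>; \<open>W\<close> fills the column of degree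
      0. Expanding along the first row leaves a matrix whose last row has the single nonzero entry
      \<open>W 1\<close>, a beta value.\<close>
    define Q :: "nat \<Rightarrow> real poly" where
      "Q k = (case k of 0 \<Rightarrow> 1 | Suc j \<Rightarrow> Polynomial.monom (p + j) j - Polynomial.monom (p + q + j) (Suc j))" for k
    define G where "G k = (case k of 0 \<Rightarrow> W | Suc j \<Rightarrow> (\<lambda>t. t ^ (p + j) * (1 - t) ^ q))" for k
    have cQ: "coeff (Q k) k = (case k of 0 \<Rightarrow> 1 | Suc j \<Rightarrow> - real (p + q + j))" for k
      by (cases k) (auto simp: Q_def)
    have dQ: "degree (Q k) \<le> k" for k
    proof (cases k)
      case (Suc j)
      then show ?thesis
        unfolding Q_def by simp (intro degree_diff_le order_trans[OF degree_monom_le], auto)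
    qed (simp add: Q_def)
    have G: "(G k has_real_derivative t ^ (p - 1) * (1 - t) ^ (q - 1) * poly (Q k) t) (at t)" for k t
    proof (cases k)
      case 0
      then show ?thesis using W(1) by (simp add: G_def Q_def p' q')
    next
      case (Suc j)
      then show ?thesis
        using has_real_derivative_powers[of p' j q' t] by (simp add: G_def Q_def p' q' poly_monom)
    qed
    have I: "integrable (cube (c ` {..<N})) F"
      "(\<integral>y. F y \<partial>cube (c ` {..<N})) = ndet (Suc N) (\<lambda>i k. if k = 0 then 1 else G (k - 1) (z i)) / (\<Prod>k<N. coeff (Q k) k)"
      unfolding F_def
      by (rule interlacing_integral[where z=z and q=Q and G=G and w="\<lambda>t. t ^ (p - 1) * (1 - t) ^ (q - 1)", OF c z dQ _ w G]; use 4 in \<open>simp add: cQ split: nat.split\<close>)+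
    have "ndet (Suc N) (\<lambda>i k. if k = 0 then 1 else G (k - 1) (z i)) = ndet (Suc n) (\<lambda>i k. G k (z (Suc i)))"
      unfolding N
      by (subst ndet_first_row) (use 4 W(2) in \<open>auto simp: z_def interlacing_points_def G_def split: nat.split\<close>)
    also have "\<dots> = (-1) ^ n * W 1 * ndet n (\<lambda>i k. G (Suc k) (z (Suc i)))"
      by (subst ndet_last_row) (use 4 in \<open>auto simp: z_def interlacing_points_def G_def split: nat.split\<close>)
    also have "ndet n (\<lambda>i k. G (Suc k) (z (Suc i))) = ndet n (\<lambda>i k. x i ^ (p + k) * (1 - x i) ^ q)"
      by (rule ndet_cong) (use 4 in \<open>auto simp: z_def interlacing_points_def G_def\<close>)
    finally have "ndet (Suc N) (\<lambda>i k. if k = 0 then 1 else G (k - 1) (z i))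
      = (-1) ^ n * W 1 * ((\<Prod>i<n. x i ^ p * (1 - x i) ^ q) * vandermonde n x)" unfolding ndet_shifted_powers .
    moreover have "(\<Prod>k<N. coeff (Q k) k) = (-1) ^ n * (\<Prod>k<n. real (p + q + k))"
    proof -
      have "(\<Prod>k<N. coeff (Q k) k) = (\<Prod>k<n. - real (p + q + k))"
        unfolding cQ N by (subst prod.lessThan_Suc_shift) simp
      then show ?thesis by (simp only: prod_uminus card_lessThan)
    qed
    moreover have "W 1 = fact (p - 1) * fact (q - 1) / fact (p + q - 1)"
      by (simp add: W(3) p' q')
    moreover have "fact (n + p + q - 1) = (\<Prod>k<n. real (p + q + k)) * (fact (p + q - 1) :: real)"
      using prod_add_fact[of "p + q" n] 4 by (simp add: add.assoc)
    ultimately show ?thesis using I by (simp add: mult_ac)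
  qed
qed

section \<open>The volume of a page\<close>

definition stair :: "nat \<Rightarrow> nat \<Rightarrow> nat \<Rightarrow> (nat \<times> nat) set" where
  "stair n p q = {(a,b). in_stair n p q a b}"

definition stair_diag :: "nat \<Rightarrow> nat \<Rightarrow> (nat \<times> nat) set" where
  "stair_diag n p = {(a,b). is_diag n p a b}"

text \<open>Only neighbouring cells are related; \<open>e\<close> names the cell at a position, so
  that the pages of a book can share their diagonal cells.\<close>

definition stair_rel :: "(nat \<Rightarrow> nat \<Rightarrow> 'c) \<Rightarrow> nat \<Rightarrow> nat \<Rightarrow> nat \<Rightarrow> ('c \<times> 'c) set" where
  "stair_rel e n p q =
    {(e a b, e a (Suc b)) |a b. in_stair n p q a b \<and> in_stair n p q a (Suc b)} \<union>
    {(e a b, e (Suc a) b) |a b. in_stair n p q a b \<and> in_stair n p q (Suc a) b}"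

lemma Ball_stair_rel:
  "(\<forall>(c,d)\<in>stair_rel e n p q. P c d) \<longleftrightarrow>
    (\<forall>a b. in_stair n p q a b \<and> in_stair n p q a (Suc b) \<longrightarrow> P (e a b) (e a (Suc b))) \<and>
    (\<forall>a b. in_stair n p q a b \<and> in_stair n p q (Suc a) b \<longrightarrow> P (e a b) (e (Suc a) b))"
  unfolding stair_rel_def by blast

lemma finite_stair: "finite (stair n p q)"
  by (rule finite_subset[of _ "{0..p + n} \<times> {0..n + q}"]) (auto simp: stair_def in_stair_def)

lemma stair_diag_subset: "stair_diag n p \<subseteq> stair n p q"
  by (auto simp: stair_diag_def stair_def is_diag_def in_stair_def)

lemma stair_rel_subset: "stair_rel e n p q \<subseteq> case_prod e ` stair n p q \<times> case_prod e ` stair n p q"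
  by (auto simp: stair_rel_def stair_def intro: rev_image_eqI)

lemma stair_diag_eq: "stair_diag n p = (\<lambda>i. (Suc i + p, Suc i)) ` {..<n}"
proof
  show "stair_diag n p \<subseteq> (\<lambda>i. (Suc i + p, Suc i)) ` {..<n}"
  proof
    fix x assume "x \<in> stair_diag n p"
    then show "x \<in> (\<lambda>i. (Suc i + p, Suc i)) ` {..<n}"
      by (intro image_eqI[of _ _ "snd x - 1"]) (auto simp: stair_diag_def is_diag_def)
  qed
qed (auto simp: stair_diag_def is_diag_def)

text \<open>Removing the diagonal of a staircase leaves a staircase again; if \<open>p = 0\<close>, its first column
  becomes empty and is dropped.\<close>

definition col_shift :: "nat \<Rightarrow> nat" where
  "col_shift p = (if p = 0 then 1 else 0)"

lemma in_stair_next: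
  "in_stair (next_diag_length n p q) (p - 1) (q - 1) a b \<longleftrightarrow>
    in_stair n p q a (b + col_shift p) \<and> \<not> is_diag n p a (b + col_shift p)"
  unfolding in_stair_def is_diag_def next_diag_length_def col_shift_def
  by (cases "p = 0"; cases "q = 0") auto

lemma off_diag_eq:
  "stair n p q - stair_diag n p
    = (\<lambda>(a,b). (a, b + col_shift p)) ` stair (next_diag_length n p q) (p - 1) (q - 1)"
proof -
  have "(a, b) \<in> stair n p q - stair_diag n p \<longleftrightarrow>
    (a, b) \<in> (\<lambda>(a,b). (a, b + col_shift p)) ` stair (next_diag_length n p q) (p - 1) (q - 1)" for a b
  proof
    assume *: "(a, b) \<in> stair n p q - stair_diag n p"
    define b' where "b' = b - col_shift p"
    have "b = b' + col_shift p"
      using * by (auto simp: b'_def stair_def in_stair_def col_shift_def)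
    with * have "(a, b') \<in> stair (next_diag_length n p q) (p - 1) (q - 1)"
      by (simp add: stair_def stair_diag_def in_stair_next del: One_nat_def)
    with \<open>b = b' + col_shift p\<close>
    show "(a, b) \<in> (\<lambda>(a,b). (a, b + col_shift p)) ` stair (next_diag_length n p q) (p - 1) (q - 1)"
      by (intro image_eqI[of _ _ "(a, b')"]) simp_all
  next
    assume "(a, b) \<in> (\<lambda>(a,b). (a, b + col_shift p)) ` stair (next_diag_length n p q) (p - 1) (q - 1)"
    then obtain b' where "b = b' + col_shift p" "in_stair (next_diag_length n p q) (p - 1) (q - 1) a b'"
      by (auto simp: stair_def)
    then show "(a, b) \<in> stair n p q - stair_diag n p"
      by (simp add: stair_def stair_diag_def in_stair_next del: One_nat_def)
  qed
  then show ?thesis by (intro equalityI subrelI) blast+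
qed

text \<open>A cell of the next diagonal has a diagonal cell, or else a bound, immediately to its
  left and immediately below it, and every neighbour relation that touches the diagonal is of this
  kind. The assumption on \<open>g\<close> makes the bounds 0 and 1 hold strictly.\<close>

lemma Ball_stair_rel_step:
  fixes g :: "'c \<Rightarrow> real"
  assumes g: "\<And>a b. in_stair n p q a b \<Longrightarrow> 0 < g (e a b) \<and> g (e a b) < 1"
  defines "N \<equiv> next_diag_length n p q" and "e' \<equiv> \<lambda>a b. e a (b + col_shift p)"
    and "z \<equiv> interlacing_points n p (\<lambda>i. g (e (Suc i + p) (Suc i)))"
  shows "(\<forall>(c,d)\<in>stair_rel e n p q. g c < g d) \<longleftrightarrow>
    (\<forall>(c,d)\<in>stair_rel e' N (p - 1) (q - 1). g c < g d) \<and>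
    (\<forall>i<N. z i < g (e' (Suc i + (p - 1)) (Suc i)) \<and> g (e' (Suc i + (p - 1)) (Suc i)) < z (Suc i))"
    (is "?L \<longleftrightarrow> ?R1 \<and> ?R2")
proof
  assume L: ?L
  have h: "g (e a b) < g (e a (Suc b))" if "in_stair n p q a b" "in_stair n p q a (Suc b)" for a b
    using L that unfolding Ball_stair_rel by blast
  have v: "g (e a b) < g (e (Suc a) b)" if "in_stair n p q a b" "in_stair n p q (Suc a) b" for a b
    using L that unfolding Ball_stair_rel by blast
  have ?R1
    unfolding Ball_stair_rel N_def in_stair_next e'_def using h v by auto
  moreover have ?R2
  proof (intro allI impI)
    fix i assume i: "i < N"
    show "z i < g (e' (Suc i + (p - 1)) (Suc i)) \<and> g (e' (Suc i + (p - 1)) (Suc i)) < z (Suc i)"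
    proof (cases "p = 0")
      \<comment> \<open>With \<open>p = 0\<close> the next diagonal starts to the right of the first
        diagonal cell, so its cell \<open>i\<close> lies between the diagonal entries
        \<open>i\<close> and \<open>i + 1\<close>; with \<open>0 < p\<close> it starts above that
        cell, and the indices are \<open>i - 1\<close> and \<open>i\<close>.\<close>
      case True
      have i': "in_stair n p q (Suc i) (Suc (Suc i))" "in_stair n p q (Suc i) (Suc i)" "i < n"
        using i True by (auto simp: N_def next_diag_length_def in_stair_def split: if_splits)
      have "g (e (Suc i) (Suc (Suc i))) < g (e (Suc (Suc i)) (Suc (Suc i)))" if "Suc i < n"
        by (rule v) (use that True in \<open>auto simp: in_stair_def\<close>)
      then show ?thesis
        using h[OF i'(2,1)] g[OF i'(1)] True i'(3)
        by (auto simp: z_def interlacing_points_def e'_def col_shift_def)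
    next
      case False
      then obtain p' where p': "p = Suc p'" by (cases p) auto
      have i': "in_stair n p q (i + p) (Suc i)"
        using i False by (auto simp: N_def next_diag_length_def in_stair_def split: if_splits)
      have 1: "g (e (i + p) (Suc i)) < g (e (Suc (i + p)) (Suc i))" if "i < n"
        by (rule v) (use that False in \<open>auto simp: in_stair_def\<close>)
      have 2: "g (e (i + p) i) < g (e (i + p) (Suc i))" if "0 < i" "i \<le> n"
        by (rule h) (use that False i' in \<open>auto simp: in_stair_def\<close>)
      have 3: "i \<le> n" using i False by (auto simp: N_def next_diag_length_def split: if_splits)
      show ?thesis
        using 1 2 3 g[OF i'] p'
        by (cases "i = 0") (auto simp: z_def interlacing_points_def e'_def col_shift_def)
    qed
  qed
  ultimately show "?R1 \<and> ?R2" ..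
next
  assume R: "?R1 \<and> ?R2"
  have h: "g (e a (b + col_shift p)) < g (e a (Suc (b + col_shift p)))"
    if "in_stair N (p - 1) (q - 1) a b" "in_stair N (p - 1) (q - 1) a (Suc b)" for a b
    using conjunct1[OF R] that unfolding Ball_stair_rel e'_def by auto
  have v: "g (e a (b + col_shift p)) < g (e (Suc a) (b + col_shift p))"
    if "in_stair N (p - 1) (q - 1) a b" "in_stair N (p - 1) (q - 1) (Suc a) b" for a b
    using conjunct1[OF R] that unfolding Ball_stair_rel e'_def by auto
  have s: "z i < g (e' (Suc i + (p - 1)) (Suc i))" "g (e' (Suc i + (p - 1)) (Suc i)) < z (Suc i)"
    if "i < N" for i
    using R that by auto
  \<comment> \<open>A step to the right may start on the diagonal but never ends there; a step down
    may end there but never starts there. So one case distinction suffices in each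
    direction.\<close>
  have h': "g (e a b) < g (e a (Suc b))" if ab: "in_stair n p q a b" "in_stair n p q a (Suc b)" for a b
  proof (cases "is_diag n p a b")
    case False
    define b' where "b' = b - col_shift p"
    have b: "b = b' + col_shift p" using ab by (auto simp: b'_def in_stair_def col_shift_def)
    have "\<not> is_diag n p a (Suc b)" using ab by (auto simp: is_diag_def in_stair_def)
    then show ?thesis
      using h[of a b'] ab False unfolding N_def in_stair_next b by simp
  next
    case True
    then obtain i where i: "b = Suc i" "a = Suc i + p" "i < n"
      by (cases b) (auto simp: is_diag_def)
    show ?thesis
    proof (cases "p = 0")
      case p: True
      have "i < N" using ab(2) i p by (auto simp: in_stair_def N_def next_diag_length_def)
      from s(1)[OF this] show ?thesis
        using p i by (auto simp: z_def interlacing_points_def e'_def col_shift_def)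
    next
      case p: False
      have "Suc i < N" using ab(2) i p by (auto simp: in_stair_def N_def next_diag_length_def)
      from s(1)[OF this] show ?thesis
        using p i by (auto simp: z_def interlacing_points_def e'_def col_shift_def)
    qed
  qed
  have v': "g (e a b) < g (e (Suc a) b)" if ab: "in_stair n p q a b" "in_stair n p q (Suc a) b" for a b
  proof (cases "is_diag n p (Suc a) b")
    case False
    define b' where "b' = b - col_shift p"
    have b: "b = b' + col_shift p" using ab by (auto simp: b'_def in_stair_def col_shift_def)
    have "\<not> is_diag n p a b" using ab by (auto simp: is_diag_def in_stair_def)
    then show ?thesis
      using v[of a b'] ab False unfolding N_def in_stair_next b by simp
  next
    case True
    then obtain i where i: "b = Suc i" "a = i + p" "i < n"
      by (cases b) (auto simp: is_diag_def)
    show ?thesis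
    proof (cases "p = 0")
      case p: True
      have i0: "0 < i" using ab(1) i p by (auto simp: in_stair_def)
      then have "i - 1 < N" using i p by (auto simp: N_def next_diag_length_def)
      from s(2)[OF this] show ?thesis
        using p i i0 by (auto simp: z_def interlacing_points_def e'_def col_shift_def)
    next
      case p: False
      have "i < N" using i p by (auto simp: in_stair_def N_def next_diag_length_def)
      from s(2)[OF this] show ?thesis
        using p i by (auto simp: z_def interlacing_points_def e'_def col_shift_def)
    qed
  qed
  show ?L unfolding Ball_stair_rel using h' v' by blast
qed

lemma chain_less:
  fixes y :: "nat \<Rightarrow> real"
  assumes "\<And>i. Suc i < n \<Longrightarrow> y i < y (Suc i)" "l < k" "k < n"
  shows "y l < y k"
  using assms(2,3)
proof (induction k)
  case (Suc k)
  then show ?case using assms(1)[of k] by (cases "l = k") force+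
qed simp

lemma vandermonde_nonneg:
  assumes "\<And>i. Suc i < n \<Longrightarrow> y i < y (Suc i)"
  shows "0 \<le> vandermonde n y"
proof -
  have "y l < y k" if "l < k" "k < n" for l k
    by (rule chain_less[where y=y, OF assms that])
  then show ?thesis unfolding vandermonde_def by (intro prod_nonneg) (auto simp: less_imp_le)
qed

lemma superfact_Suc: "superfact (Suc k) = superfact k * fact k"
  by (cases k) (simp_all add: superfact_def)

text \<open>At 0 the truncated difference gives 1 on both sides, so the constants of a page need no
  case distinction on \<open>p\<close> and \<open>q\<close>.\<close>

lemma superfact_pred: "superfact k = superfact (k - 1) * fact (k - 1)"
proof (cases k)
  case 0
  then show ?thesis by (simp add: superfact_def)
qed (simp add: superfact_Suc)

text \<open>The quotient of superfactorials solves the recursion in which each removed diagonal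
  contributes \<open>fact (p - 1) * fact (q - 1) / fact (n + p + q - 1)\<close>.\<close>

definition page_value :: "nat \<Rightarrow> nat \<Rightarrow> nat \<Rightarrow> (nat \<Rightarrow> real) \<Rightarrow> real" where
  "page_value n p q X = superfact p * superfact q / superfact (n + p + q) *
    ((\<Prod>i<n. X i ^ p * (1 - X i) ^ q) * vandermonde n X)"

lemma merge_in_space_cube:
  assumes "x \<in> space (cube I)" "y \<in> space (cube J)"
  shows "merge I J (x, y) \<in> space (cube (I \<union> J))"
  using assms by (auto simp: space_PiM PiE_iff merge_def extensional_def)

lemma measurable_merge_cube:
  assumes "x \<in> space (cube I)"
  shows "(\<lambda>y. merge I J (x, y)) \<in> measurable (cube J) (cube (I \<union> J))"
  using measurable_compose[OF measurable_Pair1'[OF assms] measurable_merge] by simp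

lemma measurable_indicator_All_less:
  assumes "finite C" "R \<subseteq> C \<times> C"
  shows "indicator {g. \<forall>(c,d)\<in>R. g c < g d} \<in> borel_measurable (cube C)"
proof -
  have "indicator {x \<in> space (cube C). \<forall>(c,d)\<in>R. x c < x d} \<in> borel_measurable (cube C)"
    by (intro borel_measurable_indicator sets_cube_All_less assms)
  then show ?thesis
    by (rule iffD1[OF measurable_cong, rotated]) (simp add: indicator_def)
qed

lemma interlacing_points_cong:
  assumes "\<And>i. i < n \<Longrightarrow> x i = x' i"
  shows "interlacing_points n p x i = interlacing_points n p x' i"
  using assms by (simp add: interlacing_points_def)

text \<open>Removing the diagonal lowers \<open>n + p + q\<close> by one in all cases. The induction
  hypothesis integrates out everything beyond the next diagonal, with that diagonal fixed;
  \<open>interlacing_volume\<close> then integrates over it.\<close>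

lemma page_volume:
  assumes "inj_on (case_prod e) (stair n p q)"
    and "x \<in> space (cube (case_prod e ` stair_diag n p))"
    and "\<And>i. Suc i < n \<Longrightarrow> x (e (Suc i + p) (Suc i)) < x (e (Suc (Suc i) + p) (Suc (Suc i)))"
  shows "(\<integral>\<^sup>+y. indicator {g. \<forall>(c,d)\<in>stair_rel e n p q. g c < g d}
      (merge (case_prod e ` stair_diag n p) (case_prod e ` (stair n p q - stair_diag n p)) (x, y))
      \<partial>cube (case_prod e ` (stair n p q - stair_diag n p)))
    = ennreal (page_value n p q (\<lambda>i. x (e (Suc i + p) (Suc i))))"
  using assms
proof (induction k \<equiv> "n + p + q" arbitrary: n p q e x)
  case 0
  then have [simp]: "n = 0" "p = 0" "q = 0" by auto
  have [simp]: "stair 0 0 0 = {}" by (auto simp: stair_def in_stair_def)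
  have [simp]: "stair_rel e 0 0 0 = {}" by (auto simp: stair_rel_def in_stair_def)
  interpret prob_space "cube {} :: ('a \<Rightarrow> real) measure" by (rule prob_space_cube)
  show ?case
    using emeasure_space_1 by (simp add: page_value_def vandermonde_def superfact_def)
next
  case (Suc k)
  define N p' q' where "N = next_diag_length n p q" and "p' = p - 1" and "q' = q - 1"
  define e' where "e' = (\<lambda>a b. e a (b + col_shift p))"
  define D Off where "D = case_prod e ` stair_diag n p"
    and "Off = case_prod e ` (stair n p q - stair_diag n p)"
  define D' Off' where "D' = case_prod e' ` stair_diag N p'"
    and "Off' = case_prod e' ` (stair N p' q' - stair_diag N p')"
  define X where "X i = x (e (Suc i + p) (Suc i))" for i
  define c where "c i = e' (Suc i + p') (Suc i)" for i
  define z where "z = interlacing_points n p X"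
  define R R' where "R = stair_rel e n p q" and "R' = stair_rel e' N p' q'"
  have pos: "0 < n + p + q" using Suc.hyps(2) by linarith
  have k: "k = N + p' + q'"
    using Suc.hyps(2) by (auto simp: N_def p'_def q'_def next_diag_length_def)
  have inj: "inj_on (case_prod e) (stair n p q)" by fact
  have shift: "case_prod e \<circ> (\<lambda>(a,b). (a, b + col_shift p)) = case_prod e'"
    by (auto simp: e'_def fun_eq_iff)
  have off: "stair n p q - stair_diag n p = (\<lambda>(a,b). (a, b + col_shift p)) ` stair N p' q'"
    unfolding N_def p'_def q'_def by (rule off_diag_eq)
  have Off: "Off = case_prod e' ` stair N p' q'"
    unfolding Off_def off image_comp shift ..
  have inj': "inj_on (case_prod e') (stair N p' q')"
    unfolding shift[symmetric]
  proof (rule comp_inj_on)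
    show "inj_on (\<lambda>(a,b). (a, b + col_shift p)) (stair N p' q')" by (auto simp: inj_on_def)
    show "inj_on (case_prod e) ((\<lambda>(a,b). (a, b + col_shift p)) ` stair N p' q')"
      unfolding off[symmetric] by (rule inj_on_subset[OF inj]) auto
  qed
  have sub': "stair_diag N p' \<subseteq> stair N p' q'" by (rule stair_diag_subset)
  have un': "D' \<union> Off' = Off"
    unfolding D'_def Off'_def Off using sub' by blast
  have dj': "D' \<inter> Off' = {}"
    unfolding D'_def Off'_def
    by (subst inj_on_image_Int[OF inj', symmetric]) (use sub' in auto)
  have un: "D \<union> Off = case_prod e ` stair n p q"
    unfolding D_def Off_def using stair_diag_subset[of n p q] by blast
  have dj: "D \<inter> Off = {}"
    unfolding D_def Off_def
    by (subst inj_on_image_Int[OF inj, symmetric]) (use stair_diag_subset[of n p q] in auto)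
  have fin: "finite D" "finite Off" "finite D'" "finite Off'"
    unfolding D_def Off_def D'_def Off'_def
    using finite_stair finite_subset[OF stair_diag_subset finite_stair] by auto
  have D'_eq: "D' = c ` {..<N}"
    unfolding D'_def stair_diag_eq image_image c_def by simp
  have c_inj: "inj_on c {..<N}"
  proof (rule inj_onI)
    fix i j assume ij: "i \<in> {..<N}" "j \<in> {..<N}" "c i = c j"
    have "(Suc i + p', Suc i) \<in> stair N p' q'" "(Suc j + p', Suc j) \<in> stair N p' q'"
      using ij(1,2) sub' unfolding stair_diag_eq by auto
    then have "(Suc i + p', Suc i) = (Suc j + p', Suc j)"
      by (rule inj_onD[OF inj', rotated]) (use ij(3) in \<open>simp add: c_def\<close>)
    then show "i = j" by simp
  qed
  have X_D: "e (Suc i + p) (Suc i) \<in> D" if "i < n" for i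
    using that unfolding D_def stair_diag_eq by force
  have x_sp: "x \<in> space (cube D)" using Suc.prems(2) by (simp add: D_def)
  have X01: "0 < X i \<and> X i < 1" if "i < n" for i
    using space_cubeD[OF x_sp X_D[OF that]] by (simp add: X_def)
  have Xinc: "X i < X (Suc i)" if "Suc i < n" for i
    using Suc.prems(3)[OF that] by (simp add: X_def)
  have R'_sub: "R' \<subseteq> Off \<times> Off" unfolding R'_def Off by (rule stair_rel_subset)
  have R_sub: "R \<subseteq> (D \<union> Off) \<times> (D \<union> Off)" unfolding R_def un by (rule stair_rel_subset)
  define slab where "slab y = (\<Prod>i<N. indicator {z i<..<z (Suc i)} (y (c i)) :: real)" for y :: "'a \<Rightarrow> real"
  have slab_iff: "slab y = (if \<forall>i<N. z i < y (c i) \<and> y (c i) < z (Suc i) then 1 else 0)" for y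
  proof (cases "\<forall>i<N. z i < y (c i) \<and> y (c i) < z (Suc i)")
    case False
    then have "\<exists>i<N. indicator {z i<..<z (Suc i)} (y (c i)) = (0::real)" by auto
    then have "slab y = 0" unfolding slab_def by auto
    then show ?thesis using False by auto
  qed (simp add: slab_def)
  define f where "f y = (indicator {g. \<forall>(c,d)\<in>R. g c < g d} (merge D Off (x, y)) :: ennreal)" for y
  have f_meas: "f \<in> borel_measurable (cube Off)"
    unfolding f_def
    by (rule measurable_compose[OF measurable_merge_cube[OF x_sp] measurable_indicator_All_less])
      (use fin R_sub in auto)
  \<comment> \<open>The order relations split into the interlacing, which involves only
    \<open>x\<close> and \<open>y\<close>, and the relations of the smaller staircase.\<close>
  have f_eq: "f (merge D' Off' (y, u))
      = ennreal (slab y) * indicator {g. \<forall>(c,d)\<in>R'. g c < g d} (merge D' Off' (y, u))"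
    if y: "y \<in> space (cube D')" and u: "u \<in> space (cube Off')" for y u
  proof -
    let ?h = "merge D' Off' (y, u)"
    let ?g = "merge D Off (x, ?h)"
    have h_sp: "?h \<in> space (cube Off)"
      using merge_in_space_cube[OF y u] by (simp add: un')
    have g_sp: "?g \<in> space (cube (D \<union> Off))"
      by (rule merge_in_space_cube[OF x_sp h_sp])
    have g01: "0 < ?g (e a b) \<and> ?g (e a b) < 1" if "in_stair n p q a b" for a b
    proof -
      have "e a b \<in> D \<union> Off" unfolding un using that by (force simp: stair_def)
      then show ?thesis using space_cubeD[OF g_sp] by blast
    qed
    have gX: "?g (e (Suc i + p) (Suc i)) = X i" if "i < n" for i
      using X_D[OF that] by (simp add: X_def merge_def)
    have gO: "?g a = ?h a" if "a \<in> Off" for a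
      using that dj by (auto simp: merge_def)
    have c_D': "c i \<in> D'" if "i < N" for i using that by (simp add: D'_eq)
    have gc: "?g (c i) = y (c i)" if "i < N" for i
      using gO[of "c i"] c_D'[OF that] un' by (auto simp: merge_def)
    have "(\<forall>(c,d)\<in>R. ?g c < ?g d) \<longleftrightarrow>
      (\<forall>(c,d)\<in>R'. ?g c < ?g d) \<and>
      (\<forall>i<N. interlacing_points n p (\<lambda>i. ?g (e (Suc i + p) (Suc i))) i < ?g (c i)
        \<and> ?g (c i) < interlacing_points n p (\<lambda>i. ?g (e (Suc i + p) (Suc i))) (Suc i))"
      unfolding R_def R'_def N_def p'_def q'_def c_def e'_def
      by (rule Ball_stair_rel_step[of n p q ?g e]) (rule g01)
    also have "(\<forall>(c,d)\<in>R'. ?g c < ?g d) \<longleftrightarrow> (\<forall>(c,d)\<in>R'. ?h c < ?h d)"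
      by (rule ball_cong[OF refl]) (use R'_sub gO in auto)
    also have "interlacing_points n p (\<lambda>i. ?g (e (Suc i + p) (Suc i))) = z"
      unfolding z_def by (rule ext, rule interlacing_points_cong, rule gX)
    finally have "(\<forall>(c,d)\<in>R. ?g c < ?g d) \<longleftrightarrow> (\<forall>(c,d)\<in>R'. ?h c < ?h d) \<and>
      (\<forall>i<N. z i < y (c i) \<and> y (c i) < z (Suc i))" using gc by auto
    then show ?thesis unfolding f_def slab_iff by (simp add: indicator_def)
  qed
  \<comment> \<open>Interlacing puts \<open>z (Suc i)\<close> between the two entries, so the new
    diagonal increases, as the induction hypothesis demands.\<close>
  have y_inc: "y (c i) < y (c (Suc i))" if "slab y \<noteq> 0" "Suc i < N" for y i
    using that unfolding slab_iff by (metis Suc_lessD order_less_trans)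
  define K :: real where "K = superfact p' * superfact q' / superfact (N + p' + q')"
  define F where "F y = slab y * ((\<Prod>i<N. y (c i) ^ p' * (1 - y (c i)) ^ q') * vandermonde N (y \<circ> c))"
    for y :: "'a \<Rightarrow> real"
  have inner: "(\<integral>\<^sup>+u. f (merge D' Off' (y, u)) \<partial>cube Off') = ennreal (K * F y)"
    if y: "y \<in> space (cube D')" for y
  proof -
    have "(\<integral>\<^sup>+u. f (merge D' Off' (y, u)) \<partial>cube Off')
        = (\<integral>\<^sup>+u. ennreal (slab y) * indicator {g. \<forall>(c,d)\<in>R'. g c < g d} (merge D' Off' (y, u)) \<partial>cube Off')"
      by (rule nn_integral_cong) (rule f_eq[OF y])
    also have "\<dots> = ennreal (slab y) *
        (\<integral>\<^sup>+u. indicator {g. \<forall>(c,d)\<in>R'. g c < g d} (merge D' Off' (y, u)) \<partial>cube Off')"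
    proof (rule nn_integral_cmult)
      show "(\<lambda>u. indicator {g. \<forall>(c,d)\<in>R'. g c < g d} (merge D' Off' (y, u))) \<in> borel_measurable (cube Off')"
        by (rule measurable_compose[OF measurable_merge_cube[OF y] measurable_indicator_All_less])
          (use fin R'_sub un' in auto)
    qed
    also have "\<dots> = ennreal (K * F y)"
    proof (cases "slab y = 0")
      case False
      have "(\<integral>\<^sup>+u. indicator {g. \<forall>(c,d)\<in>R'. g c < g d} (merge D' Off' (y, u)) \<partial>cube Off')
          = ennreal (page_value N p' q' (\<lambda>i. y (c i)))"
        unfolding R'_def D'_def Off'_def c_def
        by (rule Suc.hyps(1)[OF k inj'])
          (use y y_inc[OF False] in \<open>simp_all add: D'_def c_def\<close>)
      moreover have "slab y = 1" using False unfolding slab_iff by (simp split: if_splits)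
      ultimately show ?thesis
        by (simp add: F_def K_def page_value_def comp_def)
    qed (simp add: F_def)
    finally show ?thesis .
  qed
  have F_nonneg: "0 \<le> K * F y" if y: "y \<in> space (cube D')" for y
  proof (cases "slab y = 0")
    case False
    have "0 \<le> vandermonde N (y \<circ> c)"
      by (rule vandermonde_nonneg) (use y_inc[OF False] in simp)
    moreover have "0 \<le> (\<Prod>i<N. y (c i) ^ p' * (1 - y (c i)) ^ q')"
      by (intro prod_nonneg) (use space_cubeD[OF y] in \<open>auto simp: D'_eq less_imp_le\<close>)
    moreover have "0 \<le> slab y" unfolding slab_iff by simp
    ultimately show ?thesis by (simp add: F_def K_def)
  qed (simp add: F_def)
  have vol: "integrable (cube D') F"
    "(\<integral>y. F y \<partial>cube D') = fact p' * fact q' / fact (n + p + q - 1) *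
      ((\<Prod>i<n. X i ^ p * (1 - X i) ^ q) * vandermonde n X)"
    using interlacing_volume[where x=X and c=c, OF pos X01 Xinc] c_inj
    unfolding F_def[abs_def] slab_def z_def D'_eq p'_def q'_def N_def by blast+
  have const: "K * (fact p' * fact q' / fact (n + p + q - 1))
      = superfact p * superfact q / superfact (n + p + q)"
  proof -
    \<comment> \<open>Peeling the last factor off each of the three superfactorials on the right
      produces exactly the factorials of one layer.\<close>
    have "N + p' + q' = n + p + q - 1" using k Suc.hyps(2) by simp
    then show ?thesis
      unfolding K_def p'_def q'_def
      by (subst (6) superfact_pred, subst (3) superfact_pred, subst (4) superfact_pred) simp
  qed
  have "(\<integral>\<^sup>+y. f y \<partial>cube Off) = (\<integral>\<^sup>+y. (\<integral>\<^sup>+u. f (merge D' Off' (y, u)) \<partial>cube Off') \<partial>cube D')"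
    unfolding un'[symmetric]
    by (rule cube_nn_integral_fold[OF dj' fin(3,4)]) (use f_meas in \<open>simp add: un'\<close>)
  also have "\<dots> = (\<integral>\<^sup>+y. ennreal (K * F y) \<partial>cube D')"
    by (rule nn_integral_cong) (rule inner)
  also have "\<dots> = ennreal (\<integral>y. K * F y \<partial>cube D')"
    by (rule nn_integral_eq_integral) (use vol(1) F_nonneg in \<open>auto intro!: AE_I2\<close>)
  also have "(\<integral>y. K * F y \<partial>cube D') = page_value n p q X"
    unfolding page_value_def by (simp only: integral_mult_right_zero vol(2) const flip: mult.assoc)
  finally show ?case unfolding f_def D_def Off_def R_def X_def .
qed

section \<open>The volume of a book\<close>

text \<open>Tonelli over disjoint blocks of coordinates: once the diagonal is fixed, the remaining
  cells of different pages are independent.\<close>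

lemma nn_integral_cube_UN_prod:
  fixes A :: "nat \<Rightarrow> 'c set" and \<phi> :: "nat \<Rightarrow> ('c \<Rightarrow> real) \<Rightarrow> ennreal"
  assumes "\<And>i. i < m \<Longrightarrow> finite (A i)" "\<And>i j. i < m \<Longrightarrow> j < m \<Longrightarrow> i \<noteq> j \<Longrightarrow> A i \<inter> A j = {}"
    and "\<And>i. i < m \<Longrightarrow> \<phi> i \<in> borel_measurable (cube (A i))"
  shows "(\<integral>\<^sup>+y. (\<Prod>i<m. \<phi> i (restrict y (A i))) \<partial>cube (\<Union>i<m. A i)) = (\<Prod>i<m. \<integral>\<^sup>+y. \<phi> i y \<partial>cube (A i))"
  using assms
proof (induction m)
  case 0
  interpret prob_space "cube {} :: ('c \<Rightarrow> real) measure" by (rule prob_space_cube)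
  show ?case using emeasure_space_1 by simp
next
  case (Suc m)
  let ?B = "\<Union>i<m. A i"
  have "A i \<inter> A m = {}" if "i < m" for i using Suc.prems(2)[of i m] that by simp
  then have B: "?B \<inter> A m = {}" by blast
  have fin: "finite ?B" "finite (A m)" using Suc.prems(1) by auto
  have meas: "(\<lambda>y. \<phi> i (restrict y (A i))) \<in> borel_measurable (cube J)" if "i < Suc m" "A i \<subseteq> J" for i J
    by (rule measurable_compose[OF measurable_restrict_subset[OF that(2)] Suc.prems(3)[OF that(1)]])
  have Un: "(\<Union>i<Suc m. A i) = ?B \<union> A m" by (auto simp: lessThan_Suc)
  have "(\<integral>\<^sup>+y. (\<Prod>i<Suc m. \<phi> i (restrict y (A i))) \<partial>cube (\<Union>i<Suc m. A i))
      = (\<integral>\<^sup>+y. (\<integral>\<^sup>+u. (\<Prod>i<Suc m. \<phi> i (restrict (merge ?B (A m) (y, u)) (A i))) \<partial>cube (A m)) \<partial>cube ?B)"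
    unfolding Un
    by (rule cube_nn_integral_fold[OF B fin])
      (intro borel_measurable_prod_ennreal meas, auto simp: less_Suc_eq)
  also have "\<dots> = (\<integral>\<^sup>+y. (\<Prod>i<m. \<phi> i (restrict y (A i))) * (\<integral>\<^sup>+u. \<phi> m u \<partial>cube (A m)) \<partial>cube ?B)"
  proof (rule nn_integral_cong)
    fix y :: "'c \<Rightarrow> real"
    have "(\<integral>\<^sup>+u. (\<Prod>i<Suc m. \<phi> i (restrict (merge ?B (A m) (y, u)) (A i))) \<partial>cube (A m))
        = (\<integral>\<^sup>+u. (\<Prod>i<m. \<phi> i (restrict y (A i))) * \<phi> m u \<partial>cube (A m))"
    proof (rule nn_integral_cong)
      fix u assume u: "u \<in> space (cube (A m))"
      have 1: "restrict (merge ?B (A m) (y, u)) (A i) = restrict y (A i)" if "i < m" for i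
        using that by (auto simp: restrict_def merge_def fun_eq_iff)
      have 2: "restrict (merge ?B (A m) (y, u)) (A m) = u"
      proof
        fix a
        show "restrict (merge ?B (A m) (y, u)) (A m) a = u a"
          using u B by (cases "a \<in> A m") (auto simp: merge_def space_PiM PiE_def extensional_def)
      qed
      show "(\<Prod>i<Suc m. \<phi> i (restrict (merge ?B (A m) (y, u)) (A i))) = (\<Prod>i<m. \<phi> i (restrict y (A i))) * \<phi> m u"
        by (simp add: 1 2)
    qed
    also have "\<dots> = (\<Prod>i<m. \<phi> i (restrict y (A i))) * (\<integral>\<^sup>+u. \<phi> m u \<partial>cube (A m))"
      by (rule nn_integral_cmult) (rule Suc.prems(3), simp)
    finally show "(\<integral>\<^sup>+u. (\<Prod>i<Suc m. \<phi> i (restrict (merge ?B (A m) (y, u)) (A i))) \<partial>cube (A m))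
        = (\<Prod>i<m. \<phi> i (restrict y (A i))) * (\<integral>\<^sup>+u. \<phi> m u \<partial>cube (A m))" .
  qed
  also have "\<dots> = (\<integral>\<^sup>+y. (\<Prod>i<m. \<phi> i (restrict y (A i))) \<partial>cube ?B) * (\<integral>\<^sup>+u. \<phi> m u \<partial>cube (A m))"
    by (rule nn_integral_multc) (intro borel_measurable_prod_ennreal meas, auto)
  also have "(\<integral>\<^sup>+y. (\<Prod>i<m. \<phi> i (restrict y (A i))) \<partial>cube ?B) = (\<Prod>i<m. \<integral>\<^sup>+y. \<phi> i y \<partial>cube (A i))"
    by (rule Suc.IH) (use Suc.prems in auto)
  finally show ?case by simp
qed

lemma abs_vandermonde_image:
  fixes c :: "nat \<Rightarrow> 'c"
  assumes "inj_on c {..<n}"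
  shows "abs_vandermonde (c ` {..<n}) x = (\<Prod>k<n. \<Prod>l<k. \<bar>x (c k) - x (c l)\<bar>)"
  using assms
proof (induction n)
  case (Suc n)
  have inj: "inj_on c {..<n}" using Suc.prems by (rule inj_on_subset) auto
  have "c n \<notin> c ` {..<n}" using Suc.prems by (force dest: inj_onD)
  then have "abs_vandermonde (c ` {..<Suc n}) x
      = (\<Prod>j\<in>c ` {..<n}. \<bar>x (c n) - x j\<bar>) * abs_vandermonde (c ` {..<n}) x"
    unfolding lessThan_Suc image_insert by (intro abs_vandermonde_insert) auto
  then show ?case using Suc.IH[OF inj] by (simp add: prod.reindex[OF inj] mult.commute)
qed simp

section \<open>The cells and the order relation of a book\<close>

lemma card_stair_off: "card (stair n p q - stair_diag n p) = n * p + n * q + (n choose 2) + p * q"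
proof -
  \<comment> \<open>Counted by columns: column \<open>b\<close> has
    \<open>min (p + n) (b + p)\<close> cells, and \<open>prod.swap\<close> puts the column index
    first.\<close>
  have "stair n p q = prod.swap ` (SIGMA b:{1..n + q}. {1..min (p + n) (b + p)})"
    by (auto simp: stair_def in_stair_def image_iff)
  then have "card (stair n p q) = (\<Sum>b\<in>{1..n + q}. min (p + n) (b + p))"
    by (simp add: card_image)
  also have "\<dots> = n * p + n * q + (n choose 2) + p * q + n"
  proof (induction q)
    case 0
    have "(\<Sum>b\<in>{1..n}. min (p + n) (b + p)) = (\<Sum>b\<in>{1..n}. b + p)"
      by (rule sum.cong) auto
    also have "\<dots> = n * p + (n choose 2) + n"
    proof (induction n)
      case (Suc n)
      have "Suc n choose 2 = (n choose 2) + n" by (simp add: numeral_2_eq_2)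
      then show ?case using Suc by simp
    qed simp
    finally show ?case by simp
  qed simp
  finally have "card (stair n p q) = n * p + n * q + (n choose 2) + p * q + n" .
  moreover have "card (stair_diag n p) = n"
    unfolding stair_diag_eq by (subst card_image) (auto simp: inj_on_def)
  ultimately show ?thesis
    using card_Diff_subset[OF finite_subset[OF stair_diag_subset finite_stair] stair_diag_subset]
    by (metis add_diff_cancel_right')
qed

text \<open>The identification of the diagonals: every page sends its diagonal cell in column
  \<open>b\<close> to the same \<open>Diag b\<close>.\<close>

definition book_cell :: "nat \<Rightarrow> nat list \<Rightarrow> nat \<Rightarrow> nat \<Rightarrow> nat \<Rightarrow> cell" where
  "book_cell n r i a b = (if is_diag n (r ! i) a b then Diag b else Off i a b)"

lemma entry_eq: "entry f n r i a b = f (book_cell n r i a b)"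
  by (simp add: entry_def book_cell_def)

definition book_rel :: "nat \<Rightarrow> nat list \<Rightarrow> nat list \<Rightarrow> (cell \<times> cell) set" where
  "book_rel n r s = (\<Union>i<length r. stair_rel (book_cell n r i) n (r ! i) (s ! i))"

definition diag_cells :: "nat \<Rightarrow> cell set" where
  "diag_cells n = Diag ` {1..n}"

definition off_cells :: "nat \<Rightarrow> nat list \<Rightarrow> nat list \<Rightarrow> nat \<Rightarrow> cell set" where
  "off_cells n r s i = case_prod (Off i) ` (stair n (r ! i) (s ! i) - stair_diag n (r ! i))"

lemma inj_book_cell: "inj_on (case_prod (book_cell n r i)) (stair n (r ! i) (s ! i))"
  by (auto simp: inj_on_def book_cell_def is_diag_def split: if_splits)

lemma book_cell_diag: "case_prod (book_cell n r i) ` stair_diag n (r ! i) = diag_cells n"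
proof -
  have "case_prod (book_cell n r i) ` stair_diag n (r ! i) = (\<lambda>j. Diag (Suc j)) ` {..<n}"
    unfolding stair_diag_eq image_image by (rule image_cong) (auto simp: book_cell_def is_diag_def)
  also have "\<dots> = diag_cells n"
    unfolding diag_cells_def image_image[of Diag Suc, symmetric] image_Suc_lessThan ..
  finally show ?thesis .
qed

lemma book_cell_off:
  "case_prod (book_cell n r i) ` (stair n (r ! i) (s ! i) - stair_diag n (r ! i)) = off_cells n r s i"
  unfolding off_cells_def by (rule image_cong) (auto simp: book_cell_def stair_diag_def)

lemma book_cell_image:
  "case_prod (book_cell n r i) ` stair n (r ! i) (s ! i) = diag_cells n \<union> off_cells n r s i"
proof -
  have "stair n (r ! i) (s ! i) = stair_diag n (r ! i) \<union> (stair n (r ! i) (s ! i) - stair_diag n (r ! i))"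
    using stair_diag_subset by blast
  then show ?thesis
    using book_cell_diag[of n r i] book_cell_off[of n r i s] by (metis image_Un)
qed

lemma book_cells_eq: "book_cells n r s = diag_cells n \<union> (\<Union>i<length r. off_cells n r s i)"
  unfolding book_cells_def diag_cells_def off_cells_def stair_def stair_diag_def by force

lemma off_cells_disjoint:
  "i \<noteq> j \<Longrightarrow> off_cells n r s i \<inter> off_cells n r s j = {}" "diag_cells n \<inter> off_cells n r s i = {}"
  by (auto simp: off_cells_def diag_cells_def)

lemma finite_off_cells: "finite (off_cells n r s i)"
  unfolding off_cells_def using finite_stair by auto

lemma finite_diag_cells: "finite (diag_cells n)"
  by (simp add: diag_cells_def)

lemma finite_book_cells: "finite (book_cells n r s)"
  unfolding book_cells_eq using finite_off_cells finite_diag_cells by auto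

lemma card_diag_cells: "card (diag_cells n) = n"
  unfolding diag_cells_def by (subst card_image) (auto simp: inj_on_def)

lemma card_book_cells:
  assumes "length s = length r"
  shows "card (book_cells n r s) = book_size n r s"
proof -
  have off: "card (off_cells n r s i) = n * r ! i + n * s ! i + (n choose 2) + r ! i * s ! i" for i
    unfolding off_cells_def by (subst card_image) (auto simp: inj_on_def card_stair_off)
  have "card (book_cells n r s) = n + card (\<Union>i<length r. off_cells n r s i)"
    unfolding book_cells_eq
    by (subst card_Un_disjoint)
      (use off_cells_disjoint(2)[of n r s] in \<open>auto simp: finite_diag_cells finite_off_cells card_diag_cells\<close>)
  also have "card (\<Union>i<length r. off_cells n r s i) = (\<Sum>i<length r. card (off_cells n r s i))"
    by (rule card_UN_disjoint) (use off_cells_disjoint(1) in \<open>auto simp: finite_off_cells\<close>)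
  also have "\<dots> = n * sum_list r + n * sum_list s + length r * (n choose 2) + (\<Sum>i<length r. r ! i * s ! i)"
    by (simp add: off sum.distrib sum_distrib_left sum_list_sum_nth assms atLeast0LessThan)
  finally show ?thesis by (simp add: book_size_def algebra_simps)
qed

text \<open>Rows of a staircase are contiguous, so a chain of neighbours joins any two cells of a
  row.\<close>

lemma stair_row_mono:
  fixes g :: "'c \<Rightarrow> nat"
  assumes R: "\<forall>(c,d)\<in>stair_rel e n p q. g c < g d"
    and "in_stair n p q a b" "in_stair n p q a b'" "b < b'"
  shows "g (e a b) < g (e a b')"
  using assms(4,3)
proof (induction b')
  case (Suc b')
  have step: "g (e a b') < g (e a (Suc b'))" if "in_stair n p q a b'"
    using R Suc.prems(2) that unfolding Ball_stair_rel by blast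
  show ?case
  proof (cases "b = b'")
    case False
    then have "b < b'" using Suc.prems(1) by simp
    moreover from this have "in_stair n p q a b'"
      using assms(2) Suc.prems(2) by (auto simp: in_stair_def)
    ultimately show ?thesis using Suc.IH step by force
  qed (use step assms(2) in simp)
qed simp

lemma stair_column_mono:
  fixes g :: "'c \<Rightarrow> nat"
  assumes R: "\<forall>(c,d)\<in>stair_rel e n p q. g c < g d"
    and "in_stair n p q a b" "in_stair n p q a' b" "a < a'"
  shows "g (e a b) < g (e a' b)"
  using assms(4,3)
proof (induction a')
  case (Suc a')
  have step: "g (e a' b) < g (e (Suc a') b)" if "in_stair n p q a' b"
    using R Suc.prems(2) that unfolding Ball_stair_rel by blast
  show ?case
  proof (cases "a = a'")
    case False
    then have "a < a'" using Suc.prems(1) by simp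
    moreover from this have "in_stair n p q a' b"
      using assms(2) Suc.prems(2) by (auto simp: in_stair_def)
    ultimately show ?thesis using Suc.IH step by force
  qed (use step assms(2) in simp)
qed simp

lemma Ball_book_rel:
  "(\<forall>(c,d)\<in>book_rel n r s. P c d) \<longleftrightarrow> (\<forall>i<length r. \<forall>(c,d)\<in>stair_rel (book_cell n r i) n (r ! i) (s ! i). P c d)"
  unfolding book_rel_def by blast

text \<open>Neighbour relations generate monotonicity along rows and columns, and the Selberg
  inequalities are the comparisons with the diagonal cell of the row and of the column.\<close>

lemma YB_eq_linear_extensions:
  assumes "length s = length r"
  shows "YB n r s = {f \<in> labelings (book_cells n r s). \<forall>(c,d)\<in>book_rel n r s. f c < f d}"
proof (rule Set.set_eqI)
  fix f
  show "f \<in> YB n r s \<longleftrightarrow> f \<in> {f \<in> labelings (book_cells n r s). \<forall>(c,d)\<in>book_rel n r s. f c < f d}"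
  proof
    assume "f \<in> YB n r s"
    then have y: "young_book n r s f" by (simp add: YB_def)
    have "f \<in> labelings (book_cells n r s)"
      using y unfolding labelings_def young_book_def selberg_book_def card_book_cells[OF assms] by simp
    moreover have "\<forall>(c,d)\<in>stair_rel (book_cell n r i) n (r ! i) (s ! i). f c < f d" if "i < length r" for i
      using y that unfolding Ball_stair_rel young_book_def entry_eq by blast
    ultimately show "f \<in> {f \<in> labelings (book_cells n r s). \<forall>(c,d)\<in>book_rel n r s. f c < f d}"
      unfolding Ball_book_rel by blast
  next
    assume f: "f \<in> {f \<in> labelings (book_cells n r s). \<forall>(c,d)\<in>book_rel n r s. f c < f d}"
    have lab: "bij_betw f (book_cells n r s) {1..book_size n r s} \<and> (\<forall>x. x \<notin> book_cells n r s \<longrightarrow> f x = 0)"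
      using f unfolding labelings_def card_book_cells[OF assms] by simp
    have R: "\<forall>(c,d)\<in>stair_rel (book_cell n r i) n (r ! i) (s ! i). f c < f d" if "i < length r" for i
      using f that unfolding mem_Collect_eq Ball_book_rel by blast
    have row: "entry f n r i a b < entry f n r i a b'"
      if "i < length r" "in_stair n (r ! i) (s ! i) a b" "in_stair n (r ! i) (s ! i) a b'" "b < b'" for i a b b'
      unfolding entry_eq by (rule stair_row_mono[OF R[OF that(1)] that(2-4)])
    have col: "entry f n r i a b < entry f n r i a' b"
      if "i < length r" "in_stair n (r ! i) (s ! i) a b" "in_stair n (r ! i) (s ! i) a' b" "a < a'" for i a a' b
      unfolding entry_eq by (rule stair_column_mono[OF R[OF that(1)] that(2-4)])
    have "f (Diag (a - r ! i)) < f (Off i a b)"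
      if i: "i < length r" "in_stair n (r ! i) (s ! i) a b" "\<not> is_diag n (r ! i) a b" "r ! i < a" for i a b
    proof -
      have d: "is_diag n (r ! i) a (a - r ! i)"
        using i by (auto simp: is_diag_def in_stair_def)
      have "entry f n r i a (a - r ! i) < entry f n r i a b"
        by (rule row[OF i(1)]) (use i d in \<open>auto simp: is_diag_def in_stair_def\<close>)
      then show ?thesis using d i(3) by (simp add: entry_def)
    qed
    moreover have "f (Off i a b) < f (Diag b)"
      if i: "i < length r" "in_stair n (r ! i) (s ! i) a b" "\<not> is_diag n (r ! i) a b" "b \<le> n" for i a b
    proof -
      have d: "is_diag n (r ! i) (b + r ! i) b"
        using i by (auto simp: is_diag_def in_stair_def)
      have "entry f n r i a b < entry f n r i (b + r ! i) b"
        by (rule col[OF i(1)]) (use i d in \<open>auto simp: is_diag_def in_stair_def\<close>)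
      then show ?thesis using d i(3) by (simp add: entry_def)
    qed
    ultimately have "selberg_book n r s f" unfolding selberg_book_def using lab by blast
    then show "f \<in> YB n r s"
      unfolding YB_def young_book_def mem_Collect_eq using row col by blast
  qed
qed

lemma page_value_cong:
  assumes "\<And>i. i < n \<Longrightarrow> X i = Y i"
  shows "page_value n p q X = page_value n p q Y"
proof -
  have "vandermonde n X = vandermonde n Y"
    unfolding vandermonde_def using assms by (intro prod.cong) auto
  then show ?thesis unfolding page_value_def using assms by simp
qed

lemma indicator_All_eq_prod:
  fixes m :: nat
  shows "indicator {g. \<forall>i<m. P i g} x = (\<Prod>i<m. indicator {g. P i g} x :: ennreal)"
proof (induction m)
  case (Suc m)
  have "{g. \<forall>i<Suc m. P i g} = {g. \<forall>i<m. P i g} \<inter> {g. P m g}" by (auto simp: less_Suc_eq)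
  then show ?case using Suc by (simp add: indicator_inter_arith)
qed simp

section \<open>Increasing diagonals and the volume of a book\<close>

definition diag_label :: "nat \<Rightarrow> cell \<Rightarrow> nat" where
  "diag_label n c = (case c of Diag j \<Rightarrow> if j \<in> {1..n} then j else 0 | Off _ _ _ \<Rightarrow> 0)"

lemma diag_cells_eq: "diag_cells n = (\<lambda>j. Diag (Suc j)) ` {..<n}"
  unfolding diag_cells_def image_image[of Diag Suc, symmetric] image_Suc_lessThan ..

lemma diag_label_in_labelings: "diag_label n \<in> labelings (diag_cells n)"
proof -
  have "bij_betw (diag_label n) (diag_cells n) {1..n}"
    by (rule bij_betw_byWitness[where f'=Diag]) (auto simp: diag_cells_def diag_label_def)
  moreover have "diag_label n c = 0" if "c \<notin> diag_cells n" for c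
    using that by (cases c) (auto simp: diag_label_def diag_cells_def)
  ultimately show ?thesis unfolding labelings_def card_diag_cells by blast
qed

text \<open>Exhibits the chamber of increasing diagonals as an order cell, so that the symmetry
  argument for order cells applies to it.\<close>

lemma order_cell_diag_iff:
  assumes "x \<in> space (cube (diag_cells n))"
  shows "x \<in> order_cell (diag_cells n) (diag_label n) \<longleftrightarrow>
    (\<forall>j. Suc j < n \<longrightarrow> x (Diag (Suc j)) < x (Diag (Suc (Suc j))))"
proof
  assume x: "x \<in> order_cell (diag_cells n) (diag_label n)"
  show "\<forall>j. Suc j < n \<longrightarrow> x (Diag (Suc j)) < x (Diag (Suc (Suc j)))"
  proof (intro allI impI)
    fix j assume "Suc j < n"
    then have "Diag (Suc j) \<in> diag_cells n" "Diag (Suc (Suc j)) \<in> diag_cells n"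
      "diag_label n (Diag (Suc j)) < diag_label n (Diag (Suc (Suc j)))"
      by (auto simp: diag_cells_def diag_label_def)
    then show "x (Diag (Suc j)) < x (Diag (Suc (Suc j)))"
      using x unfolding order_cell_def by blast
  qed
next
  assume inc: "\<forall>j. Suc j < n \<longrightarrow> x (Diag (Suc j)) < x (Diag (Suc (Suc j)))"
  have lt: "x (Diag (Suc l)) < x (Diag (Suc k))" if "l < k" "k < n" for l k
    using chain_less[of n "\<lambda>j. x (Diag (Suc j))" l k] inc that by blast
  have "x c < x d" if cd: "c \<in> diag_cells n" "d \<in> diag_cells n" "diag_label n c < diag_label n d" for c d
  proof -
    from cd obtain l k where "c = Diag (Suc l)" "d = Diag (Suc k)" "l < n" "k < n"
      unfolding diag_cells_eq by auto
    then show ?thesis using cd(3) lt[of l k] by (simp add: diag_label_def)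
  qed
  then show "x \<in> order_cell (diag_cells n) (diag_label n)"
    using assms by (auto simp: order_cell_def)
qed

lemma ennreal_fact: "ennreal (fact n) = fact n"
  by (metis ennreal_of_nat_eq_real_of_nat of_nat_fact)

text \<open>The Selberg density with equal exponents is symmetric, so the chamber receives one of
  \<open>n!\<close> equal shares of the full Selberg integral.\<close>

lemma nn_integral_selberg_order_cell:
  assumes "0 < m"
  shows "(\<integral>\<^sup>+x. indicator (order_cell (diag_cells n) (diag_label n)) x
      * ennreal (selberg_density (\<lambda>_. a) b m (diag_cells n) x) \<partial>cube (diag_cells n))
    = ennreal (selberg_value m n a b / fact n)" (is "?I = _")
proof -
  let ?D = "diag_cells n"
  have nonneg: "0 \<le> selberg_density (\<lambda>_. a) b m ?D x" if "x \<in> space (cube ?D)" for x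
    by (rule selberg_density_bounds(1)[OF that])
  have "fact (card ?D) * ?I = (\<integral>\<^sup>+x. ennreal (selberg_density (\<lambda>_. a) b m ?D x) \<partial>cube ?D)"
  proof (rule nn_integral_order_cell_symmetric[OF finite_diag_cells _ _ diag_label_in_labelings])
    fix x p assume p: "p permutes ?D"
    show "ennreal (selberg_density (\<lambda>_. a) b m ?D (x \<circ> p)) = ennreal (selberg_density (\<lambda>_. a) b m ?D x)"
      using selberg_density_permute[OF p, of "\<lambda>_. a" b m x] by (simp add: comp_def)
  qed measurable
  also have "\<dots> = ennreal (\<integral>x. selberg_density (\<lambda>_. a) b m ?D x \<partial>cube ?D)"
    by (rule nn_integral_eq_integral[OF integrable_selberg_density AE_I2[OF nonneg]])
  also have "\<dots> = ennreal (selberg_value m n a b)"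
    using selberg_integral[OF finite_diag_cells assms, of n a b] by (simp add: card_diag_cells)
  finally have I: "ennreal (fact n) * ?I = ennreal (selberg_value m n a b)"
    by (simp add: card_diag_cells ennreal_fact)
  have one: "ennreal (1 / fact n) * ennreal (fact n) = 1"
    by (subst ennreal_mult[symmetric]) simp_all
  have "?I = ennreal (1 / fact n) * (ennreal (fact n) * ?I)"
    unfolding mult.assoc[symmetric] one by simp
  also have "\<dots> = ennreal (1 / fact n) * ennreal (selberg_value m n a b)" unfolding I ..
  also have "\<dots> = ennreal (selberg_value m n a b / fact n)"
    by (subst ennreal_mult'[symmetric]) simp_all
  finally show ?thesis .
qed

text \<open>Each page brings one Vandermonde product, which is positive on an increasing diagonal,
  so \<open>m\<close> pages give the \<open>m\<close>-th power of \<open>abs_vandermonde\<close>,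
  while the exponents of the pages add up.\<close>

lemma prod_page_value:
  fixes x :: "cell \<Rightarrow> real"
  assumes "\<And>j. Suc j < n \<Longrightarrow> x (Diag (Suc j)) < x (Diag (Suc (Suc j)))"
  shows "(\<Prod>i<m. page_value n (r i) (s i) (\<lambda>j. x (Diag (Suc j))))
    = (\<Prod>i<m. real (superfact (r i)) * superfact (s i) / superfact (n + r i + s i))
      * selberg_density (\<lambda>_. \<Sum>i<m. r i) (\<Sum>i<m. s i) m (diag_cells n) x"
proof -
  let ?X = "\<lambda>j. x (Diag (Suc j))"
  have inj: "inj_on (\<lambda>j. Diag (Suc j)) {..<n}" by (auto simp: inj_on_def)
  have lt: "?X l < ?X k" if "l < k" "k < n" for l k
    using chain_less[of n ?X l k] assms that by blast
  have V: "abs_vandermonde (diag_cells n) x = vandermonde n ?X"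
    unfolding diag_cells_eq abs_vandermonde_image[OF inj] vandermonde_def
    by (intro prod.cong refl abs_of_nonneg) (use lt in \<open>auto simp: less_imp_le\<close>)
  have "(\<Prod>i<m. \<Prod>j<n. ?X j ^ r i * (1 - ?X j) ^ s i)
      = (\<Prod>j<n. \<Prod>i<m. ?X j ^ r i * (1 - ?X j) ^ s i)" by (rule prod.swap)
  also have "\<dots> = (\<Prod>j<n. ?X j ^ (\<Sum>i<m. r i) * (1 - ?X j) ^ (\<Sum>i<m. s i))"
    by (simp add: prod.distrib power_sum)
  also have "\<dots> = (\<Prod>c\<in>diag_cells n. x c ^ (\<Sum>i<m. r i) * (1 - x c) ^ (\<Sum>i<m. s i))"
    unfolding diag_cells_eq by (subst prod.reindex[OF inj]) simp
  finally have W: "(\<Prod>i<m. \<Prod>j<n. ?X j ^ r i * (1 - ?X j) ^ s i)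
    = (\<Prod>c\<in>diag_cells n. x c ^ (\<Sum>i<m. r i) * (1 - x c) ^ (\<Sum>i<m. s i))" .
  show ?thesis
    unfolding page_value_def selberg_density_def V
    by (subst prod.distrib, subst (2) prod.distrib) (simp add: W)
qed

lemma book_rel_subset: "book_rel n r s \<subseteq> book_cells n r s \<times> book_cells n r s"
proof -
  have "stair_rel (book_cell n r i) n (r ! i) (s ! i) \<subseteq> book_cells n r s \<times> book_cells n r s"
    if "i < length r" for i
  proof -
    have "case_prod (book_cell n r i) ` stair n (r ! i) (s ! i) \<subseteq> book_cells n r s"
      unfolding book_cell_image book_cells_eq using that by blast
    then show ?thesis using stair_rel_subset by blast
  qed
  then show ?thesis unfolding book_rel_def by blast
qed

theorem book_volume:
  fixes n m :: nat and r s :: "nat list"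
  assumes "0 < m" "length r = m" "length s = m"
  defines "C \<equiv> book_cells n r s"
  shows "emeasure (cube C) {x \<in> space (cube C). \<forall>(c,d)\<in>book_rel n r s. x c < x d}
    = ennreal ((\<Prod>i<m. real (superfact (r ! i)) * superfact (s ! i) / superfact (n + r ! i + s ! i))
        * (selberg_value m n (sum_list r) (sum_list s) / fact n))"
proof -
  let ?D = "diag_cells n"
  define A where "A = off_cells n r s"
  define U where "U = (\<Union>i<m. A i)"
  define e where "e = book_cell n r"
  define R where "R i = stair_rel (e i) n (r ! i) (s ! i)" for i
  define K where "K = (\<Prod>i<m. real (superfact (r ! i)) * superfact (s ! i) / superfact (n + r ! i + s ! i))"
  let ?sd = "selberg_density (\<lambda>_. sum_list r) (sum_list s) m ?D"
  have sums: "sum_list r = (\<Sum>i<m. r ! i)" "sum_list s = (\<Sum>i<m. s ! i)"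
    using assms by (simp_all add: sum_list_sum_nth atLeast0LessThan)
  have C: "C = ?D \<union> U" unfolding C_def U_def A_def book_cells_eq using assms by simp
  have dj: "?D \<inter> U = {}" unfolding U_def A_def using off_cells_disjoint(2) by blast
  have finU: "finite U" unfolding U_def A_def using finite_off_cells by auto
  have imD: "case_prod (e i) ` stair_diag n (r ! i) = ?D" for i
    unfolding e_def by (rule book_cell_diag)
  have imA: "case_prod (e i) ` (stair n (r ! i) (s ! i) - stair_diag n (r ! i)) = A i" for i
    unfolding e_def A_def by (rule book_cell_off)
  have R_sub: "R i \<subseteq> (?D \<union> A i) \<times> (?D \<union> A i)" for i
    unfolding R_def e_def A_def book_cell_image[symmetric] by (rule stair_rel_subset)
  have book: "(\<forall>(c,d)\<in>book_rel n r s. g c < g d) \<longleftrightarrow> (\<forall>i<m. \<forall>(c,d)\<in>R i. g c < g d)" for g :: "cell \<Rightarrow> real"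
    unfolding Ball_book_rel R_def e_def assms(2) ..
  have R_C: "R i \<subseteq> C \<times> C" if "i < m" for i
    using R_sub[of i] that unfolding C U_def by blast
  have book_sub: "book_rel n r s \<subseteq> C \<times> C"
    unfolding C_def by (rule book_rel_subset)
  have finC: "finite C" unfolding C_def by (rule finite_book_cells)
  have set: "{x \<in> space (cube C). \<forall>(c,d)\<in>book_rel n r s. x c < x d} \<in> sets (cube C)"
    by (rule sets_cube_All_less[OF finC book_sub])
  define \<phi> where "\<phi> x i y = (indicator {g. \<forall>(c,d)\<in>R i. g c < g d} (merge ?D (A i) (x, y)) :: ennreal)"
    for x :: "cell \<Rightarrow> real" and i y
  have \<phi>_meas: "\<phi> x i \<in> borel_measurable (cube (A i))" if "x \<in> space (cube ?D)" for x i
    unfolding \<phi>_def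
    by (rule measurable_compose[OF measurable_merge_cube[OF that] measurable_indicator_All_less])
      (use R_sub in \<open>auto simp: finite_diag_cells finite_off_cells A_def\<close>)
  \<comment> \<open>Page \<open>i\<close> sees only the diagonal and its own cells, so its indicator
    may be evaluated on the restriction of \<open>y\<close> to \<open>A i\<close>.\<close>
  have \<phi>_eq: "indicator {g. \<forall>(c,d)\<in>R i. g c < g d} (merge ?D U (x, y)) = \<phi> x i (restrict y (A i))"
    if "i < m" for i x y
  proof -
    have "merge ?D U (x, y) c = merge ?D (A i) (x, restrict y (A i)) c" if "c \<in> ?D \<union> A i" for c
      using that \<open>i < m\<close> by (auto simp: merge_def U_def)
    then have "(\<forall>(c,d)\<in>R i. merge ?D U (x, y) c < merge ?D U (x, y) d) \<longleftrightarrow>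
      (\<forall>(c,d)\<in>R i. merge ?D (A i) (x, restrict y (A i)) c < merge ?D (A i) (x, restrict y (A i)) d)"
      using R_sub[of i] by (intro ball_cong) auto
    then show ?thesis unfolding \<phi>_def by (simp add: indicator_def)
  qed
  have ediag: "e i (Suc j + r ! i) (Suc j) = Diag (Suc j)" if "j < n" for i j
    using that by (simp add: e_def book_cell_def is_diag_def)
  have inner: "(\<integral>\<^sup>+y. (\<Prod>i<m. \<phi> x i (restrict y (A i))) \<partial>cube U)
      = indicator (order_cell ?D (diag_label n)) x * ennreal (K * ?sd x)"
    if x: "x \<in> space (cube ?D)" for x
  proof -
    have "(\<integral>\<^sup>+y. (\<Prod>i<m. \<phi> x i (restrict y (A i))) \<partial>cube U) = (\<Prod>i<m. \<integral>\<^sup>+y. \<phi> x i y \<partial>cube (A i))"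
      unfolding U_def
      by (rule nn_integral_cube_UN_prod)
        (use off_cells_disjoint(1) \<phi>_meas[OF x] finite_off_cells in \<open>simp_all add: A_def\<close>)
    also have "\<dots> = indicator (order_cell ?D (diag_label n)) x * ennreal (K * ?sd x)"
    proof (cases "x \<in> order_cell ?D (diag_label n)")
      case True
      then have inc: "x (Diag (Suc j)) < x (Diag (Suc (Suc j)))" if "Suc j < n" for j
        using that order_cell_diag_iff[OF x] by blast
      have pv: "(\<integral>\<^sup>+y. \<phi> x i y \<partial>cube (A i)) = ennreal (page_value n (r ! i) (s ! i) (\<lambda>j. x (Diag (Suc j))))" for i
      proof -
        have "(\<integral>\<^sup>+y. \<phi> x i y \<partial>cube (A i))
            = ennreal (page_value n (r ! i) (s ! i) (\<lambda>j. x (e i (Suc j + r ! i) (Suc j))))"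
          unfolding \<phi>_def R_def imD[of i, symmetric] imA[of i, symmetric]
        proof (rule page_volume)
          show "inj_on (case_prod (e i)) (stair n (r ! i) (s ! i))"
            unfolding e_def by (rule inj_book_cell)
          show "x \<in> space (cube (case_prod (e i) ` stair_diag n (r ! i)))"
            unfolding imD by (rule x)
          show "x (e i (Suc j + r ! i) (Suc j)) < x (e i (Suc (Suc j) + r ! i) (Suc (Suc j)))"
            if "Suc j < n" for j
            using inc[OF that] that ediag[of j i] ediag[of "Suc j" i] by simp
        qed
        also have "page_value n (r ! i) (s ! i) (\<lambda>j. x (e i (Suc j + r ! i) (Suc j)))
            = page_value n (r ! i) (s ! i) (\<lambda>j. x (Diag (Suc j)))"
          by (rule page_value_cong) (simp only: ediag)
        finally show ?thesis .
      qed
      have nonneg: "0 \<le> page_value n p q (\<lambda>j. x (Diag (Suc j)))" for p q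
      proof -
        have "0 \<le> vandermonde n (\<lambda>j. x (Diag (Suc j)))" by (rule vandermonde_nonneg) (rule inc)
        moreover have "0 \<le> (\<Prod>j<n. x (Diag (Suc j)) ^ p * (1 - x (Diag (Suc j))) ^ q)"
          by (intro prod_nonneg) (use space_cubeD[OF x] in \<open>auto simp: diag_cells_eq less_imp_le\<close>)
        ultimately show ?thesis by (simp add: page_value_def)
      qed
      have "(\<Prod>i<m. \<integral>\<^sup>+y. \<phi> x i y \<partial>cube (A i))
          = ennreal (\<Prod>i<m. page_value n (r ! i) (s ! i) (\<lambda>j. x (Diag (Suc j))))"
        unfolding pv by (rule prod_ennreal) (rule nonneg)
      also have "(\<Prod>i<m. page_value n (r ! i) (s ! i) (\<lambda>j. x (Diag (Suc j)))) = K * ?sd x"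
        unfolding K_def sums by (rule prod_page_value) (rule inc)
      finally show ?thesis using True by simp
    next
      \<comment> \<open>In page 0, which exists because \<open>0 < m\<close>, the cell to the right
        of one diagonal cell lies above the next diagonal cell. Page 0 therefore forces the diagonal
        to increase, and its factor is 0 otherwise.\<close>
      case False
      have "\<phi> x 0 y = 0" for y
      proof (rule ccontr)
        let ?g = "merge ?D (A 0) (x, y)"
        assume "\<phi> x 0 y \<noteq> 0"
        then have g: "\<forall>(c,d)\<in>R 0. ?g c < ?g d" by (auto simp: \<phi>_def indicator_def split: if_splits)
        have gD: "?g (Diag (Suc j)) = x (Diag (Suc j))" if "j < n" for j
          using that by (simp add: merge_def diag_cells_eq)
        have "x (Diag (Suc j)) < x (Diag (Suc (Suc j)))" if j: "Suc j < n" for j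
        proof -
          have st: "in_stair n (r ! 0) (s ! 0) (Suc j + r ! 0) (Suc j)"
            "in_stair n (r ! 0) (s ! 0) (Suc j + r ! 0) (Suc (Suc j))"
            "in_stair n (r ! 0) (s ! 0) (Suc (Suc j + r ! 0)) (Suc (Suc j))"
            using j by (auto simp: in_stair_def)
          have "?g (e 0 (Suc j + r ! 0) (Suc j)) < ?g (e 0 (Suc j + r ! 0) (Suc (Suc j)))"
            using g st(1,2) unfolding R_def Ball_stair_rel by blast
          also have "\<dots> < ?g (e 0 (Suc (Suc j + r ! 0)) (Suc (Suc j)))"
            using g st(2,3) unfolding R_def Ball_stair_rel by blast
          finally show ?thesis
            using ediag[of j 0] ediag[of "Suc j" 0] gD[of j] gD[of "Suc j"] j by simp
        qed
        then show False using False order_cell_diag_iff[OF x] by blast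
      qed
      then have "(\<integral>\<^sup>+y. \<phi> x 0 y \<partial>cube (A 0)) = 0" by simp
      then have "(\<Prod>i<m. \<integral>\<^sup>+y. \<phi> x i y \<partial>cube (A i)) = 0"
        using assms(1) by (intro prod_zero) auto
      then show ?thesis using False by simp
    qed
    finally show ?thesis .
  qed
  have K: "0 \<le> K" unfolding K_def by (intro prod_nonneg) simp
  have "emeasure (cube C) {x \<in> space (cube C). \<forall>(c,d)\<in>book_rel n r s. x c < x d}
      = (\<integral>\<^sup>+x. indicator {x \<in> space (cube C). \<forall>(c,d)\<in>book_rel n r s. x c < x d} x \<partial>cube C)"
    by (rule nn_integral_indicator[OF set, symmetric])
  also have "\<dots> = (\<integral>\<^sup>+x. (\<Prod>i<m. indicator {g. \<forall>(c,d)\<in>R i. g c < g d} x) \<partial>cube C)"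
  proof (rule nn_integral_cong)
    fix x assume "x \<in> space (cube C)"
    then show "indicator {x \<in> space (cube C). \<forall>(c,d)\<in>book_rel n r s. x c < x d} x
        = (\<Prod>i<m. indicator {g. \<forall>(c,d)\<in>R i. g c < g d} x :: ennreal)"
      unfolding indicator_All_eq_prod[symmetric] book by (simp add: indicator_def)
  qed
  \<comment> \<open>Conditioning on the diagonal: its entries are the outer variables, those of all
    other cells the inner ones.\<close>
  also have "\<dots> = (\<integral>\<^sup>+x. (\<integral>\<^sup>+y. (\<Prod>i<m. indicator {g. \<forall>(c,d)\<in>R i. g c < g d} (merge ?D U (x, y))) \<partial>cube U) \<partial>cube ?D)"
    unfolding C
  proof (rule cube_nn_integral_fold[OF dj finite_diag_cells finU])
    show "(\<lambda>x. \<Prod>i<m. indicator {g. \<forall>(c,d)\<in>R i. g c < g d} x :: ennreal) \<in> borel_measurable (cube (?D \<union> U))"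
      unfolding C[symmetric]
      by (intro borel_measurable_prod_ennreal measurable_indicator_All_less finC R_C) simp
  qed
  also have "\<dots> = (\<integral>\<^sup>+x. (\<integral>\<^sup>+y. (\<Prod>i<m. \<phi> x i (restrict y (A i))) \<partial>cube U) \<partial>cube ?D)"
    by (intro nn_integral_cong prod.cong refl \<phi>_eq) simp
  also have "\<dots> = (\<integral>\<^sup>+x. indicator (order_cell ?D (diag_label n)) x * ennreal (K * ?sd x) \<partial>cube ?D)"
    by (rule nn_integral_cong) (rule inner)
  also have "\<dots> = (\<integral>\<^sup>+x. ennreal K * (indicator (order_cell ?D (diag_label n)) x * ennreal (?sd x)) \<partial>cube ?D)"
    by (simp add: ennreal_mult'[OF K] mult.left_commute)
  also have "\<dots> = ennreal K * (\<integral>\<^sup>+x. indicator (order_cell ?D (diag_label n)) x * ennreal (?sd x) \<partial>cube ?D)"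
    by (rule nn_integral_cmult)
      (intro borel_measurable_times_ennreal borel_measurable_indicator sets_order_cell
        finite_diag_cells measurable_compose[OF measurable_selberg_density measurable_ennreal])
  also have "\<dots> = ennreal (K * (selberg_value m n (sum_list r) (sum_list s) / fact n))"
    unfolding nn_integral_selberg_order_cell[OF assms(1)] by (rule ennreal_mult'[OF K, symmetric])
  finally show ?thesis unfolding K_def .
qed

lemma selberg_value_nonneg: "0 \<le> selberg_value m n r s"
  unfolding selberg_value_def by (intro mult_nonneg_nonneg prod_nonneg divide_nonneg_nonneg) auto

theorem theorem4p8:
  fixes n m :: nat and r s :: "nat list"
  assumes "0 < n" and "0 < m" and "length r = m" and "length s = m"
  shows "real (card (YB n r s)) =
    fact ((sum_list r + sum_list s + 1) * n + m * (n choose 2) + (\<Sum>i<m. r ! i * s ! i))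
    * (\<Prod>i<m. real (superfact (r ! i)) * real (superfact (s ! i))
                 / real (superfact (n + r ! i + s ! i)))
    * (2 ^ n / fact n)
    * (\<Prod>j\<in>{1..n}. real (dfact (j * m) * dfact (2 * sum_list r + (j - 1) * m)
                          * dfact (2 * sum_list s + (j - 1) * m))
         / real (dfact m * dfact (2 * sum_list r + 2 * sum_list s + 2 + (n + j - 2) * m)))"
proof -
  let ?C = "book_cells n r s"
  let ?N = "(sum_list r + sum_list s + 1) * n + m * (n choose 2) + (\<Sum>i<m. r ! i * s ! i)"
  define V where "V = (\<Prod>i<m. real (superfact (r ! i)) * superfact (s ! i) / superfact (n + r ! i + s ! i))
    * (selberg_value m n (sum_list r) (sum_list s) / fact n)"
  have len: "length s = length r" using assms by simp
  have N: "card ?C = ?N"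
    unfolding card_book_cells[OF len] book_size_def assms(3) ..
  have V: "0 \<le> V"
    unfolding V_def by (intro mult_nonneg_nonneg prod_nonneg divide_nonneg_nonneg selberg_value_nonneg) auto
  \<comment> \<open>The count is compared with the volume in \<open>ennreal\<close>; nonnegativity
    of \<open>V\<close> brings the equation back to the reals.\<close>
  have "ennreal (real (card (YB n r s))) = of_nat (card (YB n r s))"
    by (simp add: ennreal_of_nat_eq_real_of_nat)
  also have "\<dots> = fact (card ?C) * ennreal V"
    unfolding YB_eq_linear_extensions[OF len] card_linear_extensions[OF finite_book_cells book_rel_subset]
      book_volume[OF assms(2-4)] V_def ..
  also have "\<dots> = ennreal (fact ?N * V)"
    by (simp only: N ennreal_mult'[OF fact_ge_zero] ennreal_fact)
  finally have "real (card (YB n r s)) = fact ?N * V"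
    using V by (subst (asm) ennreal_inj) auto
  then show ?thesis
    unfolding V_def selberg_value_def by (simp only: mult_ac times_divide_eq_left times_divide_eq_right)
qed

end
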